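(* Let $a,b,c>0$ be constants with $a\ne b$, $q_n\to\infty$ with $q_n\le\log n$, $d=d_n\ge2$, $R=R_n$ with $R^4/(R^2+d/n)=cq_n$, $\alpha=aq_n/n$, $\beta=bq_n/n$, and $(\mathbf{y},\boldsymbol\mu,\mathbf{A},\{\mathbf{x}_i\})\sim\mathrm{CSBM}(n,d,\alpha,\beta,R)$. For the estimator $\tilde{\mathbf{u}}$ defined below, $\limsup_{n\to\infty}q_n^{-1}\log\mathbb{E}\mathcal{M}(\mathrm{sgn}(\tilde{\mathbf{u}}),\mathbf{y})\le-I^*(a,b,c)$, where $I^*(a,b,c)=[(\sqrt a-\sqrt b)^2+c]/2$. In addition, if $q_n=\log n$ and $I^*(a,b,c)>1$, then $\lim_{n\to\infty}\mathbb{P}[\mathcal{M}(\mathrm{sgn}(\tilde{\mathbf{u}}),\mathbf{y})=0]=1$.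
   Context: $\mathrm{SBM}(\mathbf{y},\alpha,\beta)$: symmetric $\mathbf{A}\in\{0,1\}^{n\times n}$, $A_{ii}=0$, $\{A_{ij}\}_{i<j}$ independent, $\mathbb{P}(A_{ij}=1)=\alpha$ if $y_i=y_j$, $\beta$ otherwise. $\mathrm{GMM}(\boldsymbol\mu,\mathbf{y})$: $\mathbf{x}_i=y_i\boldsymbol\mu+\mathbf{z}_i$, $\mathbf{z}_i$ i.i.d. $N(\mathbf{0},\mathbf{I}_d)$. $\mathrm{CSBM}(n,d,\alpha,\beta,R)$: $\mathbf{y}$ uniform on $\{\pm1\}^n$, $\boldsymbol\mu$ uniform on the radius-$R$ sphere of $\mathbb{R}^d$, independent; conditionally, $\mathbf{A}\sim\mathrm{SBM}(\mathbf{y},\alpha,\beta)$ and $\{\mathbf{x}_i\}\sim\mathrm{GMM}(\boldsymbol\mu,\mathbf{y})$ independently. $\mathbf{X}=(\mathbf{x}_1,\dots,\mathbf{x}_n)^\top$, $\mathbf{G}=\mathcal{H}(\mathbf{X}\mathbf{X}^\top)$ ($\mathcal{H}$ zeroes the diagonal); $\lambda_1(\mathbf{G})$ is the largest-in-absolute-value eigenvalue of $\mathbf{G}$ and $\mathbf{u}_1(\mathbf{G})$ an associated unit eigenvector; $\hat{\mathbf{y}}_G=\mathrm{sgn}(\mathbf{u}_1(\mathbf{G}))$ entrywise; $\mathbf{1}$ is the all-ones vector. $\tilde{\mathbf{u}}=\frac{1}{\sqrt n}\log\Big(\frac{\mathbf{1}^\top\mathbf{A}\mathbf{1}+\hat{\mathbf{y}}_G^\top\mathbf{A}\hat{\mathbf{y}}_G}{\mathbf{1}^\top\mathbf{A}\mathbf{1}-\hat{\mathbf{y}}_G^\top\mathbf{A}\hat{\mathbf{y}}_G}\Big)\mathbf{A}\hat{\mathbf{y}}_G+\frac{2\lambda_1^2(\mathbf{G})}{n\lambda_1(\mathbf{G})+nd}\mathbf{u}_1(\mathbf{G})$.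 $\mathcal{M}(\hat{\mathbf{y}},\mathbf{y})=\frac1n\min_{s=\pm1}|\{i:\hat y_i\ne sy_i\}|$. *)

theory Defs
  imports "HOL-Probability.Probability"
begin

(* Vectors in R^m are functions nat => real, only the indices < m matter;
   n x n matrices are functions nat => nat => real, only indices < n matter. *)

definition std_normal :: "real measure" where
  "std_normal = density lborel std_normal_density"

definition sign_unif :: "real measure" where
  "sign_unif = measure_pmf (pmf_of_set {-1, 1})"

definition unit_ball_unif :: "nat \<Rightarrow> (nat \<Rightarrow> real) measure" where
  "unit_ball_unif d = uniform_measure (PiM {..<d} (\<lambda>_. lborel))
     {x \<in> space (PiM {..<d} (\<lambda>_. lborel)). (\<Sum>j<d. (x j)\<^sup>2) \<le> 1}"

(* uniform (normalised surface / cone) measure on the radius-R sphere of R^d: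
   radial projection of the uniform measure on the unit ball *)
definition sphere_unif :: "nat \<Rightarrow> real \<Rightarrow> (nat \<Rightarrow> real) measure" where
  "sphere_unif d R = distr (unit_ball_unif d) (PiM {..<d} (\<lambda>_. borel))
     (\<lambda>x. \<lambda>j\<in>{..<d}. R * x j / sqrt (\<Sum>k<d. (x k)\<^sup>2))"

(* sample space of CSBM(n,d,alpha,beta,R):
   labels y, mean vector mu, uniforms U (for the edges i<j) and Gaussian noise Z *)
definition csbm_space :: "nat \<Rightarrow> nat \<Rightarrow> real \<Rightarrow>
    ((nat \<Rightarrow> real) \<times> (nat \<Rightarrow> real) \<times> (nat \<times> nat \<Rightarrow> real) \<times> (nat \<times> nat \<Rightarrow> real)) measure" where
  "csbm_space n d R =
     PiM {..<n} (\<lambda>_. sign_unif) \<Otimes>\<^sub>M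
     (sphere_unif d R \<Otimes>\<^sub>M
     (PiM {(i, j). i < j \<and> j < n} (\<lambda>_. uniform_measure lborel {0..1}) \<Otimes>\<^sub>M
      PiM ({..<n} \<times> {..<d}) (\<lambda>_. std_normal)))"

(* SBM adjacency matrix: A_ij = 1 iff U_{min(i,j),max(i,j)} < alpha (same label) / beta;
   so the A_ij, i<j, are independent Bernoulli(alpha or beta) given y *)
definition sbm_adj :: "nat \<Rightarrow> real \<Rightarrow> real \<Rightarrow> (nat \<Rightarrow> real) \<Rightarrow> (nat \<times> nat \<Rightarrow> real)
    \<Rightarrow> nat \<Rightarrow> nat \<Rightarrow> real" where
  "sbm_adj n \<alpha> \<beta> y U i j =
     (if i < n \<and> j < n \<and> i \<noteq> j then
        (if U (min i j, max i j) < (if y i = y j then \<alpha> else \<beta>) then 1 else 0)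
      else 0)"

definition gmm_X :: "(nat \<Rightarrow> real) \<Rightarrow> (nat \<Rightarrow> real) \<Rightarrow> (nat \<times> nat \<Rightarrow> real) \<Rightarrow> nat \<Rightarrow> nat \<Rightarrow> real" where
  "gmm_X y \<mu> Z i k = y i * \<mu> k + Z (i, k)"

definition gram_hollow :: "nat \<Rightarrow> nat \<Rightarrow> (nat \<Rightarrow> nat \<Rightarrow> real) \<Rightarrow> nat \<Rightarrow> nat \<Rightarrow> real" where
  "gram_hollow n d X i j =
     (if i < n \<and> j < n \<and> i \<noteq> j then (\<Sum>k<d. X i k * X j k) else 0)"

definition sym_mat :: "nat \<Rightarrow> (nat \<Rightarrow> nat \<Rightarrow> real) \<Rightarrow> bool" where
  "sym_mat n G \<longleftrightarrow> (\<forall>i<n. \<forall>j<n. G i j = G j i)"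

definition is_eigenvalue :: "nat \<Rightarrow> (nat \<Rightarrow> nat \<Rightarrow> real) \<Rightarrow> real \<Rightarrow> bool" where
  "is_eigenvalue n G l \<longleftrightarrow>
     (\<exists>v. (\<exists>i<n. v i \<noteq> 0) \<and> (\<forall>i<n. (\<Sum>j<n. G i j * v j) = l * v i))"

definition top_eigpair :: "nat \<Rightarrow> (nat \<Rightarrow> nat \<Rightarrow> real) \<Rightarrow> real \<Rightarrow> (nat \<Rightarrow> real) \<Rightarrow> bool" where
  "top_eigpair n G l u \<longleftrightarrow>
     (\<forall>l'. is_eigenvalue n G l' \<longrightarrow> \<bar>l'\<bar> \<le> \<bar>l\<bar>) \<and>
     (\<Sum>i<n. (u i)\<^sup>2) = 1 \<and> (\<forall>i<n. (\<Sum>j<n. G i j * u j) = l * u i)"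

definition mismatch :: "nat \<Rightarrow> (nat \<Rightarrow> real) \<Rightarrow> (nat \<Rightarrow> real) \<Rightarrow> real" where
  "mismatch n yh y = (1 / real n) *
     real (min (card {i. i < n \<and> yh i \<noteq> y i}) (card {i. i < n \<and> yh i \<noteq> - y i}))"

definition u_tilde :: "nat \<Rightarrow> nat \<Rightarrow> (nat \<Rightarrow> nat \<Rightarrow> real) \<Rightarrow> real \<Rightarrow> (nat \<Rightarrow> real) \<Rightarrow> nat \<Rightarrow> real" where
  "u_tilde n d A l u i =
     (let yh = (\<lambda>k. sgn (u k));
          s1 = (\<Sum>k<n. \<Sum>m<n. A k m);
          s2 = (\<Sum>k<n. \<Sum>m<n. yh k * A k m * yh m)
      in 1 / sqrt (real n) * ln ((s1 + s2) / (s1 - s2)) * (\<Sum>m<n. A i m * yh m)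
         + 2 * l\<^sup>2 / (real n * l + real n * real d) * u i)"

definition csbm_error :: "nat \<Rightarrow> nat \<Rightarrow> real \<Rightarrow> real \<Rightarrow>
    (nat \<Rightarrow> (nat \<Rightarrow> nat \<Rightarrow> real) \<Rightarrow> real \<times> (nat \<Rightarrow> real)) \<Rightarrow>
    (nat \<Rightarrow> real) \<times> (nat \<Rightarrow> real) \<times> (nat \<times> nat \<Rightarrow> real) \<times> (nat \<times> nat \<Rightarrow> real) \<Rightarrow> real" where
  "csbm_error n d \<alpha> \<beta> eig \<omega> =
     (case \<omega> of (y, \<mu>, U, Z) \<Rightarrow>
        (let A = sbm_adj n \<alpha> \<beta> y U;
             G = gram_hollow n d (gmm_X y \<mu> Z);
             l = fst (eig n G); u = snd (eig n G)
         in mismatch n (\<lambda>i. sgn (u_tilde n d A l u i)) y))"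

definition Istar :: "real \<Rightarrow> real \<Rightarrow> real \<Rightarrow> real" where
  "Istar a b c = ((sqrt a - sqrt b)\<^sup>2 + c) / 2"

end

theory Submission
  imports Defs
begin

text \<open>
  Given the labels, the graph and the Gaussian features are independent, so with the features fixed the
  misclassification probability of vertex \<open>i\<close> is bounded by \<open>exp (- x / 2)\<close> averaged over the edges, where
  \<open>x\<close> is the signed score of \<open>i\<close>. The edges contribute the factor \<open>exp (- q (\<surd>a - \<surd>b)\<^sup>2 / 2)\<close>, up to
  the fluctuation of the logarithm in \<open>u_tilde\<close>, which concentrates at scale \<open>exp (- q n)\<close>.

  There remains \<open>exp (- c q V)\<close>, where \<open>V = \<plusminus> \<surd>n y\<^sub>i u\<^sub>i\<close> is a rescaled entry of the top
  eigenvector \<open>u\<close> of the hollow Gram matrix \<open>G\<close>. Outside an event of probability \<open>exp (- 2 n)\<close>, \<open>G\<close> is a small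
  perturbation of \<open>R\<^sup>2 y y\<^sup>T\<close>. Let \<open>p\<close> be the top eigenvector of \<open>G\<close> with row and column \<open>i\<close> deleted and let
  \<open>r\<close> be the part of \<open>u\<close> orthogonal to \<open>p\<close>. The eigenvalue equation gives \<open>\<parallel>r\<parallel> \<le> 2 \<bar>u\<^sub>i\<bar>\<close>, and row
  \<open>i\<close> of \<open>G\<close> is short compared with the eigenvalue; hence \<open>u\<^sub>i\<close> agrees, up to a factor close to 1, with the
  inner product of row \<open>i\<close> with \<open>p\<close>. Since \<open>p\<close> is independent of the noise in row \<open>i\<close>, this inner
  product is conditionally Gaussian, and its moment generating function gives \<open>exp (- c q / 2)\<close>.
\<close>

section \<open>Linear algebra on functions\<close>

text \<open>The factor one half in \<open>exp (- x / 2)\<close> is the Chernoff tilt of a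
  log-likelihood ratio. \<open>ln (a / b)\<close> times a signed edge indicator is the ratio of one
  neighbour; the rescaled entry \<open>V\<close> behaves, with \<open>Q = c q\<close>, like a
  Gaussian of mean 1 and variance \<open>1 / Q\<close>, whose log-likelihood ratio between the means
  1 and -1 is \<open>2 * Q * V\<close>. At one half, each source contributes its Bhattacharyya
  exponent, and the two add up to \<open>Istar a b c\<close>. Two obstacles shape the argument. The
  initial signs depend on the features only, hence are independent of the graph, but the logarithm
  in \<open>u_tilde\<close> depends on every edge; it is exchanged for \<open>ln (a / b)\<close> at
  a price proportional to the degree of the vertex. And no delocalisation bound on \<open>u\<close>
  enters: comparing \<open>r\<close> with the entry of \<open>u\<close> itself makes the error in
  that entry relative. A relative error merely shifts the tilt of the Gaussian transform, and at the
  optimal tilt the exponent is flat to first order.\<close>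

definition ip :: "nat \<Rightarrow> (nat \<Rightarrow> real) \<Rightarrow> (nat \<Rightarrow> real) \<Rightarrow> real" where
  "ip n x y = (\<Sum>i<n. x i * y i)"

definition nrm :: "nat \<Rightarrow> (nat \<Rightarrow> real) \<Rightarrow> real" where
  "nrm n x = sqrt (ip n x x)"

definition mv :: "nat \<Rightarrow> (nat \<Rightarrow> nat \<Rightarrow> real) \<Rightarrow> (nat \<Rightarrow> real) \<Rightarrow> nat \<Rightarrow> real" where
  "mv n M x = (\<lambda>i. \<Sum>j<n. M i j * x j)"

lemma ip_commute: "ip n x y = ip n y x"
  by (simp add: ip_def mult.commute)

lemma ip_add_left: "ip n (\<lambda>i. x i + y i) z = ip n x z + ip n y z"
  by (simp add: ip_def sum.distrib algebra_simps)

lemma ip_diff_left: "ip n (\<lambda>i. x i - y i) z = ip n x z - ip n y z"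
  by (simp add: ip_def sum_subtractf algebra_simps)

lemma ip_scale_left: "ip n (\<lambda>i. a * x i) z = a * ip n x z"
  by (simp add: ip_def sum_distrib_left algebra_simps)

lemma ip_add_right: "ip n z (\<lambda>i. x i + y i) = ip n z x + ip n z y"
  by (simp add: ip_def sum.distrib algebra_simps)

lemma ip_diff_right: "ip n z (\<lambda>i. x i - y i) = ip n z x - ip n z y"
  by (simp add: ip_def sum_subtractf algebra_simps)

lemma ip_scale_right: "ip n z (\<lambda>i. a * x i) = a * ip n z x"
  by (simp add: ip_def sum_distrib_left algebra_simps)

lemmas ip_lin = ip_add_left ip_diff_left ip_scale_left ip_add_right ip_diff_right ip_scale_right

lemma ip_cong: "(\<And>i. i < n \<Longrightarrow> x i = x' i) \<Longrightarrow> (\<And>i. i < n \<Longrightarrow> y i = y' i) \<Longrightarrow> ip n x y = ip n x' y'"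
  by (simp add: ip_def)

lemma ip_self_nonneg [simp]: "0 \<le> ip n x x"
  by (simp add: ip_def sum_nonneg)

lemma ip_self_eq_0: "ip n x x = 0 \<longleftrightarrow> (\<forall>i<n. x i = 0)"
  unfolding ip_def by (subst sum_nonneg_eq_0_iff) auto

lemma nrm_nonneg [simp]: "0 \<le> nrm n x"
  by (simp add: nrm_def)

lemma nrm_sq: "(nrm n x)\<^sup>2 = ip n x x"
  by (simp add: nrm_def)

lemma nrm_scale: "nrm n (\<lambda>i. a * x i) = \<bar>a\<bar> * nrm n x"
  by (simp add: nrm_def ip_scale_left ip_scale_right real_sqrt_mult flip: mult.assoc)

lemma ip_CS: "\<bar>ip n x y\<bar> \<le> nrm n x * nrm n y"
proof -
  have "(ip n x y)\<^sup>2 \<le> ip n x x * ip n y y"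
    using Cauchy_Schwarz_ineq_sum[of x y "{..<n}"] by (simp add: ip_def power2_eq_square)
  then have "sqrt ((ip n x y)\<^sup>2) \<le> sqrt (ip n x x * ip n y y)"
    by (rule real_sqrt_le_mono)
  then show ?thesis by (simp add: nrm_def real_sqrt_mult)
qed

lemma ip_unit: "i < n \<Longrightarrow> ip n (\<lambda>j. if j = i then 1 else 0) x = x i"
  by (simp add: ip_def if_distrib[of "\<lambda>a. a * _"] cong: if_cong)

lemma nrm_unit: "i < n \<Longrightarrow> nrm n (\<lambda>j. if j = i then 1 else 0) = 1"
  by (simp add: nrm_def ip_unit)

lemma coord_le_nrm: "i < n \<Longrightarrow> \<bar>x i\<bar> \<le> nrm n x"
  using ip_CS[of n "\<lambda>j. if j = i then 1 else 0" x] by (simp add: ip_unit nrm_unit)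

lemma mv_lin: "mv n M (\<lambda>i. a * x i + b * y i) = (\<lambda>i. a * mv n M x i + b * mv n M y i)"
  by (auto simp: mv_def sum.distrib sum_distrib_left algebra_simps)

lemma mv_add: "mv n M (\<lambda>i. x i + y i) = (\<lambda>i. mv n M x i + mv n M y i)"
  using mv_lin[of n M 1 x 1 y] by simp

lemma mv_diff: "mv n M (\<lambda>i. x i - y i) = (\<lambda>i. mv n M x i - mv n M y i)"
  using mv_lin[of n M 1 x "-1" y] by simp

lemma mv_scale: "mv n M (\<lambda>i. a * x i) = (\<lambda>i. a * mv n M x i)"
  using mv_lin[of n M a x 0 x] by simp

lemma mv_cong: "(\<And>i. i < n \<Longrightarrow> x i = x' i) \<Longrightarrow> mv n M x = mv n M x'"
  by (simp add: mv_def)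

lemma ip_mv: "ip n x (mv n M y) = (\<Sum>i<n. \<Sum>j<n. M i j * x i * y j)"
  by (simp add: ip_def mv_def sum_distrib_left algebra_simps)

lemma ip_mv_sym:
  assumes "sym_mat n M"
  shows "ip n x (mv n M y) = ip n y (mv n M x)"
  unfolding ip_mv using assms
  by (subst sum.swap) (auto simp: sym_mat_def intro!: sum.cong)

text \<open>Vectors are functions on all of \<open>nat\<close>, so the sphere is cut down to those
  vanishing from \<open>n\<close> on. Compactness comes from Tychonoff: it is a closed subset of a
  product of intervals \<open>{-1..1}\<close> in the product topology.\<close>

lemma compact_unit_sphere: "compact {x :: nat \<Rightarrow> real. (\<forall>i\<ge>n. x i = 0) \<and> ip n x x = 1}"
proof -
  let ?B = "PiE UNIV (\<lambda>_::nat. {-1..1::real})"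
  let ?S = "{x :: nat \<Rightarrow> real. (\<forall>i\<ge>n. x i = 0) \<and> ip n x x = 1}"
  have "compactin (product_topology (\<lambda>_. euclidean) UNIV) ?B"
    unfolding compactin_PiE by (auto simp: compactin_euclidean_iff)
  then have B: "compact ?B"
    by (simp add: euclidean_product_topology compactin_euclidean_iff)
  have "closed {x :: nat \<Rightarrow> real. \<forall>i. n \<le> i \<longrightarrow> x i = 0}"
    by (intro closed_Collect_all closed_Collect_imp closed_Collect_eq) (auto intro: continuous_intros)
  moreover have "closed {x :: nat \<Rightarrow> real. ip n x x = 1}"
    unfolding ip_def by (intro closed_Collect_eq continuous_intros) auto
  ultimately have "closed ?S"
    by (auto simp: Collect_conj_eq intro!: closed_Int)
  moreover have "?S \<subseteq> ?B"
  proof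
    fix x assume x: "x \<in> ?S"
    have "nrm n x = 1" using x by (simp add: nrm_def)
    then have "x i \<in> {-1..1}" for i
      using coord_le_nrm[of i n x] x by (cases "i < n") (simp_all add: abs_le_iff)
    then show "x \<in> ?B" by auto
  qed
  ultimately show ?thesis
    using B compact_Int_closed[of ?B ?S] by (simp add: inf_absorb2)
qed

text \<open>A maximiser of the quadratic form on the unit sphere is an eigenvector. This turns
  \<open>top_eigpair\<close>, which compares \<open>l\<close> with eigenvalues alone, into a bound
  on the quadratic form.\<close>

lemma max_rayleigh_eigenvalue:
  assumes n: "1 \<le> n" and M: "sym_mat n M"
  obtains m where "is_eigenvalue n M m" "\<And>x. ip n x (mv n M x) \<le> m * ip n x x"
proof -
  let ?S = "{x :: nat \<Rightarrow> real. (\<forall>i\<ge>n. x i = 0) \<and> ip n x x = 1}"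
  have "continuous_on ?S (\<lambda>x. ip n x (mv n M x))"
    unfolding ip_mv
    by (intro continuous_on_sum continuous_on_mult continuous_on_const)
      (rule continuous_on_subset[OF continuous_on_product_coordinates subset_UNIV])+
  moreover have "ip n (\<lambda>j. if j = 0 then 1 else 0) (\<lambda>j. if j = 0 then 1 else 0) = 1"
    using n by (subst ip_unit) auto
  then have "(\<lambda>j. if j = 0 then 1 else 0) \<in> ?S"
    using n by simp
  then have "?S \<noteq> {}" by (rule ex_in_conv[THEN iffD1, OF exI])
  ultimately have "\<exists>w\<in>?S. \<forall>x\<in>?S. ip n x (mv n M x) \<le> ip n w (mv n M w)"
    by (intro continuous_attains_sup compact_unit_sphere)
  then obtain w where w: "w \<in> ?S"
    and wmax: "\<And>x. x \<in> ?S \<Longrightarrow> ip n x (mv n M x) \<le> ip n w (mv n M w)"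
    by meson
  define m where "m = ip n w (mv n M w)"
  have ww: "ip n w w = 1" using w by simp
  have le: "ip n x (mv n M x) \<le> m * ip n x x" for x
  proof (cases "ip n x x = 0")
    case True
    then have "ip n x (mv n M x) = ip n (\<lambda>_. 0) (mv n M x)"
      by (intro ip_cong) (auto simp: ip_self_eq_0)
    then show ?thesis using True by (simp add: ip_def)
  next
    case False
    then have pos: "ip n x x > 0" using ip_self_nonneg[of n x] by linarith
    define x' where "x' = (\<lambda>i. if i < n then x i else 0)"
    define z where "z = (\<lambda>i. (1 / sqrt (ip n x x)) * x' i)"
    have xx: "ip n x' x' = ip n x x" by (auto intro!: ip_cong simp: x'_def)
    have mx: "ip n x' (mv n M x') = ip n x (mv n M x)"
      using mv_cong[of n x' x M] by (auto intro!: ip_cong simp: x'_def)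
    have "ip n z z = 1"
      using pos unfolding z_def ip_scale_left ip_scale_right xx by simp
    then have "z \<in> ?S" by (simp add: z_def x'_def)
    from wmax[OF this] have "ip n x (mv n M x) / ip n x x \<le> m"
      unfolding z_def mv_scale ip_scale_left ip_scale_right mx m_def using pos by simp
    then show ?thesis using pos by (simp add: field_simps)
  qed
  \<comment> \<open>\<open>B\<close> is the form of \<open>m I - M\<close>: positive semidefinite
    and zero at \<open>w\<close>. Along \<open>y + t w\<close> it is therefore affine in
    \<open>t\<close>, and an affine function bounded below is constant, so \<open>w\<close> lies in
    the kernel.\<close>
  define B where "B = (\<lambda>x y. m * ip n x y - ip n x (mv n M y))"
  have Bw: "B y w = 0" for y
  proof (rule ccontr)
    assume nz: "B y w \<noteq> 0"
    have q: "0 \<le> B y y + 2 * t * B y w" for t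
    proof -
      have "0 \<le> B (\<lambda>i. y i + t * w i) (\<lambda>i. y i + t * w i)"
        using le[of "\<lambda>i. y i + t * w i"] by (simp add: B_def)
      also have "\<dots> = B y y + 2 * t * B y w + t\<^sup>2 * B w w"
        using ip_mv_sym[OF M, of w y] ip_commute[of n w y]
        by (simp add: B_def mv_add mv_scale ip_lin algebra_simps power2_eq_square)
      also have "B w w = 0" by (simp add: B_def m_def ww)
      finally show ?thesis by simp
    qed
    have "2 * (- (B y y + 1) / (2 * B y w)) * B y w = - (B y y + 1)" using nz by simp
    then show False using q[of "- (B y y + 1) / (2 * B y w)"] by linarith
  qed
  have "is_eigenvalue n M m"
    unfolding is_eigenvalue_def
  proof (intro exI[of _ w] conjI allI impI)
    have "\<not> (\<forall>i<n. w i = 0)" using ww ip_self_eq_0[of n w] by auto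
    then show "\<exists>i<n. w i \<noteq> 0" by simp
  next
    fix i assume i: "i < n"
    have "ip n (\<lambda>j. if j = i then 1 else 0) (mv n M w) = m * w i"
      using Bw[of "\<lambda>j. if j = i then 1 else 0"] i by (simp add: B_def ip_unit)
    then show "(\<Sum>j<n. M i j * w j) = m * w i"
      using i by (simp add: ip_unit) (simp add: mv_def)
  qed
  with le show ?thesis using that by blast
qed

lemma top_eigpair_rayleigh:
  assumes "1 \<le> n" "sym_mat n M" "top_eigpair n M l u"
  shows "ip n x (mv n M x) \<le> \<bar>l\<bar> * ip n x x"
proof -
  obtain m where m: "is_eigenvalue n M m" "\<And>x. ip n x (mv n M x) \<le> m * ip n x x"
    using max_rayleigh_eigenvalue[OF assms(1,2)] by blast
  have "m \<le> \<bar>l\<bar>" using assms(3) m(1) by (force simp: top_eigpair_def)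
  then show ?thesis using m(2)[of x] mult_right_mono[of m "\<bar>l\<bar>" "ip n x x"] by simp
qed

section \<open>Eigenvectors of perturbed rank one matrices\<close>

text \<open>\<open>M\<close> is \<open>K w w^T\<close> up to operator norm \<open>E\<close>. The
  vector \<open>w\<close> is not normalised, since it will be \<open>y\<close> or \<open>y\<close>
  with one entry erased. The factor 4 in \<open>gap\<close> yields \<open>l > 3 E\<close>, while
  \<open>M\<close> has norm at most \<open>3 E\<close> on the complement of \<open>v\<close>; this
  is what lets power iteration converge.\<close>

locale spiked =
  fixes n :: nat and M :: "nat \<Rightarrow> nat \<Rightarrow> real" and w :: "nat \<Rightarrow> real" and K E l :: real
    and v :: "nat \<Rightarrow> real"
  assumes n: "1 \<le> n" and sym: "sym_mat n M"
    and K: "0 < K" and E: "0 \<le> E"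
    and noise: "\<And>x z. \<bar>ip n x (mv n M z) - K * ip n w x * ip n w z\<bar> \<le> E * nrm n x * nrm n z"
    and gap: "4 * E < K * ip n w w"
    and top: "top_eigpair n M l v"
begin

lemma v_unit: "ip n v v = 1"
  using top by (simp add: top_eigpair_def ip_def power2_eq_square)

lemma nrm_v: "nrm n v = 1"
  by (simp add: nrm_def v_unit)

lemma mv_v: "i < n \<Longrightarrow> mv n M v i = l * v i"
  using top by (simp add: top_eigpair_def mv_def)

lemma ip_mv_v: "ip n x (mv n M v) = l * ip n x v"
proof -
  have "ip n x (mv n M v) = ip n x (\<lambda>i. l * v i)"
    by (intro ip_cong) (auto simp: mv_v)
  then show ?thesis by (simp add: ip_scale_right)
qed

lemma ip_v_mv: "ip n v (mv n M x) = l * ip n x v"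
  using ip_mv_sym[OF sym, of v x] ip_mv_v by simp

lemma ww_pos: "0 < ip n w w"
proof -
  have "0 < K * ip n w w" using gap E by linarith
  then show ?thesis using K zero_less_mult_pos by blast
qed

lemma l_eq: "\<bar>l - K * (ip n w v)\<^sup>2\<bar> \<le> E"
  using noise[of v v] by (simp add: ip_mv_v v_unit nrm_v power2_eq_square)

lemma wv_le: "(ip n w v)\<^sup>2 \<le> ip n w w"
proof -
  have "(ip n w v)\<^sup>2 \<le> (nrm n w * nrm n v)\<^sup>2"
    using ip_CS[of n w v] power_mono[of "\<bar>ip n w v\<bar>" _ 2] by auto
  then show ?thesis by (simp add: nrm_v nrm_sq)
qed

text \<open>\<open>w\<close> serves as test vector. Only the absolute value is bounded at this
  point, because \<open>top_eigpair\<close> ranks eigenvalues by size.\<close>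

lemma abs_l_ge: "K * ip n w w - E \<le> \<bar>l\<bar>"
proof -
  have "ip n w (mv n M w) \<le> \<bar>l\<bar> * ip n w w"
    using top_eigpair_rayleigh[OF n sym top] .
  moreover have "K * ip n w w * ip n w w - E * ip n w w \<le> ip n w (mv n M w)"
    using noise[of w w] nrm_sq[of n w] by (simp add: abs_le_iff power2_eq_square mult.assoc)
  ultimately have "(K * ip n w w - E) * ip n w w \<le> \<bar>l\<bar> * ip n w w"
    by (simp add: algebra_simps)
  then show ?thesis using ww_pos by simp
qed

text \<open>The spike is positive, so \<open>l \<ge> - E\<close>; since the absolute value of
  \<open>l\<close> exceeds \<open>3 E\<close>, a negative \<open>l\<close> is excluded.\<close>

lemma l_pos: "0 < l"
proof -
  have "0 \<le> K * (ip n w v)\<^sup>2" using K by simp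
  then have "- E \<le> l" using l_eq by linarith
  then show ?thesis using abs_l_ge gap E by linarith
qed

lemma l_ge: "K * ip n w w - E \<le> l"
  using abs_l_ge l_pos by simp

lemma l_le: "l \<le> K * ip n w w + E"
proof -
  have "K * (ip n w v)\<^sup>2 \<le> K * ip n w w" using wv_le K by simp
  then show ?thesis using l_eq by linarith
qed

lemma wv_ge: "ip n w w - 2 * E / K \<le> (ip n w v)\<^sup>2"
proof -
  have "K * ip n w w - 2 * E \<le> K * (ip n w v)\<^sup>2" using l_eq l_ge by linarith
  then show ?thesis using K by (simp add: field_simps)
qed

lemma wv_nz: "ip n w v \<noteq> 0"
proof
  assume "ip n w v = 0"
  then have "K * ip n w w \<le> 2 * E" using wv_ge K by (simp add: field_simps)
  then show False using gap E by linarith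
qed

text \<open>Removing from \<open>w\<close> its projection on \<open>v\<close> does not change the
  product with \<open>r\<close>, and by \<open>wv_ge\<close> the remainder has squared norm at most
  \<open>2 * E / K\<close>.\<close>

lemma orth_w:
  assumes "ip n r v = 0"
  shows "(ip n w r)\<^sup>2 \<le> 2 * E / K * ip n r r"
proof -
  let ?w = "\<lambda>i. w i - ip n w v * v i"
  have "ip n w r = ip n ?w r"
    using assms by (simp add: ip_lin ip_commute[of n v])
  then have "\<bar>ip n w r\<bar> \<le> nrm n ?w * nrm n r" using ip_CS by simp
  then have "(ip n w r)\<^sup>2 \<le> (nrm n ?w)\<^sup>2 * (nrm n r)\<^sup>2"
    using power_mono[of "\<bar>ip n w r\<bar>" "nrm n ?w * nrm n r" 2] by (simp add: power_mult_distrib)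
  also have "(nrm n ?w)\<^sup>2 = ip n w w - (ip n w v)\<^sup>2"
    unfolding nrm_sq ip_lin v_unit using ip_commute[of n v w] by (simp add: power2_eq_square)
  also have "\<dots> * (nrm n r)\<^sup>2 \<le> 2 * E / K * (nrm n r)\<^sup>2"
    using wv_ge by (intro mult_right_mono) auto
  finally show ?thesis by (simp add: nrm_sq)
qed

lemma orth_abs:
  assumes "ip n r v = 0"
  shows "\<bar>ip n w r\<bar> \<le> sqrt (2 * E / K) * nrm n r"
  using real_sqrt_le_mono[OF orth_w[OF assms]] by (simp only: nrm_def real_sqrt_mult[symmetric]) simp

text \<open>On the complement of \<open>v\<close> the spike is worth at most \<open>2 E\<close> by
  \<open>orth_abs\<close>, and the noise another \<open>E\<close>.\<close>

lemma orth_form: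
  assumes "ip n r v = 0" "ip n x v = 0"
  shows "\<bar>ip n x (mv n M r)\<bar> \<le> 3 * E * nrm n x * nrm n r"
proof -
  have "\<bar>ip n w x * ip n w r\<bar> \<le> (sqrt (2 * E / K) * nrm n x) * (sqrt (2 * E / K) * nrm n r)"
    unfolding abs_mult using orth_abs assms K E by (intro mult_mono) auto
  also have "\<dots> = 2 * E / K * nrm n x * nrm n r"
  proof -
    have "sqrt (2 * E / K) * sqrt (2 * E / K) = 2 * E / K" using K E by simp
    then show ?thesis by algebra
  qed
  finally have "K * \<bar>ip n w x * ip n w r\<bar> \<le> 2 * E * nrm n x * nrm n r"
    using K by (simp add: field_simps)
  then have "\<bar>K * ip n w x * ip n w r\<bar> \<le> 2 * E * nrm n x * nrm n r"
    using K by (simp add: abs_mult mult.assoc)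
  then show ?thesis using noise[of x r] by (auto simp: abs_le_iff)
qed

text \<open>Symmetry makes the complement of \<open>v\<close> invariant; the norm bound results from
  testing \<open>orth_form\<close> against \<open>mv n M r\<close> itself.\<close>

lemma orth_mv:
  assumes r: "ip n r v = 0"
  shows "ip n (mv n M r) v = 0" "nrm n (mv n M r) \<le> 3 * E * nrm n r"
proof -
  show o: "ip n (mv n M r) v = 0"
    using r ip_v_mv[of r] by (simp add: ip_commute)
  have "(nrm n (mv n M r))\<^sup>2 \<le> 3 * E * nrm n (mv n M r) * nrm n r"
    using orth_form[OF r o] by (simp add: nrm_sq)
  then have "nrm n (mv n M r) * nrm n (mv n M r) \<le> nrm n (mv n M r) * (3 * E * nrm n r)"
    by (simp add: power2_eq_square algebra_simps)
  then show "nrm n (mv n M r) \<le> 3 * E * nrm n r"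
    using E nrm_nonneg[of n "mv n M r"] nrm_nonneg[of n r]
    by (cases "nrm n (mv n M r) = 0") (auto simp: mult_le_cancel_left)
qed

text \<open>Dividing by the product with \<open>y\<close> removes the growth \<open>l ^ k\<close>
  and also the sign of \<open>v\<close>, so the limit does not depend on which of the two unit
  eigenvectors is meant. Convergence is geometric with ratio \<open>3 * E / l\<close>.\<close>

lemma power_method:
  assumes y: "ip n y v \<noteq> 0" and j: "j < n"
  shows "(\<lambda>k. (mv n M ^^ k) y j / ip n y ((mv n M ^^ k) y)) \<longlonglongrightarrow> v j / ip n y v"
proof -
  define r where "r = (\<lambda>i. y i - ip n y v * v i)"
  have orth: "ip n ((mv n M ^^ k) r) v = 0 \<and> nrm n ((mv n M ^^ k) r) \<le> (3 * E) ^ k * nrm n r" for k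
  proof (induction k)
    case 0
    show ?case by (simp add: r_def ip_lin v_unit)
  next
    case (Suc k)
    then have "nrm n (mv n M ((mv n M ^^ k) r)) \<le> 3 * E * nrm n ((mv n M ^^ k) r)"
      by (intro orth_mv) simp
    also have "\<dots> \<le> 3 * E * ((3 * E) ^ k * nrm n r)"
      using Suc E by (intro mult_left_mono) auto
    finally show ?case using orth_mv(1) Suc by (simp add: mult.assoc)
  qed
  have dec: "i < n \<Longrightarrow> (mv n M ^^ k) y i = l ^ k * ip n y v * v i + (mv n M ^^ k) r i" for k i
  proof (induction k arbitrary: i)
    case 0
    show ?case by (simp add: r_def)
  next
    case (Suc k)
    have "mv n M ((mv n M ^^ k) y) = mv n M (\<lambda>i. (l ^ k * ip n y v) * v i + 1 * (mv n M ^^ k) r i)"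
      by (intro mv_cong) (auto simp: Suc.IH)
    also have "\<dots> = (\<lambda>i. (l ^ k * ip n y v) * mv n M v i + 1 * mv n M ((mv n M ^^ k) r) i)"
      by (rule mv_lin)
    finally show ?case using Suc.prems by (simp add: mv_v)
  qed
  have small: "(\<lambda>k. (mv n M ^^ k) r i / l ^ k) \<longlonglongrightarrow> 0" if i: "i < n" for i
  proof (rule Lim_null_comparison)
    show "\<forall>\<^sub>F k in sequentially. norm ((mv n M ^^ k) r i / l ^ k) \<le> (3 * E / l) ^ k * nrm n r"
    proof (intro always_eventually allI)
      fix k
      have "\<bar>(mv n M ^^ k) r i\<bar> \<le> (3 * E) ^ k * nrm n r"
        using coord_le_nrm[OF i, of "(mv n M ^^ k) r"] orth[of k] by linarith
      then show "norm ((mv n M ^^ k) r i / l ^ k) \<le> (3 * E / l) ^ k * nrm n r"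
        using l_pos by (simp add: power_divide divide_right_mono field_simps)
    qed
    have "3 * E / l < 1" "0 \<le> 3 * E / l"
      using l_pos l_ge gap E by (auto simp: field_simps)
    then have "(\<lambda>k. (3 * E / l) ^ k) \<longlonglongrightarrow> 0" by (intro LIMSEQ_power_zero) auto
    then show "(\<lambda>k. (3 * E / l) ^ k * nrm n r) \<longlonglongrightarrow> 0" by (rule tendsto_mult_left_zero)
  qed
  have lim: "(\<lambda>k. (mv n M ^^ k) y i / l ^ k) \<longlonglongrightarrow> ip n y v * v i" if i: "i < n" for i
  proof -
    have "(\<lambda>k. ip n y v * v i + (mv n M ^^ k) r i / l ^ k) \<longlonglongrightarrow> ip n y v * v i + 0"
      by (intro tendsto_intros small i)
    moreover have "(mv n M ^^ k) y i / l ^ k = ip n y v * v i + (mv n M ^^ k) r i / l ^ k" for k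
      using l_pos by (simp add: dec[OF i] add_divide_distrib)
    ultimately show ?thesis by simp
  qed
  have "(\<lambda>k. \<Sum>i<n. y i * ((mv n M ^^ k) y i / l ^ k)) \<longlonglongrightarrow> (\<Sum>i<n. y i * (ip n y v * v i))"
    by (intro tendsto_sum tendsto_mult tendsto_const lim) auto
  moreover have "(\<Sum>i<n. y i * (ip n y v * v i)) = (ip n y v)\<^sup>2"
    using ip_scale_right[of n y "ip n y v" v] by (simp add: ip_def power2_eq_square)
  moreover have "(\<Sum>i<n. y i * ((mv n M ^^ k) y i / l ^ k)) = ip n y ((mv n M ^^ k) y) / l ^ k" for k
    by (simp add: ip_def sum_divide_distrib)
  ultimately have limy: "(\<lambda>k. ip n y ((mv n M ^^ k) y) / l ^ k) \<longlonglongrightarrow> (ip n y v)\<^sup>2"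
    by simp
  have "(\<lambda>k. ((mv n M ^^ k) y j / l ^ k) / (ip n y ((mv n M ^^ k) y) / l ^ k))
      \<longlonglongrightarrow> (ip n y v * v j) / (ip n y v)\<^sup>2"
    using y by (intro tendsto_divide lim limy j) auto
  then show ?thesis using y l_pos by (simp add: power2_eq_square)
qed

end

section \<open>Leave-one-out comparison of top eigenvectors\<close>

definition loo_mat :: "nat \<Rightarrow> (nat \<Rightarrow> nat \<Rightarrow> real) \<Rightarrow> nat \<Rightarrow> nat \<Rightarrow> real" where
  "loo_mat i G j k = (if j = i \<or> k = i then 0 else G j k)"

text \<open>The top eigenvector of \<open>loo_mat i G\<close>, normalised by \<open>ip n y p = n\<close>. Writing it as a limit of
  power iterates makes it a measurable function of the entries.\<close>

definition loo_vec :: "nat \<Rightarrow> (nat \<Rightarrow> nat \<Rightarrow> real) \<Rightarrow> (nat \<Rightarrow> real) \<Rightarrow> nat \<Rightarrow> nat \<Rightarrow> real" where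
  "loo_vec n G y i j =
     real n * lim (\<lambda>k. (mv n (loo_mat i G) ^^ k) y j / ip n y ((mv n (loo_mat i G) ^^ k) y))"

text \<open>\<open>\<Lambda>\<close> is the eigenvalue of the spike (later \<open>n * r2\<close>)
  and \<open>\<rho>\<close> the relative noise level. The assumption \<open>large\<close> says
  \<open>1 / sqrt n \<le> \<rho>\<close>, so that the share of the spike in a single row counts as
  noise.\<close>

locale noisy_signs =
  fixes n :: nat and G :: "nat \<Rightarrow> nat \<Rightarrow> real" and y :: "nat \<Rightarrow> real" and \<Lambda> \<rho> l :: real
    and u :: "nat \<Rightarrow> real"
  assumes n: "1 \<le> n" and sym: "sym_mat n G" and y: "\<And>j. j < n \<Longrightarrow> (y j)\<^sup>2 = 1"
    and \<Lambda>: "0 < \<Lambda>" and \<rho>: "0 < \<rho>" "\<rho> \<le> 1/100" and large: "1 \<le> \<rho>\<^sup>2 * n"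
    and noise: "\<And>x z. \<bar>ip n x (mv n G z) - \<Lambda> / n * ip n y x * ip n y z\<bar> \<le> \<rho> * \<Lambda> * nrm n x * nrm n z"
    and top: "top_eigpair n G l u"
begin

lemma yy: "ip n y y = n"
  using y by (simp add: ip_def power2_eq_square)

lemma nrm_y: "nrm n y = sqrt n"
  by (simp add: nrm_def yy)

lemma n_pos: "0 < real n" using n by simp

lemma inv_n_le: "1 / n \<le> \<rho>"
proof -
  have "1 \<le> \<rho> * (\<rho> * n)" using large by (simp add: power2_eq_square mult.assoc)
  also have "\<dots> \<le> 1 * (\<rho> * n)" using \<rho> by (intro mult_right_mono) auto
  finally show ?thesis using n_pos by (simp add: field_simps)
qed

sublocale G: spiked n G y "\<Lambda> / n" "\<rho> * \<Lambda>" l u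
proof
  show "4 * (\<rho> * \<Lambda>) < \<Lambda> / real n * ip n y y" using \<Lambda> \<rho> n_pos by (simp add: yy)
qed (use n sym \<Lambda> \<rho> noise top n_pos in auto)

definition s :: real where "s = sgn (ip n y u)"

lemma l_bounds: "(1 - \<rho>) * \<Lambda> \<le> l" "l \<le> (1 + \<rho>) * \<Lambda>"
  using G.l_ge G.l_le n_pos by (auto simp: yy algebra_simps)

lemma s_cases: "s = 1 \<or> s = -1"
  using G.wv_nz by (simp add: s_def sgn_real_def)

text \<open>Since \<open>1 - e\<close> dominates its square, the bound on the squared correlation
  passes to the correlation itself with the same \<open>e\<close>; expanding the square then gives a
  distance linear in \<open>e\<close>. It serves \<open>u\<close> and the leave-one-out vector
  \<open>\<psi>\<close> alike.\<close>

lemma signed_distance: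
  assumes v: "ip n v v = 1" and le: "real n * (1 - e) \<le> (ip n y v)\<^sup>2" and e: "0 \<le> e" "e \<le> 1"
    and nz: "ip n y v \<noteq> 0"
  shows "sqrt n * (1 - e) \<le> \<bar>ip n y v\<bar>"
    and "ip n (\<lambda>j. sqrt n * sgn (ip n y v) * v j - y j) (\<lambda>j. sqrt n * sgn (ip n y v) * v j - y j) \<le> 2 * e * n"
proof -
  have "real n * (1 - e)\<^sup>2 \<le> real n * (1 - e)"
    using e by (intro mult_left_mono) (auto simp: power2_eq_square mult_left_le_one_le)
  then have "(sqrt n * (1 - e))\<^sup>2 \<le> \<bar>ip n y v\<bar>\<^sup>2" using le by (simp add: power_mult_distrib)
  then show *: "sqrt n * (1 - e) \<le> \<bar>ip n y v\<bar>" by (rule power2_le_imp_le) simp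
  have sg: "sgn (ip n y v) * ip n y v = \<bar>ip n y v\<bar>" "sgn (ip n y v) * sgn (ip n y v) = 1"
    using nz by (auto simp: sgn_real_def)
  have "ip n (\<lambda>j. sqrt n * sgn (ip n y v) * v j - y j) (\<lambda>j. sqrt n * sgn (ip n y v) * v j - y j)
    = (sqrt n * sqrt n) * (sgn (ip n y v) * sgn (ip n y v)) + n - 2 * sqrt n * (sgn (ip n y v) * ip n y v)"
    unfolding ip_lin v yy using ip_commute[of n v y] by (simp add: algebra_simps)
  also have "\<dots> = 2 * n - 2 * sqrt n * \<bar>ip n y v\<bar>" unfolding sg by simp
  also have "\<dots> \<le> 2 * n - 2 * sqrt n * (sqrt n * (1 - e))"
    using mult_left_mono[OF *, of "2 * sqrt n"] by simp
  also have "\<dots> = 2 * e * n"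
  proof -
    have "2 * sqrt n * (sqrt n * (1 - e)) = 2 * (sqrt n * sqrt n) * (1 - e)" by (simp only: mult_ac)
    then show ?thesis by (simp add: algebra_simps)
  qed
  finally show "ip n (\<lambda>j. sqrt n * sgn (ip n y v) * v j - y j) (\<lambda>j. sqrt n * sgn (ip n y v) * v j - y j) \<le> 2 * e * n" .
qed

lemma yu_sq: "real n * (1 - 2 * \<rho>) \<le> (ip n y u)\<^sup>2"
  using G.wv_ge \<Lambda> n_pos by (simp add: yy algebra_simps)

lemma distance:
  "ip n (\<lambda>j. sqrt n * s * u j - y j) (\<lambda>j. sqrt n * s * u j - y j) \<le> 4 * \<rho> * n"
  using signed_distance(2)[OF G.v_unit yu_sq _ _ G.wv_nz] \<rho> by (simp add: s_def)

text \<open>A wrong or zero sign makes \<open>s * u j * y j\<close> nonpositive, so the coordinate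
  contributes at least 1 to the squared distance in \<open>distance\<close>.\<close>

lemma mismatch_le: "card {j. j < n \<and> sgn (u j) \<noteq> s * y j} \<le> 4 * \<rho> * n"
proof -
  let ?B = "{j. j < n \<and> sgn (u j) \<noteq> s * y j}"
  have "real (card ?B) = (\<Sum>j\<in>?B. 1)" by simp
  also have "\<dots> \<le> (\<Sum>j\<in>?B. (sqrt n * s * u j - y j)\<^sup>2)"
  proof (rule sum_mono)
    fix j assume j: "j \<in> ?B"
    then have yj: "y j = 1 \<or> y j = -1" using y[of j] by (auto simp: power2_eq_1_iff)
    have "s * u j * y j \<le> 0"
      using j s_cases yj by (auto simp: sgn_real_def split: if_splits)
    then have "0 \<le> - (sqrt n * (s * u j * y j))" by (simp add: mult_nonneg_nonpos)
    moreover have "(sqrt n * s * u j - y j)\<^sup>2 = (sqrt n * s * u j)\<^sup>2 + 1 - 2 * (sqrt n * (s * u j * y j))"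
      using y[of j] j by (simp add: power2_diff)
    ultimately show "1 \<le> (sqrt n * s * u j - y j)\<^sup>2"
      using zero_le_power2[of "sqrt n * s * u j"] by linarith
  qed
  also have "\<dots> \<le> (\<Sum>j<n. (sqrt n * s * u j - y j)\<^sup>2)"
    by (intro sum_mono2) auto
  also have "\<dots> \<le> 4 * \<rho> * n" using distance by (simp add: ip_def power2_eq_square)
  finally show ?thesis .
qed

context
  fixes i :: nat and lm :: real and \<psi> :: "nat \<Rightarrow> real"
  assumes i: "i < n" and Gii: "G i i = 0" and topM: "top_eigpair n (loo_mat i G) lm \<psi>"
begin

lemma zeroed_sq: "ip n (\<lambda>j. if j = i then 0 else y j) (\<lambda>j. if j = i then 0 else y j) = real n - 1"
proof -
  have "ip n (\<lambda>j. if j = i then 0 else y j) (\<lambda>j. if j = i then 0 else y j) = (\<Sum>j<n. (1::real) - (if j = i then 1 else 0))"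
    unfolding ip_def using y by (intro sum.cong) (auto simp: power2_eq_square)
  then show ?thesis using i by (simp add: sum_subtractf)
qed

text \<open>Erasing entry \<open>i\<close> of the test vectors turns a form of
  \<open>loo_mat i G\<close> into a form of \<open>G\<close>, so the noise bound is inherited with
  the same constant. The spike loses a fraction \<open>1 / n\<close> of its mass, which the slack in
  \<open>gap\<close> covers.\<close>

interpretation M: spiked n "loo_mat i G" "\<lambda>j. if j = i then 0 else y j" "\<Lambda> / n" "\<rho> * \<Lambda>" lm \<psi>
proof
  have "4 * \<rho> * \<Lambda> < (1 - 1 / n) * \<Lambda>"
    using \<rho> inv_n_le \<Lambda> by (intro mult_strict_right_mono) auto
  then show "4 * (\<rho> * \<Lambda>) < \<Lambda> / real n * ip n (\<lambda>j. if j = i then 0 else y j) (\<lambda>j. if j = i then 0 else y j)"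
    unfolding zeroed_sq using n_pos by (simp add: field_simps)
  show "sym_mat n (loo_mat i G)" using sym by (auto simp: sym_mat_def loo_mat_def)
  fix x z :: "nat \<Rightarrow> real"
  define x' where "x' = (\<lambda>j. if j = i then 0 else x j)"
  define z' where "z' = (\<lambda>j. if j = i then 0 else z j)"
  have sub: "nrm n (\<lambda>j. if j = i then 0 else x j) \<le> nrm n x" for x :: "nat \<Rightarrow> real"
    unfolding nrm_def ip_def by (intro real_sqrt_le_mono sum_mono) auto
  have eq1: "ip n x (mv n (loo_mat i G) z) = ip n x' (mv n G z')"
    unfolding ip_mv by (intro sum.cong) (auto simp: loo_mat_def x'_def z'_def)
  have eq2: "ip n (\<lambda>j. if j = i then 0 else y j) x = ip n y x'"
    "ip n (\<lambda>j. if j = i then 0 else y j) z = ip n y z'"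
    unfolding ip_def by (auto intro!: sum.cong simp: x'_def z'_def)
  have "\<rho> * \<Lambda> * nrm n x' * nrm n z' \<le> \<rho> * \<Lambda> * nrm n x * nrm n z"
    unfolding x'_def z'_def using \<rho> \<Lambda> by (intro mult_mono sub) auto
  then show "\<bar>ip n x (mv n (loo_mat i G) z) - \<Lambda> / n * ip n (\<lambda>j. if j = i then 0 else y j) x
     * ip n (\<lambda>j. if j = i then 0 else y j) z\<bar> \<le> \<rho> * \<Lambda> * nrm n x * nrm n z"
    unfolding eq1 eq2 using noise[of x' z'] by linarith
qed (use n \<Lambda> \<rho> topM n_pos in auto)

lemma psi_i: "\<psi> i = 0"
  using M.mv_v[OF i] M.l_pos by (simp add: mv_def loo_mat_def)

lemma ip_zeroed: "ip n (\<lambda>j. if j = i then 0 else y j) \<psi> = ip n y \<psi>"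
  unfolding ip_def using psi_i by (intro sum.cong) auto

lemma y_psi_sq: "real n * (1 - 3 * \<rho>) \<le> (ip n y \<psi>)\<^sup>2"
proof -
  have "1 \<le> \<rho> * n" using inv_n_le n_pos by (simp add: field_simps)
  then show ?thesis using M.wv_ge \<Lambda> n_pos unfolding zeroed_sq ip_zeroed by (simp add: algebra_simps)
qed

lemma y_psi_nz: "ip n y \<psi> \<noteq> 0"
  using M.wv_nz by (simp add: ip_zeroed)

text \<open>Ties the limit in \<open>loo_vec\<close> to an arbitrary top eigenvector
  \<open>\<psi>\<close>: its sign cancels in the quotient.\<close>

lemma loo_vec_eq: "j < n \<Longrightarrow> loo_vec n G y i j = n / ip n y \<psi> * \<psi> j"
  using limI[OF M.power_method[OF y_psi_nz]] by (simp add: loo_vec_def)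

lemma loo_vec_i: "loo_vec n G y i i = 0"
  by (simp add: loo_vec_eq i psi_i)

lemma ip_y_loo: "ip n y (loo_vec n G y i) = n"
proof -
  have "ip n y (loo_vec n G y i) = ip n y (\<lambda>j. n / ip n y \<psi> * \<psi> j)"
    by (intro ip_cong) (auto simp: loo_vec_eq)
  then show ?thesis using y_psi_nz unfolding ip_scale_right by simp
qed

lemma loo_sq: "ip n (loo_vec n G y i) (loo_vec n G y i) \<le> n * (1 + 4 * \<rho>)"
proof -
  have "ip n (loo_vec n G y i) (loo_vec n G y i) = ip n (\<lambda>j. n / ip n y \<psi> * \<psi> j) (\<lambda>j. n / ip n y \<psi> * \<psi> j)"
    by (intro ip_cong) (auto simp: loo_vec_eq)
  also have "\<dots> = real n * n / (ip n y \<psi>)\<^sup>2"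
    unfolding ip_scale_right ip_scale_left M.v_unit by (simp add: power2_eq_square)
  also have "\<dots> \<le> n * (1 + 4 * \<rho>)"
  proof -
    have "1 \<le> (1 - 3 * \<rho>) * (1 + 4 * \<rho>)"
      using mult_left_mono[of "12 * \<rho>" 1 \<rho>] \<rho> by (simp add: algebra_simps)
    then have "real n * 1 \<le> real n * ((1 - 3 * \<rho>) * (1 + 4 * \<rho>))"
      by (intro mult_left_mono) auto
    also have "\<dots> \<le> (ip n y \<psi>)\<^sup>2 * (1 + 4 * \<rho>)"
      using mult_right_mono[OF y_psi_sq, of "1 + 4 * \<rho>"] \<rho> by (simp add: algebra_simps)
    finally have "real n * n \<le> n * ((1 + 4 * \<rho>) * (ip n y \<psi>)\<^sup>2)"
      using n_pos by (simp add: mult.commute)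
    then show ?thesis using y_psi_nz by (simp add: divide_le_eq mult.assoc)
  qed
  finally show ?thesis .
qed

text \<open>\<open>u\<close> is split into its overlap with \<open>\<psi>\<close> and an orthogonal
  part. Because \<open>\<psi> i = 0\<close>, the orthogonal part carries the whole entry:
  \<open>res i = u i\<close>.\<close>

definition "kap = ip n u \<psi>"
definition "res = (\<lambda>j. u j - kap * \<psi> j)"

lemma res_orth: "ip n res \<psi> = 0"
  by (simp add: res_def ip_lin M.v_unit kap_def)

lemma ip_res_u: "ip n res u = ip n res res"
proof -
  have "ip n res res = ip n res u - kap * ip n res \<psi>"
    unfolding res_def ip_diff_right ip_scale_right by simp
  then show ?thesis by (simp add: res_orth)
qed

text \<open>A row is \<open>G\<close> tested on a coordinate vector. The noise gives
  \<open>\<rho> * \<Lambda>\<close>; the spike gives \<open>\<Lambda> / sqrt n\<close>, which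
  \<open>large\<close> bounds by \<open>\<rho> * \<Lambda>\<close> once more.\<close>

lemma row_bound: "\<bar>ip n (G i) x\<bar> \<le> 2 * \<rho> * \<Lambda> * nrm n x"
proof -
  let ?e = "\<lambda>j. if j = i then 1 else 0 :: real"
  have "\<bar>ip n ?e (mv n G x) - \<Lambda> / n * ip n y ?e * ip n y x\<bar> \<le> \<rho> * \<Lambda> * nrm n ?e * nrm n x"
    by (rule noise)
  moreover have "ip n ?e (mv n G x) = ip n (G i) x" using i by (simp add: ip_unit) (simp add: mv_def ip_def)
  moreover have "ip n y ?e = y i" using ip_unit[OF i, of y] by (simp add: ip_commute)
  ultimately have 1: "\<bar>ip n (G i) x - \<Lambda> / n * y i * ip n y x\<bar> \<le> \<rho> * \<Lambda> * nrm n x"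
    using i by (simp add: nrm_unit)
  have yi: "\<bar>y i\<bar> = 1" using y[OF i] by (auto simp: power2_eq_1_iff)
  have "\<bar>\<Lambda> / n * y i * ip n y x\<bar> = \<Lambda> / n * \<bar>ip n y x\<bar>"
    using \<Lambda> by (simp add: abs_mult yi)
  also have "\<dots> \<le> \<Lambda> / n * (sqrt n * nrm n x)"
    using ip_CS[of n y x] \<Lambda> by (intro mult_left_mono) (auto simp: nrm_y)
  also have "\<dots> = \<Lambda> * nrm n x * (1 / sqrt n)"
  proof -
    have "sqrt n / n = 1 / sqrt n" using n_pos by (simp add: sqrt_divide_self_eq inverse_eq_divide)
    moreover have "\<Lambda> / n * (sqrt n * nrm n x) = \<Lambda> * nrm n x * (sqrt n / n)" by simp
    ultimately show ?thesis by simp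
  qed
  also have "\<dots> \<le> \<Lambda> * nrm n x * \<rho>"
  proof (rule mult_left_mono)
    have "sqrt 1 \<le> sqrt (\<rho>\<^sup>2 * n)" using large by (intro real_sqrt_le_mono)
    then have "1 \<le> \<rho> * sqrt n" using \<rho> by (simp add: real_sqrt_mult)
    then show "1 / sqrt n \<le> \<rho>" using n_pos by (simp add: field_simps)
  qed (use \<Lambda> in auto)
  finally have "\<bar>\<Lambda> / n * y i * ip n y x\<bar> \<le> \<rho> * \<Lambda> * nrm n x" by (simp only: mult_ac)
  moreover have "2 * \<rho> * \<Lambda> * nrm n x = 2 * (\<rho> * \<Lambda> * nrm n x)" by simp
  ultimately show ?thesis using 1 by linarith
qed

text \<open>The leave-one-out matrix maps \<open>u\<close> to \<open>l u\<close> minus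
  \<open>u i\<close> times row \<open>i\<close>, with an extra \<open>- l * u i\<close> at
  coordinate \<open>i\<close>. The \<open>\<psi>\<close> part of the second argument disappears
  because its image is a multiple of \<open>\<psi>\<close>, orthogonal to
  \<open>res\<close>.\<close>

lemma res_form: "ip n res (mv n (loo_mat i G) res) = l * ip n res res - l * (u i)\<^sup>2 - u i * ip n (G i) res"
proof -
  have mvM: "mv n (loo_mat i G) u j = l * u j - u i * G i j - (if j = i then l * u i else 0)" if j: "j < n" for j
  proof (cases "j = i")
    case True then show ?thesis by (simp add: mv_def loo_mat_def Gii)
  next
    case False
    have "mv n (loo_mat i G) u j = (\<Sum>k<n. G j k * u k - (if k = i then G j i * u i else 0))"
      unfolding mv_def using False by (intro sum.cong) (auto simp: loo_mat_def)
    also have "\<dots> = mv n G u j - G j i * u i" using i by (simp add: sum_subtractf mv_def)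
    finally show ?thesis using False G.mv_v[OF j] sym i j by (simp add: sym_mat_def)
  qed
  have "mv n (loo_mat i G) res = (\<lambda>j. mv n (loo_mat i G) u j - kap * mv n (loo_mat i G) \<psi> j)"
    unfolding res_def mv_diff mv_scale ..
  then have "ip n res (mv n (loo_mat i G) res) = ip n res (mv n (loo_mat i G) u)"
    using res_orth by (simp add: ip_lin M.ip_mv_v)
  also have "\<dots> = ip n res (\<lambda>j. l * u j - u i * G i j - l * u i * (if j = i then 1 else 0))"
    by (intro ip_cong) (auto simp: mvM)
  also have "\<dots> = l * ip n res u - u i * ip n res (G i) - l * u i * ip n res (\<lambda>j. if j = i then 1 else 0)"
    unfolding ip_lin ..
  also have "ip n res (\<lambda>j. if j = i then 1 else 0) = u i"
    using ip_unit[OF i, of res] psi_i by (simp add: ip_commute) (simp add: res_def)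
  finally show ?thesis by (simp add: ip_res_u ip_commute[of n res "G i"] power2_eq_square)
qed

text \<open>Orthogonality to \<open>\<psi>\<close> makes the leave-one-out form at
  \<open>res\<close> small, of order \<open>3 \<rho> \<Lambda>\<close> per unit of squared norm,
  whereas \<open>res_form\<close> makes it roughly \<open>l\<close> times the squared norm of
  \<open>res\<close> minus \<open>l * (u i)\<^sup>2\<close>. Both are possible only if
  \<open>res\<close> is no longer than a multiple of the entry; beyond the factor 2 they lead to
  \<open>3 \<le> 21 * \<rho>\<close>.\<close>

lemma res_le: "nrm n res \<le> 2 * \<bar>u i\<bar>"
proof (rule ccontr)
  define a b where "a = nrm n res" and "b = \<bar>u i\<bar>"
  assume "\<not> nrm n res \<le> 2 * \<bar>u i\<bar>"
  then have ab: "2 * b < a" by (simp add: a_def b_def)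
  have b: "0 \<le> b" by (simp add: b_def)
  have a: "0 < a" using ab b by linarith
  have "l * a\<^sup>2 - l * b\<^sup>2 - u i * ip n (G i) res \<le> 3 * (\<rho> * \<Lambda>) * a * a"
    using M.orth_form[OF res_orth res_orth] unfolding res_form nrm_sq[symmetric]
    by (simp add: a_def b_def)
  moreover have "u i * ip n (G i) res \<le> b * (2 * \<rho> * \<Lambda> * a)"
  proof -
    have "\<bar>u i * ip n (G i) res\<bar> \<le> b * (2 * \<rho> * \<Lambda> * a)"
      unfolding abs_mult b_def a_def by (intro mult_left_mono row_bound) auto
    then show ?thesis by linarith
  qed
  moreover have "l * b\<^sup>2 \<le> (1 + \<rho>) * \<Lambda> * (a\<^sup>2 / 4)"
  proof -
    have "b\<^sup>2 \<le> (a/2)\<^sup>2" using ab b by (intro power_mono) auto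
    then show ?thesis using l_bounds G.l_pos by (intro mult_mono) (auto simp: power2_eq_square)
  qed
  moreover have "(1 - \<rho>) * \<Lambda> * a\<^sup>2 \<le> l * a\<^sup>2" using l_bounds by (intro mult_right_mono) auto
  moreover have "b * (2 * \<rho> * \<Lambda> * a) \<le> (a/2) * (2 * \<rho> * \<Lambda> * a)"
    using ab \<rho> \<Lambda> a by (intro mult_right_mono) auto
  ultimately have "(1 - \<rho>) * \<Lambda> * a\<^sup>2 \<le> (1 + \<rho>) * \<Lambda> * (a\<^sup>2 / 4) + (a/2) * (2 * \<rho> * \<Lambda> * a) + 3 * (\<rho> * \<Lambda>) * a * a"
    by linarith
  then have "(1 - \<rho>) * (\<Lambda> * a\<^sup>2) \<le> ((1 + \<rho>) / 4 + 4 * \<rho>) * (\<Lambda> * a\<^sup>2)"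
    by (simp add: algebra_simps power2_eq_square)
  then have "1 - \<rho> \<le> (1 + \<rho>) / 4 + 4 * \<rho>"
    by (rule mult_right_le_imp_le) (use \<Lambda> a in simp)
  then have "3 \<le> 21 * \<rho>" by (simp add: field_simps)
  then show False using \<rho> by simp
qed

text \<open>Row \<open>i\<close> of the eigenvalue equation, split along \<open>\<psi>\<close> and
  \<open>res\<close>. By \<open>res_le\<close> the error stays proportional to the entry: 4 of the 5
  units of \<open>\<rho>\<close> come from \<open>res\<close>, one from replacing \<open>l\<close>
  by \<open>\<Lambda>\<close>.\<close>

lemma coordinate_linearization: "\<bar>\<Lambda> * u i - kap * ip n (G i) \<psi>\<bar> \<le> 5 * \<rho> * \<Lambda> * \<bar>u i\<bar>"
proof -
  have "l * u i = ip n (G i) u" using G.mv_v[OF i] by (simp add: mv_def ip_def)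
  also have "\<dots> = kap * ip n (G i) \<psi> + ip n (G i) res"
    by (simp add: res_def ip_lin)
  finally have "\<bar>l * u i - kap * ip n (G i) \<psi>\<bar> \<le> 2 * \<rho> * \<Lambda> * nrm n res"
    using row_bound[of res] by simp
  also have "\<dots> \<le> 2 * \<rho> * \<Lambda> * (2 * \<bar>u i\<bar>)"
    using res_le \<rho> \<Lambda> by (intro mult_left_mono) auto
  finally have "\<bar>l * u i - kap * ip n (G i) \<psi>\<bar> \<le> 4 * \<rho> * \<Lambda> * \<bar>u i\<bar>" by simp
  moreover have "\<bar>(\<Lambda> - l) * u i\<bar> \<le> \<rho> * \<Lambda> * \<bar>u i\<bar>"
    unfolding abs_mult using l_bounds by (intro mult_right_mono) (auto simp: abs_le_iff algebra_simps)
  ultimately show ?thesis by (simp add: algebra_simps abs_le_iff)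
qed

text \<open>The signed multiples of \<open>u\<close> and \<open>\<psi>\<close> of length
  \<open>sqrt n\<close> have squared distances at most \<open>4 * \<rho> * n\<close> and
  \<open>6 * \<rho> * n\<close> from \<open>y\<close>, hence at most \<open>20 * \<rho> * n\<close>
  from each other.\<close>

lemma alignment: "1 - 10 * \<rho> \<le> s * sgn (ip n y \<psi>) * kap" "s * sgn (ip n y \<psi>) * kap \<le> 1"
proof -
  define t where "t = sgn (ip n y \<psi>)"
  have ss: "s * s = 1" "t * t = 1" using s_cases y_psi_nz by (auto simp: t_def sgn_real_def)
  have st: "\<bar>s * t\<bar> = 1" using s_cases y_psi_nz by (auto simp: t_def sgn_real_def)
  let ?A = "\<lambda>j. sqrt n * s * u j - y j" and ?B = "\<lambda>j. sqrt n * t * \<psi> j - y j"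
  have B: "ip n ?B ?B \<le> 6 * \<rho> * n"
    using signed_distance(2)[OF M.v_unit y_psi_sq _ _ y_psi_nz] \<rho> by (simp add: t_def)
  have "0 \<le> ip n (\<lambda>j. ?A j + ?B j) (\<lambda>j. ?A j + ?B j)" by simp
  then have "ip n (\<lambda>j. ?A j - ?B j) (\<lambda>j. ?A j - ?B j) \<le> 2 * ip n ?A ?A + 2 * ip n ?B ?B"
    unfolding ip_add_left ip_add_right ip_diff_left[of n ?A ?B] ip_diff_right[of n _ ?A ?B] by linarith
  also have "\<dots> \<le> 20 * \<rho> * n" using distance B by linarith
  also have "ip n (\<lambda>j. ?A j - ?B j) (\<lambda>j. ?A j - ?B j)
      = ip n (\<lambda>j. sqrt n * s * u j - sqrt n * t * \<psi> j) (\<lambda>j. sqrt n * s * u j - sqrt n * t * \<psi> j)"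
    by (intro ip_cong) auto
  also have "\<dots> = 2 * real n - 2 * real n * (s * t * kap)"
  proof -
    have "ip n (\<lambda>j. r * s * u j - r * t * \<psi> j) (\<lambda>j. r * s * u j - r * t * \<psi> j)
        = (r * r) * (s * s) + (r * r) * (t * t) - 2 * (r * r) * (s * t * kap)" for r
      unfolding ip_lin G.v_unit M.v_unit kap_def using ip_commute[of n \<psi> u]
      by (simp add: algebra_simps)
    from this[of "sqrt n"] show ?thesis unfolding ss by simp
  qed
  finally have "n * (1 - 10 * \<rho>) \<le> n * (s * t * kap)" by (simp add: algebra_simps)
  then show "1 - 10 * \<rho> \<le> s * sgn (ip n y \<psi>) * kap" using n_pos by (simp add: t_def)
  have "\<bar>kap\<bar> \<le> 1" using ip_CS[of n u \<psi>] by (simp add: kap_def G.nrm_v M.nrm_v)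
  then have "\<bar>s * t * kap\<bar> \<le> 1" by (simp add: abs_mult[of "s * t"] st)
  then show "s * sgn (ip n y \<psi>) * kap \<le> 1" by (simp add: t_def abs_le_iff)
qed

text \<open>Up to the relative error of \<open>coordinate_linearization\<close>, the signed entry is
  \<open>\<phi> * f\<close>, where the factor \<open>\<phi>\<close> lies between
  \<open>1 - 13 * \<rho>\<close> and 1 because the unknown signs of \<open>u\<close> and
  \<open>\<psi>\<close> cancel in it. The error is stated relative to \<open>f\<close>, whose
  conditional law is Gaussian, and not to the entry.\<close>

lemma entry_lower_bound:
  defines "f \<equiv> y i * ip n (G i) (loo_vec n G y i) / \<Lambda>"
  shows "f - 30 * \<rho> * \<bar>f\<bar> \<le> s * sqrt n * y i * u i"
proof -
  define V where "V = s * sqrt n * y i * u i"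
  define \<phi> where "\<phi> = s * kap * ip n y \<psi> / sqrt n"
  define g where "g = \<bar>ip n y \<psi>\<bar> / sqrt n"
  have abs_y: "\<bar>y i\<bar> = 1" using y[OF i] by (auto simp: power2_eq_1_iff)
  have abs_s: "\<bar>s\<bar> = 1" using s_cases by auto
  have "ip n (G i) (loo_vec n G y i) = ip n (G i) (\<lambda>j. n / ip n y \<psi> * \<psi> j)"
    by (intro ip_cong) (auto simp: loo_vec_eq)
  then have f: "\<Lambda> * f = y i * (n / ip n y \<psi>) * ip n (G i) \<psi>"
    unfolding f_def ip_scale_right using \<Lambda> by simp
  have sq: "sqrt n * sqrt n = n" "sqrt n > 0" using n_pos by auto
  have 1: "\<Lambda> * (\<phi> * f) = (s * sqrt n * y i) * (kap * ip n (G i) \<psi>)"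
  proof -
    have "\<Lambda> * (\<phi> * f) = \<phi> * (\<Lambda> * f)" by simp
    also have "\<dots> = (s * kap * y i * ip n (G i) \<psi>) * (n / sqrt n)"
      unfolding f \<phi>_def using y_psi_nz by simp
    also have "n / sqrt n = sqrt n" by (simp add: real_div_sqrt)
    finally show ?thesis by simp
  qed
  have "\<bar>\<Lambda> * (V - \<phi> * f)\<bar> = \<bar>s * sqrt n * y i\<bar> * \<bar>\<Lambda> * u i - kap * ip n (G i) \<psi>\<bar>"
    unfolding abs_mult[symmetric] right_diff_distrib 1 V_def by (simp add: algebra_simps)
  also have "\<dots> \<le> \<bar>s * sqrt n * y i\<bar> * (5 * \<rho> * \<Lambda> * \<bar>u i\<bar>)"
    by (intro mult_left_mono coordinate_linearization) auto
  also have "\<dots> = \<Lambda> * (5 * \<rho> * \<bar>V\<bar>)" unfolding V_def abs_mult by simp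
  finally have 2: "\<bar>V - \<phi> * f\<bar> \<le> 5 * \<rho> * \<bar>V\<bar>" using \<Lambda> by (simp add: abs_mult)
  have g: "1 - 3 * \<rho> \<le> g" "g \<le> 1"
  proof -
    have "sqrt n * (1 - 3 * \<rho>) \<le> \<bar>ip n y \<psi>\<bar>"
      using signed_distance(1)[OF M.v_unit y_psi_sq _ _ y_psi_nz] \<rho> by simp
    then show "1 - 3 * \<rho> \<le> g" using sq by (simp add: g_def field_simps)
    show "g \<le> 1" using ip_CS[of n y \<psi>] sq by (simp add: g_def nrm_y M.nrm_v)
  qed
  have \<phi>: "\<phi> = (s * sgn (ip n y \<psi>) * kap) * g"
    using y_psi_nz by (simp add: \<phi>_def g_def sgn_real_def)
  have "(1 - 10 * \<rho>) * (1 - 3 * \<rho>) \<le> \<phi>" unfolding \<phi> using alignment g \<rho> by (intro mult_mono) auto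
  moreover have "(1 - 10 * \<rho>) * (1 - 3 * \<rho>) = 1 - 13 * \<rho> + 30 * \<rho>\<^sup>2"
    by (simp add: algebra_simps power2_eq_square)
  ultimately have \<phi>1: "1 - 13 * \<rho> \<le> \<phi>" using zero_le_power2[of \<rho>] by linarith
  have "0 \<le> s * sgn (ip n y \<psi>) * kap" using alignment \<rho> by simp
  then have "\<phi> \<le> 1 * 1" unfolding \<phi> using alignment g \<rho> by (intro mult_mono) auto
  then have 3: "\<bar>f - \<phi> * f\<bar> \<le> 13 * \<rho> * \<bar>f\<bar>" "\<bar>\<phi> * f\<bar> \<le> \<bar>f\<bar>"
  proof -
    have "\<bar>f - \<phi> * f\<bar> = \<bar>1 - \<phi>\<bar> * \<bar>f\<bar>" by (simp add: abs_mult[symmetric] algebra_simps)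
    also have "\<dots> \<le> 13 * \<rho> * \<bar>f\<bar>" using \<phi>1 \<open>\<phi> \<le> 1 * 1\<close> by (intro mult_right_mono) auto
    finally show "\<bar>f - \<phi> * f\<bar> \<le> 13 * \<rho> * \<bar>f\<bar>" .
    show "\<bar>\<phi> * f\<bar> \<le> \<bar>f\<bar>" unfolding abs_mult using \<phi>1 \<open>\<phi> \<le> 1 * 1\<close> \<rho>
      by (intro mult_left_le_one_le) auto
  qed
  have "5 * \<rho> * \<bar>V\<bar> \<le> \<bar>V\<bar> / 2" using mult_right_mono[of "5 * \<rho>" "1/2" "\<bar>V\<bar>"] \<rho> by simp
  \<comment> \<open>So far one error is relative to \<open>V\<close>. As \<open>V\<close> is at most
    twice \<open>f\<close> in size, it becomes relative to \<open>f\<close>, and the total is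
    \<open>13 + 2 * 5 = 23\<close> units of \<open>\<rho>\<close>.\<close>
  then have "\<bar>V\<bar> \<le> 2 * \<bar>f\<bar>" using 2 3(2) by linarith
  then have "5 * \<rho> * \<bar>V\<bar> \<le> 5 * \<rho> * (2 * \<bar>f\<bar>)" using \<rho> by (intro mult_left_mono) auto
  then have "\<bar>f - V\<bar> \<le> 23 * \<rho> * \<bar>f\<bar>" using 2 3(1) by linarith
  also have "\<dots> \<le> 30 * \<rho> * \<bar>f\<bar>" using \<rho> by (intro mult_right_mono) auto
  finally show ?thesis unfolding V_def by linarith
qed

end

end

section \<open>Quadratic forms on a net\<close>

lemma nrm_triangle: "nrm n (\<lambda>i. x i + y i) \<le> nrm n x + nrm n y"
proof (rule power2_le_imp_le)
  have "(nrm n (\<lambda>i. x i + y i))\<^sup>2 = (nrm n x)\<^sup>2 + (nrm n y)\<^sup>2 + 2 * ip n x y"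
    unfolding nrm_sq ip_lin using ip_commute[of n x y] by simp
  then show "(nrm n (\<lambda>i. x i + y i))\<^sup>2 \<le> (nrm n x + nrm n y)\<^sup>2"
    using ip_CS[of n x y] by (simp add: power2_sum abs_le_iff)
qed simp

text \<open>Scaling each vector by the norm of the other balances the two, so the squared norms of
  \<open>p\<close> and \<open>m\<close> add up to exactly \<open>4 * (a * b)\<^sup>2\<close> and no
  constant is lost.\<close>

lemma polarization:
  assumes M: "sym_mat n M" and Q: "\<And>x. \<bar>ip n x (mv n M x)\<bar> \<le> B * ip n x x"
  shows "\<bar>ip n x (mv n M z)\<bar> \<le> B * nrm n x * nrm n z"
proof (cases "nrm n x * nrm n z = 0")
  case True
  have "\<bar>ip n x (mv n M z)\<bar> \<le> nrm n x * nrm n (mv n M z)"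
    "\<bar>ip n x (mv n M z)\<bar> \<le> nrm n z * nrm n (mv n M x)"
    using ip_CS[of n x "mv n M z"] ip_CS[of n z "mv n M x"] ip_mv_sym[OF M, of x z] by auto
  then show ?thesis using True by auto
next
  case False
  define a b where "a = nrm n x" and "b = nrm n z"
  have ab: "0 < a * b" using False by (simp add: a_def b_def less_le)
  define p where "p = (\<lambda>i. b * x i + a * z i)"
  define m where "m = (\<lambda>i. b * x i - a * z i)"
  have xx: "ip n x x = a * a" "ip n z z = b * b"
    using nrm_sq[of n x] nrm_sq[of n z] by (auto simp: a_def b_def power2_eq_square)
  have "4 * (a * b) * ip n x (mv n M z) = ip n p (mv n M p) - ip n m (mv n M m)"
    unfolding p_def m_def mv_add mv_diff mv_scale ip_lin
    using ip_mv_sym[OF M, of x z] by (simp add: algebra_simps)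
  then have "\<bar>4 * (a * b) * ip n x (mv n M z)\<bar> \<le> B * ip n p p + B * ip n m m"
    using Q[of p] Q[of m] by linarith
  also have "\<dots> = 4 * (a * b) * (B * a * b)"
    unfolding p_def m_def ip_lin xx by (simp add: algebra_simps)
  finally have "4 * (a * b) * \<bar>ip n x (mv n M z)\<bar> \<le> 4 * (a * b) * (B * a * b)"
    using ab abs_mult[of "4 * (a * b)" "ip n x (mv n M z)"] by (simp only: abs_of_pos)
  then have "\<bar>ip n x (mv n M z)\<bar> \<le> B * a * b"
    by (rule mult_left_le_imp_le) (use ab in simp)
  then show ?thesis by (simp add: a_def b_def)
qed

text \<open>The bound \<open>25 n\<close> is \<open>(5/4)\<^sup>2 (4 \<surd>n)\<^sup>2\<close>: the lattice points below have spacing \<open>1 / (4 \<surd>n)\<close>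
  and norm at most \<open>5/4\<close>, and \<open>\<bar>k\<bar> \<le> k\<^sup>2\<close> for integers.\<close>

definition int_net :: "nat \<Rightarrow> (nat \<Rightarrow> int) set" where
  "int_net n = {k \<in> PiE {..<n} (\<lambda>_. {- int (25 * n)..int (25 * n)}). (\<Sum>i<n. \<bar>k i\<bar>) \<le> int (25 * n)}"

lemma finite_int_net [simp]: "finite (int_net n)"
proof (rule finite_subset)
  show "int_net n \<subseteq> PiE {..<n} (\<lambda>_. {- int (25 * n)..int (25 * n)})"
    unfolding int_net_def by blast
qed (intro finite_PiE, simp_all)

lemma sum_half_powers: "(\<Sum>k\<in>{- int m..int m}. (1/2::real) ^ nat \<bar>k\<bar>) = 3 - 2 * (1/2) ^ m"
proof (induction m)
  case (Suc m)
  have "{- int (Suc m)..int (Suc m)} = insert (- int (Suc m)) (insert (int (Suc m)) {- int m..int m})"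
    by auto
  then show ?case using Suc by (simp add: nat_add_distrib)
qed simp

text \<open>Give \<open>k\<close> the product of the weights one half to the power of the absolute
  value of \<open>k i\<close>. Every point of the net weighs at least one half to the power
  \<open>25 * n\<close>, while the whole box weighs at most \<open>3 ^ n\<close>, since these powers
  summed over the integers give 3.\<close>

lemma card_int_net: "real (card (int_net n)) \<le> 2 ^ (25 * n) * 3 ^ n"
proof -
  let ?P = "PiE {..<n} (\<lambda>_. {- int (25 * n)..int (25 * n)})"
  have "real (card (int_net n)) = (\<Sum>k\<in>int_net n. 1)" by simp
  also have "\<dots> \<le> (\<Sum>k\<in>int_net n. 2 ^ (25 * n) * (\<Prod>i<n. (1/2::real) ^ nat \<bar>k i\<bar>))"
  proof (rule sum_mono)
    fix k assume k: "k \<in> int_net n"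
    have eq: "int (\<Sum>i<n. nat \<bar>k i\<bar>) = (\<Sum>i<n. \<bar>k i\<bar>)" by simp
    have "int (\<Sum>i<n. nat \<bar>k i\<bar>) \<le> int (25 * n)"
      unfolding eq using k unfolding int_net_def by blast
    then have le: "(\<Sum>i<n. nat \<bar>k i\<bar>) \<le> 25 * n" unfolding of_nat_le_iff .
    have "(1::real) = 2 ^ (25 * n) * (1/2) ^ (25 * n)" by (simp add: power_one_over)
    also have "\<dots> \<le> 2 ^ (25 * n) * (1/2) ^ (\<Sum>i<n. nat \<bar>k i\<bar>)"
      using le by (intro mult_left_mono power_decreasing) auto
    finally show "1 \<le> 2 ^ (25 * n) * (\<Prod>i<n. (1/2::real) ^ nat \<bar>k i\<bar>)" by (simp add: power_sum)
  qed
  also have "\<dots> \<le> (\<Sum>k\<in>?P. 2 ^ (25 * n) * (\<Prod>i<n. (1/2::real) ^ nat \<bar>k i\<bar>))"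
  proof (rule sum_mono2)
    show "int_net n \<subseteq> ?P" unfolding int_net_def by blast
  qed (simp_all add: finite_PiE prod_nonneg)
  also have "\<dots> = 2 ^ (25 * n) * (\<Prod>i<n. \<Sum>k\<in>{- int (25 * n)..int (25 * n)}. (1/2::real) ^ nat \<bar>k\<bar>)"
    by (subst prod_sum_PiE) (auto simp: sum_distrib_left)
  also have "\<dots> \<le> 2 ^ (25 * n) * (\<Prod>i<n. 3)"
  proof -
    have "(1/2::real) ^ (25 * n) \<le> 1" by (rule power_le_one) auto
    then have "0 \<le> 3 - 2 * (1/2::real) ^ (25 * n)" by linarith
    then show ?thesis unfolding sum_half_powers by (intro mult_left_mono prod_mono) auto
  qed
  finally show ?thesis by simp
qed

text \<open>Rounding a unit vector down to the lattice \<open>\<int>\<^sup>n / (4 \<surd>n)\<close> moves it by at most \<open>1/4\<close>, so a bound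
  on the lattice improves any global bound by a factor \<open>9/16\<close>, up to an additive term.\<close>

lemma quadratic_form_net:
  assumes n: "1 \<le> n" and M: "sym_mat n M" and s: "0 \<le> s"
    and net: "\<And>k. k \<in> int_net n \<Longrightarrow>
      \<bar>ip n (\<lambda>i. of_int (k i)) (mv n M (\<lambda>i. of_int (k i)))\<bar> \<le> s * ip n (\<lambda>i. of_int (k i)) (\<lambda>i. of_int (k i))"
  shows "\<bar>ip n x (mv n M x)\<bar> \<le> 4 * s * ip n x x"
proof -
  define B0 where "B0 = (\<Sum>i<n. \<Sum>j<n. \<bar>M i j\<bar>)"
  have B0: "0 \<le> B0" by (simp add: B0_def sum_nonneg)
  \<comment> \<open>One rounding turns a bound \<open>B\<close> into
    \<open>25/16 * s + 9/16 * B\<close>. The value \<open>4 * s\<close> is preserved, as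
    \<open>25/16 + 9/4 \<le> 4\<close>, and any surplus over it shrinks by \<open>9/16\<close>. The
    sum of the absolute entries is a crude start.\<close>
  have iter: "\<forall>x. \<bar>ip n x (mv n M x)\<bar> \<le> (4 * s + B0 * (9/16) ^ m) * ip n x x" for m
  proof (induction m)
    case 0
    have "\<bar>ip n x (mv n M x)\<bar> \<le> B0 * ip n x x" for x
    proof -
      have "\<bar>ip n x (mv n M x)\<bar> \<le> (\<Sum>i<n. \<bar>\<Sum>j<n. M i j * x i * x j\<bar>)"
        unfolding ip_mv by (rule sum_abs)
      also have "\<dots> \<le> (\<Sum>i<n. \<Sum>j<n. \<bar>M i j * x i * x j\<bar>)"
        by (intro sum_mono sum_abs)
      also have "\<dots> \<le> (\<Sum>i<n. \<Sum>j<n. \<bar>M i j\<bar> * (nrm n x * nrm n x))"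
        unfolding abs_mult mult.assoc by (intro sum_mono mult_left_mono mult_mono coord_le_nrm) auto
      also have "\<dots> = B0 * ip n x x"
        using nrm_sq[of n x] by (simp add: B0_def sum_distrib_right power2_eq_square)
      finally show ?thesis .
    qed
    moreover have "B0 * ip n x x \<le> (4 * s + B0 * (9/16) ^ 0) * ip n x x" for x
      using s by (intro mult_right_mono) auto
    ultimately show ?case using order_trans by blast
  next
    case (Suc m)
    define B where "B = 4 * s + B0 * (9/16) ^ m"
    have B: "0 \<le> B" using s B0 by (simp add: B_def)
    have QB: "\<bar>ip n x (mv n M z)\<bar> \<le> B * nrm n x * nrm n z" for x z
      using polarization[OF M, of B] Suc by (simp add: B_def)
    have unit: "\<bar>ip n x (mv n M x)\<bar> \<le> 25/16 * s + 9/16 * B" if x: "ip n x x = 1" for x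
    proof -
      define c where "c = 4 * sqrt n"
      have c: "0 < c" "c * c = 16 * n" using n by (auto simp: c_def)
      define k where "k = (\<lambda>i\<in>{..<n}. \<lfloor>c * x i\<rfloor>)"
      define kr where "kr = (\<lambda>i. real_of_int (k i))"
      define y where "y = (\<lambda>i. (1 / c) * kr i)"
      define r where "r = (\<lambda>i. x i - y i)"
      have rb: "0 \<le> r i" "r i \<le> 1 / c" if "i < n" for i
      proof -
        have "c * r i = c * x i - \<lfloor>c * x i\<rfloor>"
          using that c by (simp add: r_def y_def kr_def k_def right_diff_distrib)
        then have "0 \<le> c * r i" "c * r i \<le> 1"
          using of_int_floor_le[of "c * x i"] real_of_int_floor_add_one_ge[of "c * x i"] by linarith+
        then show "0 \<le> r i" "r i \<le> 1 / c"
          using c by (simp_all add: zero_le_mult_iff pos_le_divide_eq mult.commute)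
      qed
      have "ip n r r \<le> (\<Sum>i<n. (1 / c) * (1 / c))"
        unfolding ip_def using rb c by (intro sum_mono mult_mono) auto
      also have "\<dots> = (1/4)\<^sup>2" using n c by (simp add: power2_eq_square)
      finally have "sqrt (ip n r r) \<le> sqrt ((1/4)\<^sup>2)" by (rule real_sqrt_le_mono)
      then have r4: "nrm n r \<le> 1/4" by (simp add: nrm_def)
      have nx: "nrm n x = 1" using x by (simp add: nrm_def)
      have ny: "nrm n y \<le> 5/4"
        using nrm_triangle[of n x "\<lambda>i. (-1) * r i"] nx r4 unfolding nrm_scale by (simp add: r_def)
      have yy: "ip n y y \<le> 25/16"
        using power_mono[OF ny nrm_nonneg, of 2] unfolding nrm_sq by (simp add: power2_eq_square)
      have kk: "ip n kr kr \<le> 25 * n"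
      proof -
        have "ip n y y = (1 / c) * ((1 / c) * ip n kr kr)" unfolding y_def ip_lin ..
        then have "ip n kr kr = (c * c) * ip n y y" using c(1) by simp
        also have "\<dots> \<le> (c * c) * (25/16)" using yy by (intro mult_left_mono) auto
        finally show ?thesis using c by simp
      qed
      have knet: "k \<in> int_net n"
      proof -
        have sq: "\<bar>z\<bar> \<le> z * z" for z :: int
          using mult_right_mono[of 1 "\<bar>z\<bar>" "\<bar>z\<bar>"] by (cases "z = 0") auto
        have "real_of_int (\<Sum>i<n. k i * k i) \<le> real_of_int (int (25 * n))"
          using kk by (simp add: ip_def kr_def)
        then have sum: "(\<Sum>i<n. k i * k i) \<le> int (25 * n)" by linarith
        have s2: "(\<Sum>i<n. \<bar>k i\<bar>) \<le> int (25 * n)"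
          using sum_mono[of "{..<n}" "\<lambda>i. \<bar>k i\<bar>" "\<lambda>i. k i * k i"] sq sum by force
        have "\<bar>k i\<bar> \<le> int (25 * n)" if "i < n" for i
          using member_le_sum[of i "{..<n}" "\<lambda>i. \<bar>k i\<bar>"] that s2 by force
        then show ?thesis using s2 unfolding int_net_def
          by (auto simp: abs_le_iff k_def minus_le_iff)
      qed
      have Qy: "\<bar>ip n y (mv n M y)\<bar> \<le> 25/16 * s"
      proof -
        have "\<bar>ip n y (mv n M y)\<bar> = (1 / c) * (1 / c) * \<bar>ip n kr (mv n M kr)\<bar>"
          unfolding y_def mv_scale ip_lin using c by (simp add: abs_mult)
        also have "\<dots> \<le> (1 / c) * (1 / c) * (s * ip n kr kr)"
          using net[OF knet] c by (intro mult_left_mono) (auto simp: kr_def)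
        also have "\<dots> = s * ip n y y" unfolding y_def ip_lin by simp
        also have "\<dots> \<le> s * (25/16)" using yy s by (intro mult_left_mono) auto
        finally show ?thesis by simp
      qed
      \<comment> \<open>By symmetry the difference of the two forms is the bilinear form at
        \<open>x - y\<close> and \<open>x + y\<close>, whose norms are at most \<open>1/4\<close>
        and \<open>9/4\<close>; their product is the \<open>9/16\<close>.\<close>
      have "ip n x (mv n M x) - ip n y (mv n M y) = ip n r (mv n M (\<lambda>i. x i + y i))"
        unfolding r_def mv_add ip_lin using ip_mv_sym[OF M, of x y] by simp
      moreover have "\<bar>ip n r (mv n M (\<lambda>i. x i + y i))\<bar> \<le> B * (1/4) * (9/4)"
      proof -
        have "nrm n (\<lambda>i. x i + y i) \<le> 9/4" using nrm_triangle[of n x y] nx ny by linarith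
        then have "B * nrm n r * nrm n (\<lambda>i. x i + y i) \<le> B * (1/4) * (9/4)"
          using r4 B by (intro mult_mono) auto
        then show ?thesis using QB[of r "\<lambda>i. x i + y i"] by linarith
      qed
      ultimately show ?thesis using Qy by linarith
    qed
    show ?case
    proof
      fix x
      define t where "t = nrm n x"
      show "\<bar>ip n x (mv n M x)\<bar> \<le> (4 * s + B0 * (9/16) ^ Suc m) * ip n x x"
      proof (cases "t = 0")
        case True
        then have "ip n x x = 0" using nrm_sq[of n x] by (simp add: t_def)
        then show ?thesis using Suc by (metis mult_zero_right)
      next
        case False
        then have t: "0 < t" by (simp add: t_def less_le)
        have tt: "ip n x x = t * t" using nrm_sq[of n x] by (simp add: t_def power2_eq_square)
        have "\<bar>ip n (\<lambda>i. (1/t) * x i) (mv n M (\<lambda>i. (1/t) * x i))\<bar> \<le> 25/16 * s + 9/16 * B"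
          by (rule unit) (unfold ip_lin tt, use t in simp)
        then have "\<bar>ip n x (mv n M x)\<bar> \<le> (25/16 * s + 9/16 * B) * (t * t)"
          unfolding mv_scale ip_lin using t by (simp add: abs_mult field_simps)
        also have "\<dots> \<le> (4 * s + B0 * (9/16) ^ Suc m) * (t * t)"
        proof (rule mult_right_mono)
          show "25/16 * s + 9/16 * B \<le> 4 * s + B0 * (9/16) ^ Suc m"
            using s by (simp add: B_def field_simps)
        qed simp
        finally show ?thesis by (simp add: tt)
      qed
    qed
  qed
  have "(\<lambda>m. (9/16::real) ^ m) \<longlonglongrightarrow> 0" by (rule LIMSEQ_realpow_zero) auto
  then have "(\<lambda>m. (4 * s + B0 * (9/16) ^ m) * ip n x x) \<longlonglongrightarrow> (4 * s + B0 * 0) * ip n x x"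
    by (intro tendsto_mult tendsto_add tendsto_const)
  then show ?thesis
    using iter by (intro LIMSEQ_le_const[of _ "4 * s * ip n x x"]) auto
qed

section \<open>Signal and noise in the hollow Gram matrix\<close>

definition tmul :: "nat \<Rightarrow> (nat \<Rightarrow> nat \<Rightarrow> real) \<Rightarrow> (nat \<Rightarrow> real) \<Rightarrow> nat \<Rightarrow> real" where
  "tmul n X x k = (\<Sum>j<n. x j * X j k)"

definition noise_proj :: "nat \<Rightarrow> (nat \<Rightarrow> real) \<Rightarrow> (nat \<times> nat \<Rightarrow> real) \<Rightarrow> nat \<Rightarrow> real" where
  "noise_proj d \<mu> Z j = (\<Sum>k<d. \<mu> k * Z (j, k))"

abbreviation "sqn d V \<equiv> ip d V V"

text \<open>The erased diagonal is invisible because \<open>p\<close> vanishes at \<open>i\<close>.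
  Row \<open>i\<close> thus meets the other rows only through one vector of feature space.\<close>

lemma gram_apply:
  assumes "i < n" "p i = 0"
  shows "ip n (gram_hollow n d X i) p = ip d (X i) (tmul n X p)"
proof -
  have "ip n (gram_hollow n d X i) p = (\<Sum>j<n. \<Sum>k<d. X i k * X j k * p j)"
    unfolding ip_def gram_hollow_def sum_distrib_right[symmetric] using assms by (intro sum.cong) auto
  also have "\<dots> = ip d (X i) (tmul n X p)"
    unfolding ip_def tmul_def by (subst sum.swap) (simp add: sum_distrib_left algebra_simps)
  finally show ?thesis .
qed

lemma gram_form:
  "ip n x (mv n (gram_hollow n d X) x) = sqn d (tmul n X x) - (\<Sum>i<n. (x i)\<^sup>2 * sqn d (X i))"
proof -
  have "sqn d (tmul n X x) = (\<Sum>k<d. \<Sum>i<n. \<Sum>j<n. (x i * X i k) * (x j * X j k))"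
    unfolding ip_def tmul_def sum_product ..
  also have "\<dots> = (\<Sum>i<n. \<Sum>k<d. \<Sum>j<n. (x i * X i k) * (x j * X j k))" by (rule sum.swap)
  also have "\<dots> = (\<Sum>i<n. \<Sum>j<n. \<Sum>k<d. (x i * X i k) * (x j * X j k))"
    by (intro sum.cong refl sum.swap)
  also have "\<dots> = (\<Sum>i<n. \<Sum>j<n. gram_hollow n d X i j * x i * x j + (if j = i then (x i)\<^sup>2 * sqn d (X i) else 0))"
    by (intro sum.cong refl) (auto simp: gram_hollow_def ip_def sum_distrib_left sum_distrib_right power2_eq_square algebra_simps)
  finally show ?thesis by (simp add: ip_mv sum.distrib)
qed

lemma tmul_gmm: "tmul n (gmm_X y \<mu> Z) x k = ip n y x * \<mu> k + tmul n (curry Z) x k"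
proof -
  have "x j * gmm_X y \<mu> Z j k = y j * x j * \<mu> k + x j * curry Z j k" for j
    by (simp add: gmm_X_def algebra_simps)
  then show ?thesis by (simp add: tmul_def ip_def sum.distrib sum_distrib_right)
qed

lemma ip_mu_tmul: "ip d \<mu> (tmul n (curry Z) x) = ip n x (noise_proj d \<mu> Z)"
  unfolding ip_def tmul_def noise_proj_def sum_distrib_left
  by (subst sum.swap) (simp add: algebra_simps)

lemma ip_mu_tmul_gmm: "ip d \<mu> (tmul n (gmm_X y \<mu> Z) x) = ip n y x * sqn d \<mu> + ip n x (noise_proj d \<mu> Z)"
proof -
  have "ip d \<mu> (tmul n (gmm_X y \<mu> Z) x) = ip d \<mu> (\<lambda>k. ip n y x * \<mu> k + tmul n (curry Z) x k)"
    by (intro ip_cong) (auto simp: tmul_gmm)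
  then show ?thesis by (simp add: ip_lin ip_mu_tmul)
qed

lemma sqn_tmul_gmm: "sqn d (tmul n (gmm_X y \<mu> Z) x) =
    (ip n y x)\<^sup>2 * sqn d \<mu> + 2 * ip n y x * ip n x (noise_proj d \<mu> Z) + sqn d (tmul n (curry Z) x)"
proof -
  have "sqn d (tmul n (gmm_X y \<mu> Z) x) = sqn d (\<lambda>k. ip n y x * \<mu> k + tmul n (curry Z) x k)"
    by (intro ip_cong) (auto simp: tmul_gmm)
  also have "\<dots> = (ip n y x)\<^sup>2 * sqn d \<mu> + 2 * ip n y x * ip d \<mu> (tmul n (curry Z) x) + sqn d (tmul n (curry Z) x)"
    unfolding ip_lin using ip_commute[of d \<mu> "tmul n (curry Z) x"] by (simp add: power2_eq_square algebra_simps)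
  finally show ?thesis by (simp add: ip_mu_tmul)
qed


text \<open>The mean \<open>d\<close> of the Wishart form cancels against the erased diagonal, whose
  entries are all close to \<open>d\<close>. There remain the cross term, counted twice, the Wishart
  fluctuation, and the fluctuation of the diagonal with weight 4: together the 7.\<close>

lemma gram_noise_bound:
  assumes n: "1 \<le> n" and y: "\<And>j. j < n \<Longrightarrow> (y j)\<^sup>2 = 1" and r2: "sqn d \<mu> = r2" and \<rho>: "0 < \<rho>" "1 \<le> \<rho> * n"
    and E1: "\<And>x. \<bar>sqn d (tmul n (curry Z) x) - d * ip n x x\<bar> \<le> \<rho> * (n * r2) * ip n x x"
    and E2: "nrm n (noise_proj d \<mu> Z) \<le> \<rho> * sqrt n * r2"
  defines "G \<equiv> gram_hollow n d (gmm_X y \<mu> Z)"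
  shows "\<bar>ip n x (mv n G z) - r2 * ip n y x * ip n y z\<bar> \<le> 7 * \<rho> * (n * r2) * nrm n x * nrm n z"
proof -
  define w where "w = noise_proj d \<mu> Z"
  define L where "L = n * r2"
  have r2_nn: "0 \<le> r2" using r2 ip_self_nonneg[of d \<mu>] by simp
  have L: "0 \<le> L" "r2 \<le> \<rho> * L"
    using r2_nn mult_right_mono[OF \<rho>(2) r2_nn] by (auto simp: L_def)
  have ny: "nrm n y = sqrt n" using y by (simp add: nrm_def ip_def power2_eq_square)
  have sn: "sqrt n \<le> n" "1 \<le> sqrt n" using n real_le_lsqrt[of n n] by (auto simp: power2_eq_square)
  define M where "M = (\<lambda>i j. G i j - r2 * y i * y j)"
  have mvM: "mv n M z = (\<lambda>i. mv n G z i - (r2 * ip n y z) * y i)" for z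
    by (auto simp: mv_def M_def ip_def sum_subtractf sum_distrib_left sum_distrib_right algebra_simps)
  have ipM: "ip n x (mv n M z) = ip n x (mv n G z) - r2 * ip n y x * ip n y z" for x z
    unfolding mvM ip_lin ip_commute[of n x y] by simp
  have symM: "sym_mat n M"
    by (auto simp: sym_mat_def M_def G_def gram_hollow_def mult.commute intro!: sum.cong)
  \<comment> \<open>Coordinate vectors inserted in \<open>E1\<close>, and single entries of the
    vector in \<open>E2\<close>, control the diagonal. The 4 is \<open>r2 \<le> \<rho> * L\<close>,
    twice the cross term, and one Wishart term.\<close>
  have diag: "\<bar>sqn d (gmm_X y \<mu> Z i) - d\<bar> \<le> 4 * \<rho> * L" if i: "i < n" for i
  proof -
    let ?e = "\<lambda>j. if j = i then 1 else 0 :: real"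
    have "sqn d (gmm_X y \<mu> Z i) = sqn d (tmul n (gmm_X y \<mu> Z) ?e)"
      using i by (intro ip_cong) (auto simp: tmul_def if_distrib[of "\<lambda>a. a * _"] cong: if_cong)
    also have "\<dots> = r2 + 2 * y i * w i + sqn d (tmul n (curry Z) ?e)"
      unfolding sqn_tmul_gmm r2 ip_commute[of n y] using i y[of i] by (simp add: ip_unit w_def)
    finally have "sqn d (gmm_X y \<mu> Z i) - d = r2 + 2 * (y i * w i) + (sqn d (tmul n (curry Z) ?e) - d)"
      by simp
    moreover have "\<bar>sqn d (tmul n (curry Z) ?e) - d\<bar> \<le> \<rho> * L"
      using E1[of ?e] i by (simp add: ip_unit L_def)
    moreover have "\<bar>y i * w i\<bar> \<le> \<rho> * L"
    proof -
      have "\<bar>y i\<bar> = 1" using y[OF i] by (auto simp: power2_eq_1_iff)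
      then have "\<bar>y i * w i\<bar> \<le> nrm n w" using coord_le_nrm[OF i, of w] by (simp add: abs_mult)
      also have "\<dots> \<le> \<rho> * sqrt n * r2" using E2 by (simp add: w_def)
      also have "\<dots> \<le> \<rho> * n * r2" using sn \<rho> r2_nn by (intro mult_right_mono mult_left_mono) auto
      finally show ?thesis by (simp add: L_def)
    qed
    ultimately show ?thesis using L r2_nn by linarith
  qed
  have "\<bar>ip n x (mv n M x)\<bar> \<le> (7 * \<rho> * L) * ip n x x" for x
  proof -
    have "ip n x (mv n M x) = 2 * (ip n y x * ip n x w) + (sqn d (tmul n (curry Z) x) - d * ip n x x)
        - (\<Sum>i<n. (x i)\<^sup>2 * (sqn d (gmm_X y \<mu> Z i) - d))"
    proof -
      have "(\<Sum>i<n. (x i)\<^sup>2 * (sqn d (gmm_X y \<mu> Z i) - d))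
          = (\<Sum>i<n. (x i)\<^sup>2 * sqn d (gmm_X y \<mu> Z i)) - d * ip n x x"
        by (simp add: right_diff_distrib sum_subtractf sum_distrib_left power2_eq_square ip_def[of n] mult_ac)
      then show ?thesis
        unfolding ipM G_def gram_form sqn_tmul_gmm r2 w_def by (simp add: power2_eq_square)
    qed
    moreover have "\<bar>ip n y x * ip n x w\<bar> \<le> \<rho> * L * ip n x x"
    proof -
      have "\<bar>ip n y x * ip n x w\<bar> \<le> (sqrt n * nrm n x) * (nrm n x * (\<rho> * sqrt n * r2))"
      proof -
        have "\<bar>ip n x w\<bar> \<le> nrm n x * (\<rho> * sqrt n * r2)"
          using ip_CS[of n x w] mult_left_mono[OF E2, of "nrm n x"] by (simp add: w_def)
        then show ?thesis unfolding abs_mult using ip_CS[of n y x] ny by (intro mult_mono) auto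
      qed
      also have "\<dots> = \<rho> * r2 * (sqrt n * sqrt n) * (nrm n x)\<^sup>2"
        unfolding power2_eq_square by (simp only: mult_ac)
      finally show ?thesis by (simp add: L_def nrm_sq mult_ac)
    qed
    moreover have "\<bar>\<Sum>i<n. (x i)\<^sup>2 * (sqn d (gmm_X y \<mu> Z i) - d)\<bar> \<le> 4 * \<rho> * L * ip n x x"
    proof -
      have "\<bar>\<Sum>i<n. (x i)\<^sup>2 * (sqn d (gmm_X y \<mu> Z i) - d)\<bar> \<le> (\<Sum>i<n. \<bar>(x i)\<^sup>2 * (sqn d (gmm_X y \<mu> Z i) - d)\<bar>)"
        by (rule sum_abs)
      also have "\<dots> \<le> (\<Sum>i<n. (x i)\<^sup>2 * (4 * \<rho> * L))"
        unfolding abs_mult using diag by (intro sum_mono mult_mono) auto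
      also have "\<dots> = 4 * \<rho> * L * ip n x x"
        by (simp add: ip_def sum_distrib_left power2_eq_square algebra_simps)
      finally show ?thesis .
    qed
    ultimately have "\<bar>ip n x (mv n M x)\<bar> \<le> 2 * (\<rho> * L * ip n x x) + \<rho> * L * ip n x x + 4 * \<rho> * L * ip n x x"
      using E1[of x] by (simp only: L_def[symmetric])
    then show ?thesis by (simp add: mult_ac)
  qed
  from polarization[OF symM this, of x z] show ?thesis unfolding ipM L_def .
qed

text \<open>Up to the sign of its own noise, the score of vertex \<open>i\<close> is
  \<open>ip d \<mu> W\<close> plus a centred Gaussian of variance \<open>sqn d W\<close>, so these
  are bounds on its conditional mean and variance. The summand \<open>n * d\<close> is the noise of
  the other rows accumulated in \<open>W\<close>.\<close>

lemma loo_projection_bounds: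
  assumes r2: "sqn d \<mu> = r2" and \<rho>: "0 < \<rho>" "\<rho> \<le> 1/10"
    and E1: "\<And>x. \<bar>sqn d (tmul n (curry Z) x) - d * ip n x x\<bar> \<le> \<rho> * (n * r2) * ip n x x"
    and E2: "nrm n (noise_proj d \<mu> Z) \<le> \<rho> * sqrt n * r2"
    and p: "ip n y p = n" "ip n p p \<le> n * (1 + 4 * \<rho>)"
  defines "W \<equiv> tmul n (gmm_X y \<mu> Z) p"
  shows "(1 - 2 * \<rho>) * (n * r2) \<le> ip d \<mu> W" and "sqn d W \<le> (1 + 10 * \<rho>) * (n * (n * r2 + d))"
proof -
  have r2_nn: "0 \<le> r2" using r2 ip_self_nonneg[of d \<mu>] by simp
  have "nrm n p \<le> sqrt (n * 2\<^sup>2)"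
    unfolding nrm_def using p(2) \<rho> mult_left_mono[of "1 + 4 * \<rho>" 4 n] by (intro real_sqrt_le_mono) simp
  then have np: "nrm n p \<le> 2 * sqrt n" by (simp add: real_sqrt_mult)
  have "\<bar>ip n p (noise_proj d \<mu> Z)\<bar> \<le> nrm n p * nrm n (noise_proj d \<mu> Z)" by (rule ip_CS)
  also have "\<dots> \<le> (2 * sqrt n) * (\<rho> * sqrt n * r2)" using np E2 by (intro mult_mono) auto
  also have "\<dots> = 2 * \<rho> * (sqrt n * sqrt n * r2)" by simp
  finally have w: "\<bar>ip n p (noise_proj d \<mu> Z)\<bar> \<le> 2 * (\<rho> * (n * r2))" by simp
  show "(1 - 2 * \<rho>) * (n * r2) \<le> ip d \<mu> W"
    using w unfolding W_def ip_mu_tmul_gmm p r2 by (simp add: algebra_simps abs_le_iff)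
  have "sqn d W \<le> n * (n * r2) + 2 * n * (2 * (\<rho> * (n * r2))) + (d + \<rho> * (n * r2)) * (n * (1 + 4 * \<rho>))"
  proof -
    have "2 * n * ip n p (noise_proj d \<mu> Z) \<le> 2 * n * (2 * (\<rho> * (n * r2)))"
      using w by (intro mult_left_mono) auto
    moreover have "(d + \<rho> * (n * r2)) * ip n p p \<le> (d + \<rho> * (n * r2)) * (n * (1 + 4 * \<rho>))"
      using p(2) \<rho> r2_nn by (intro mult_left_mono) auto
    moreover have "sqn d (tmul n (curry Z) p) \<le> (d + \<rho> * (n * r2)) * ip n p p"
      using E1[of p] by (simp add: algebra_simps abs_le_iff)
    moreover have "(real n)\<^sup>2 * r2 = n * (n * r2)" by (simp add: power2_eq_square)
    ultimately show ?thesis unfolding W_def sqn_tmul_gmm p(1) r2 by linarith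
  qed
  also have "\<dots> = (1 + 5 * \<rho> + 4 * \<rho>\<^sup>2) * (n * (n * r2)) + (1 + 4 * \<rho>) * (n * d)"
    by (simp add: algebra_simps power2_eq_square)
  also have "\<dots> \<le> (1 + 10 * \<rho>) * (n * (n * r2)) + (1 + 10 * \<rho>) * (n * d)"
  proof -
    have "\<rho>\<^sup>2 \<le> 1 * \<rho>" unfolding power2_eq_square using \<rho> by (intro mult_right_mono) auto
    then show ?thesis using \<rho> r2_nn by (intro add_mono[OF mult_right_mono mult_right_mono]) auto
  qed
  finally show "sqn d W \<le> (1 + 10 * \<rho>) * (n * (n * r2 + d))" by (simp add: algebra_simps)
qed

section \<open>Gaussian noise\<close>

lemma emeasure_le_nn_integral:
  assumes "A \<in> sets M" "\<And>x. x \<in> A \<Longrightarrow> 1 \<le> g x"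
  shows "emeasure M A \<le> (\<integral>\<^sup>+x. g x \<partial>M)"
proof -
  have "emeasure M A = (\<integral>\<^sup>+x. indicator A x \<partial>M)" using assms(1) by simp
  also have "\<dots> \<le> (\<integral>\<^sup>+x. g x \<partial>M)"
    using assms(2) by (intro nn_integral_mono) (auto simp: indicator_def)
  finally show ?thesis .
qed

lemma two_sided_chernoff:
  fixes f :: "'a \<Rightarrow> real"
  assumes [measurable]: "f \<in> borel_measurable M" and \<theta>: "0 < \<theta>" and B: "0 \<le> B"
    and mgf: "\<And>\<sigma>. \<sigma> = 1 \<or> \<sigma> = -1 \<Longrightarrow> (\<integral>\<^sup>+x. ennreal (exp (\<sigma> * \<theta> * f x - \<theta> * t)) \<partial>M) \<le> ennreal B"
  shows "emeasure M {x \<in> space M. t < \<bar>f x\<bar>} \<le> ennreal (2 * B)"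
proof -
  let ?g = "\<lambda>\<sigma> x. exp (\<sigma> * \<theta> * f x - \<theta> * t)"
  have "emeasure M {x \<in> space M. t < \<bar>f x\<bar>} \<le> (\<integral>\<^sup>+x. ennreal (?g 1 x) + ennreal (?g (-1) x) \<partial>M)"
  proof (rule emeasure_le_nn_integral)
    fix x assume "x \<in> {x \<in> space M. t < \<bar>f x\<bar>}"
    then have "\<theta> * t \<le> \<theta> * \<bar>f x\<bar>" using \<theta> by simp
    also have "\<dots> = \<bar>\<theta> * f x\<bar>" using \<theta> by (simp add: abs_mult)
    finally have "\<theta> * t \<le> \<theta> * f x \<or> \<theta> * t \<le> - (\<theta> * f x)" by linarith
    then have "1 \<le> ?g 1 x \<or> 1 \<le> ?g (-1) x" by auto
    then have "1 \<le> ?g 1 x + ?g (-1) x" by (auto intro: add_increasing add_increasing2)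
    then show "1 \<le> ennreal (?g 1 x) + ennreal (?g (-1) x)" by (simp flip: ennreal_plus)
  qed measurable
  also have "\<dots> = (\<integral>\<^sup>+x. ennreal (?g 1 x) \<partial>M) + (\<integral>\<^sup>+x. ennreal (?g (-1) x) \<partial>M)"
    by (rule nn_integral_add) measurable
  also have "\<dots> \<le> ennreal B + ennreal B" by (intro add_mono mgf) auto
  also have "\<dots> = ennreal (2 * B)" using B by (simp flip: ennreal_plus)
  finally show ?thesis .
qed

lemma space_std_normal [simp]: "space std_normal = UNIV"
  by (simp add: std_normal_def)

lemma sets_std_normal [simp, measurable_cong]: "sets std_normal = sets borel"
  by (simp add: std_normal_def)

lemma prob_space_std_normal [simp]: "prob_space std_normal"
  unfolding std_normal_def by (rule prob_space_normal_density) simp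

interpretation SN: prob_space std_normal by simp

interpretation SNP: product_sigma_finite "\<lambda>_. std_normal"
  by standard

lemma std_normal_mgf: "(\<integral>\<^sup>+z. ennreal (exp (c * z)) \<partial>std_normal) = ennreal (exp (c\<^sup>2 / 2))"
proof -
  have "(\<integral>\<^sup>+z. ennreal (exp (c * z)) \<partial>std_normal)
      = (\<integral>\<^sup>+z. ennreal (std_normal_density z) * ennreal (exp (c * z)) \<partial>lborel)"
    unfolding std_normal_def by (subst nn_integral_density) auto
  also have "\<dots> = (\<integral>\<^sup>+z. ennreal (exp (c\<^sup>2 / 2)) * ennreal (normal_density c 1 z) \<partial>lborel)"
  proof (intro nn_integral_cong)
    fix z :: real
    have "- (z\<^sup>2 / 2) + c * z = c\<^sup>2 / 2 + (- ((z - c)\<^sup>2 / 2))"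
      by (simp add: power2_eq_square field_simps)
    then have "exp (- (z\<^sup>2 / 2)) * exp (c * z) = exp (c\<^sup>2 / 2) * exp (- ((z - c)\<^sup>2 / 2))"
      by (simp flip: exp_add)
    then have "std_normal_density z * exp (c * z) = exp (c\<^sup>2 / 2) * normal_density c 1 z"
      by (simp add: normal_density_def)
    then show "ennreal (std_normal_density z) * ennreal (exp (c * z)) =
        ennreal (exp (c\<^sup>2 / 2)) * ennreal (normal_density c 1 z)"
      by (simp flip: ennreal_mult)
  qed
  also have "\<dots> = ennreal (exp (c\<^sup>2 / 2)) * (\<integral>\<^sup>+z. ennreal (normal_density c 1 z) \<partial>lborel)"
    by (intro nn_integral_cmult) auto
  also have "(\<integral>\<^sup>+z. ennreal (normal_density c 1 z) \<partial>lborel) = 1"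
    using prob_space.emeasure_space_1[OF prob_space_normal_density[of 1 c]]
    by (simp add: emeasure_density)
  finally show ?thesis by simp
qed

abbreviation gaussians :: "'i set \<Rightarrow> ('i \<Rightarrow> real) measure" where
  "gaussians I \<equiv> PiM I (\<lambda>_. std_normal)"

lemma gaussian_linear_mgf:
  assumes "finite I"
  shows "(\<integral>\<^sup>+Z. ennreal (exp (\<Sum>e\<in>I. c e * Z e)) \<partial>gaussians I) = ennreal (exp ((\<Sum>e\<in>I. (c e)\<^sup>2) / 2))"
proof -
  have "(\<integral>\<^sup>+Z. ennreal (exp (\<Sum>e\<in>I. c e * Z e)) \<partial>gaussians I)
      = (\<integral>\<^sup>+Z. (\<Prod>e\<in>I. ennreal (exp (c e * Z e))) \<partial>gaussians I)"
    using assms by (intro nn_integral_cong) (simp add: exp_sum prod_ennreal)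
  also have "\<dots> = (\<Prod>e\<in>I. \<integral>\<^sup>+z. ennreal (exp (c e * z)) \<partial>std_normal)"
    using assms by (subst SNP.product_nn_integral_prod) auto
  also have "\<dots> = ennreal (exp (\<Sum>e\<in>I. (c e)\<^sup>2 / 2))"
    using assms by (simp add: std_normal_mgf exp_sum prod_ennreal)
  finally show ?thesis by (simp add: sum_divide_distrib)
qed

lemma prob_space_gaussians: "prob_space (gaussians I)"
  by (intro prob_space_PiM) simp

lemma indep_vars_gaussians:
  assumes "I \<noteq> {}"
  shows "prob_space.indep_vars (gaussians I) (\<lambda>_. std_normal) (\<lambda>e Z. Z e) I"
proof -
  interpret P: prob_space "gaussians I" by (rule prob_space_gaussians)
  show ?thesis
  proof (subst P.indep_vars_iff_distr_eq_PiM'[OF assms])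
    have "distr (gaussians I) (gaussians I) (\<lambda>x. \<lambda>i\<in>I. x i)
        = distr (gaussians I) (gaussians I) (\<lambda>x. x)"
      by (intro distr_cong) (auto simp: space_PiM extensional_restrict PiE_iff)
    also have "\<dots> = PiM I (\<lambda>i. distr (gaussians I) std_normal (\<lambda>\<omega>. \<omega> i))"
      unfolding distr_id by (intro PiM_cong refl distr_PiM_component[symmetric]) auto
    finally show "distr (gaussians I) (gaussians I) (\<lambda>x. \<lambda>i\<in>I. x i)
        = PiM I (\<lambda>i. distr (gaussians I) std_normal (\<lambda>\<omega>. \<omega> i))" .
  qed auto
qed

lemma distributed_gaussian_combination:
  assumes I: "finite I" "I \<noteq> {}" and K: "K \<subseteq> I" and v: "(\<Sum>e\<in>K. (c e)\<^sup>2) = v" "0 < v"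
  shows "distributed (gaussians I) lborel (\<lambda>Z. \<Sum>e\<in>K. c e * Z e) (normal_density 0 (sqrt v))"
proof -
  interpret P: prob_space "gaussians I" by (rule prob_space_gaussians)
  \<comment> \<open>Terms with coefficient zero have no density, so only the others can enter the
    sum of independent normal variables.\<close>
  define J where "J = {e\<in>K. c e \<noteq> 0}"
  have fin: "finite K" using I K finite_subset by auto
  have sumJ: "(\<Sum>e\<in>K. c e * Z e) = (\<Sum>e\<in>J. c e * Z e)" for Z :: "'a \<Rightarrow> real"
    unfolding J_def by (intro sum.mono_neutral_right fin) auto
  have vJ: "(\<Sum>e\<in>J. \<bar>c e\<bar>\<^sup>2) = v"
    unfolding v(1)[symmetric] power2_abs J_def by (intro sum.mono_neutral_left fin) auto
  have "J \<noteq> {}" using vJ v(2) by auto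
  have comp: "distributed (gaussians I) lborel (\<lambda>Z. Z e) (normal_density 0 1)" if "e \<in> I" for e
  proof -
    have "distr (gaussians I) lborel (\<lambda>Z. Z e) = distr (gaussians I) std_normal (\<lambda>Z. Z e)"
      by (intro distr_cong) auto
    also have "\<dots> = std_normal" using that by (intro distr_PiM_component) auto
    finally show ?thesis using that by (auto simp: distributed_def std_normal_def)
  qed
  have "distributed (gaussians I) lborel (\<lambda>Z. \<Sum>e\<in>J. c e * Z e)
      (normal_density (\<Sum>e\<in>J. 0) (sqrt (\<Sum>e\<in>J. \<bar>c e\<bar>\<^sup>2)))"
  proof (rule P.sum_indep_normal)
    have "P.indep_vars (\<lambda>_. std_normal) (\<lambda>e Z. Z e) J"
      by (rule P.indep_vars_subset[OF indep_vars_gaussians[OF I(2)]]) (use K J_def in auto)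
    then show "P.indep_vars (\<lambda>_. borel) (\<lambda>e Z. c e * Z e) J"
      by (rule P.indep_vars_compose2) auto
    fix e assume e: "e \<in> J"
    then show "0 < \<bar>c e\<bar>" by (simp add: J_def)
    show "distributed (gaussians I) lborel (\<lambda>Z. c e * Z e) (normal_density 0 \<bar>c e\<bar>)"
      using P.normal_density_affine[OF comp[of e], of "c e" 0] e K by (auto simp: J_def)
  qed (use fin \<open>J \<noteq> {}\<close> J_def in auto)
  then show ?thesis unfolding sumJ vJ by simp
qed

text \<open>The tilted density is again a centred normal one, of variance
  \<open>v / (1 - 2 * t * v)\<close>; the value is the ratio of the normalising constants.\<close>

lemma normal_square_mgf:
  assumes v: "0 < v" "2 * t * v < 1"
  shows "(\<integral>\<^sup>+x. ennreal (normal_density 0 (sqrt v) x) * ennreal (exp (t * x\<^sup>2)) \<partial>lborel)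
     = ennreal (1 / sqrt (1 - 2 * t * v))"
proof -
  define a where "a = 1 - 2 * t * v"
  have a: "0 < a" using v by (simp add: a_def)
  have eq: "normal_density 0 (sqrt v) x * exp (t * x\<^sup>2) = 1 / sqrt a * normal_density 0 (sqrt (v / a)) x" for x
  proof -
    have "- (x\<^sup>2 / (2 * v)) + t * x\<^sup>2 = - (x\<^sup>2 / (2 * (v / a)))"
      using v by (simp add: a_def field_simps)
    then have "exp (- (x\<^sup>2 / (2 * v))) * exp (t * x\<^sup>2) = exp (- (x\<^sup>2 / (2 * (v / a))))"
      by (simp flip: exp_add)
    moreover have "1 / sqrt (2 * pi * v) = 1 / sqrt a * (1 / sqrt (2 * pi * (v / a)))"
      using a v by (simp add: real_sqrt_mult real_sqrt_divide)
    ultimately show ?thesis using v a by (simp add: normal_density_def)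
  qed
  have "(\<integral>\<^sup>+x. ennreal (normal_density 0 (sqrt v) x) * ennreal (exp (t * x\<^sup>2)) \<partial>lborel)
      = (\<integral>\<^sup>+x. ennreal (1 / sqrt a) * ennreal (normal_density 0 (sqrt (v / a)) x) \<partial>lborel)"
    using a eq by (intro nn_integral_cong) (simp flip: ennreal_mult)
  also have "\<dots> = ennreal (1 / sqrt a) * (\<integral>\<^sup>+x. ennreal (normal_density 0 (sqrt (v / a)) x) \<partial>lborel)"
    by (intro nn_integral_cmult) auto
  also have "(\<integral>\<^sup>+x. ennreal (normal_density 0 (sqrt (v / a)) x) \<partial>lborel) = 1"
    using prob_space.emeasure_space_1[OF prob_space_normal_density[of "sqrt (v / a)" 0]] a v
    by (simp add: emeasure_density)
  finally show ?thesis by (simp add: a_def)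
qed

text \<open>Sums over disjoint blocks are independent normals of equal variance, so the transforms
  of their squares multiply. The blocks will be the columns of the noise for \<open>tmul\<close> and
  its rows for \<open>noise_proj\<close>.\<close>

lemma gaussian_quadratic_mgf:
  assumes I: "finite I" "I \<noteq> {}" and L: "finite L" and K: "\<And>l. l \<in> L \<Longrightarrow> K l \<subseteq> I" "disjoint_family_on K L"
    and v: "\<And>l. l \<in> L \<Longrightarrow> (\<Sum>e\<in>K l. (c e)\<^sup>2) = v" "0 < v" and t: "2 * t * v < 1"
  shows "(\<integral>\<^sup>+Z. ennreal (exp (t * (\<Sum>l\<in>L. (\<Sum>e\<in>K l. c e * Z e)\<^sup>2))) \<partial>gaussians I)
     = ennreal ((1 / sqrt (1 - 2 * t * v)) ^ card L)"
proof -
  interpret P: prob_space "gaussians I" by (rule prob_space_gaussians)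
  define X where "X l Z = ennreal (exp (t * (\<Sum>e\<in>K l. c e * Z e)\<^sup>2))" for l and Z :: "'a \<Rightarrow> real"
  have "P.indep_vars (\<lambda>l. PiM (K l) (\<lambda>_. std_normal)) (\<lambda>l Z. restrict (\<lambda>e. Z e) (K l)) L"
    by (rule P.indep_vars_restrict[OF indep_vars_gaussians[OF I(2)] K])
  then have "P.indep_vars (\<lambda>_. borel) (\<lambda>l Z. X l (restrict (\<lambda>e. Z e) (K l))) L"
    by (rule P.indep_vars_compose2) (auto simp: X_def)
  moreover have "X l (restrict (\<lambda>e. Z e) (K l)) = X l Z" for l and Z :: "'a \<Rightarrow> real"
    by (simp add: X_def)
  ultimately have ind: "P.indep_vars (\<lambda>_. borel) X L" by simp
  have one: "(\<integral>\<^sup>+Z. X l Z \<partial>gaussians I) = ennreal (1 / sqrt (1 - 2 * t * v))" if l: "l \<in> L" for l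
    unfolding X_def
    using distributed_nn_integral[OF distributed_gaussian_combination[OF I K(1)[OF l] v(1)[OF l] v(2)],
        of "\<lambda>x. ennreal (exp (t * x\<^sup>2))"] normal_square_mgf[OF v(2) t] by simp
  have "(\<integral>\<^sup>+Z. ennreal (exp (t * (\<Sum>l\<in>L. (\<Sum>e\<in>K l. c e * Z e)\<^sup>2))) \<partial>gaussians I)
      = (\<integral>\<^sup>+Z. (\<Prod>l\<in>L. X l Z) \<partial>gaussians I)"
    using L by (intro nn_integral_cong) (simp add: X_def exp_sum prod_ennreal sum_distrib_left)
  also have "\<dots> = (\<Prod>l\<in>L. \<integral>\<^sup>+Z. X l Z \<partial>gaussians I)"
    by (rule P.indep_vars_nn_integral[OF L ind]) simp
  also have "\<dots> = ennreal ((1 / sqrt (1 - 2 * t * v)) ^ card L)"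
    using t by (simp add: one ennreal_power)
  finally show ?thesis .
qed

lemma inverse_sqrt_le_exp:
  fixes w :: real
  assumes "\<bar>w\<bar> \<le> 1 / 4"
  shows "1 / sqrt (1 - 2 * w) \<le> exp (w + 4 * w\<^sup>2)"
proof -
  have "\<bar>ln (1 + (- 2 * w)) - (- 2 * w)\<bar> \<le> 2 * (- 2 * w)\<^sup>2"
    using assms by (intro abs_ln_one_plus_x_minus_x_bound) auto
  then have "- (w + 4 * w\<^sup>2) \<le> ln (1 - 2 * w) / 2" by (simp add: power2_eq_square abs_le_iff)
  also have "\<dots> = ln (sqrt (1 - 2 * w))" using assms by (simp add: ln_sqrt)
  finally have "exp (- (w + 4 * w\<^sup>2)) \<le> sqrt (1 - 2 * w)"
    using assms by (subst (asm) ln_ge_iff) auto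
  then have "1 / sqrt (1 - 2 * w) \<le> 1 / exp (- (w + 4 * w\<^sup>2))"
    using assms by (intro divide_left_mono) auto
  then show ?thesis by (simp only: exp_minus divide_inverse inverse_inverse_eq mult_1)
qed

lemma sum_Times_singleton:
  "(\<Sum>e\<in>A \<times> {k}. g e) = (\<Sum>j\<in>A. g (j, k))" "(\<Sum>e\<in>{l} \<times> B. h e) = (\<Sum>j\<in>B. h (l, j))"
proof -
  have "A \<times> {k} = (\<lambda>j. (j, k)) ` A" "{l} \<times> B = Pair l ` B" by auto
  then show "(\<Sum>e\<in>A \<times> {k}. g e) = (\<Sum>j\<in>A. g (j, k))" "(\<Sum>e\<in>{l} \<times> B. h e) = (\<Sum>j\<in>B. h (l, j))"
    by (simp_all add: sum.reindex inj_on_def)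
qed

text \<open>A chi-square bound with the tilt scaled so that
  \<open>t * v = \<plusminus>\<tau>\<close>. The threshold carries the factor
  \<open>ip n x x\<close>, which makes the estimate the same for all lattice points; for
  \<open>x = 0\<close> the event is empty.\<close>

lemma quadratic_noise_tail:
  fixes x :: "nat \<Rightarrow> real"
  assumes n: "1 \<le> n" "1 \<le> d" and \<tau>: "0 < \<tau>" "\<tau> \<le> 1 / 4"
  shows "emeasure (gaussians ({..<n} \<times> {..<d}))
     {Z \<in> space (gaussians ({..<n} \<times> {..<d})). s * ip n x x < \<bar>sqn d (tmul n (curry Z) x) - d * ip n x x\<bar>}
     \<le> ennreal (2 * exp (- \<tau> * s + 4 * d * \<tau>\<^sup>2))"
proof (cases "ip n x x = 0")
  case True
  then have "tmul n (curry Z) x k = 0" for Z k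
    by (auto simp: ip_self_eq_0 tmul_def)
  then show ?thesis using True by (simp add: ip_def)
next
  case False
  then have v: "0 < ip n x x" using ip_self_nonneg[of n x] by linarith
  define v where "v = ip n x x"
  let ?P = "gaussians ({..<n} \<times> {..<d})"
  define q where "q Z = sqn d (tmul n (curry Z) x)" for Z
  have q_eq: "q Z = (\<Sum>k<d. (\<Sum>e\<in>{..<n} \<times> {k}. x (fst e) * Z e)\<^sup>2)" for Z
    by (simp add: q_def ip_def tmul_def power2_eq_square sum_Times_singleton)
  have [measurable]: "q \<in> borel_measurable ?P"
    unfolding q_def ip_def tmul_def curry_def by measurable
  have mgf: "(\<integral>\<^sup>+Z. ennreal (exp (t * (q Z - d * v) - \<tau> * s)) \<partial>?P) \<le> ennreal (exp (- \<tau> * s + 4 * d * \<tau>\<^sup>2))"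
    if t: "\<bar>t * v\<bar> = \<tau>" for t
  proof -
    have "(\<integral>\<^sup>+Z. ennreal (exp (t * (q Z - d * v) - \<tau> * s)) \<partial>?P)
        = (\<integral>\<^sup>+Z. ennreal (exp (- (t * d * v) - \<tau> * s)) * ennreal (exp (t * q Z)) \<partial>?P)"
      by (intro nn_integral_cong) (simp add: algebra_simps flip: ennreal_mult exp_add)
    also have "\<dots> = ennreal (exp (- (t * d * v) - \<tau> * s)) * (\<integral>\<^sup>+Z. ennreal (exp (t * q Z)) \<partial>?P)"
      by (intro nn_integral_cmult) auto
    also have "(\<integral>\<^sup>+Z. ennreal (exp (t * q Z)) \<partial>?P) = ennreal ((1 / sqrt (1 - 2 * t * v)) ^ card {..<d})"
      unfolding q_eq
    proof (rule gaussian_quadratic_mgf)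
      show "2 * t * v < 1" using t \<tau> by (auto simp: abs_le_iff)
      show "(\<Sum>e\<in>{..<n} \<times> {k}. (x (fst e))\<^sup>2) = v" for k
        by (simp add: v_def ip_def power2_eq_square sum_Times_singleton)
      show "0 < v" using v by (simp add: v_def)
    qed (use n in \<open>auto simp: disjoint_family_on_def lessThan_empty_iff\<close>)
    also have "\<dots> \<le> ennreal (exp (t * v + 4 * (t * v)\<^sup>2) ^ card {..<d})"
      using inverse_sqrt_le_exp[of "t * v"] t \<tau> by (intro ennreal_leI power_mono) (auto simp: mult.assoc)
    also have "ennreal (exp (- (t * d * v) - \<tau> * s)) * \<dots> = ennreal (exp (- (t * d * v) - \<tau> * s) * exp (t * v + 4 * (t * v)\<^sup>2) ^ d)"
      by (simp add: ennreal_mult)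
    also have "exp (- (t * d * v) - \<tau> * s) * exp (t * v + 4 * (t * v)\<^sup>2) ^ d = exp (- \<tau> * s + 4 * d * (t * v)\<^sup>2)"
      by (simp add: algebra_simps flip: exp_add exp_of_nat_mult)
    also have "(t * v)\<^sup>2 = \<tau>\<^sup>2" using t by (metis power2_abs)
    finally show ?thesis by (simp add: mult_left_mono)
  qed
  have "emeasure ?P {Z \<in> space ?P. s * v < \<bar>q Z - d * v\<bar>} \<le> ennreal (2 * exp (- \<tau> * s + 4 * d * \<tau>\<^sup>2))"
  proof (rule two_sided_chernoff)
    show "0 < \<tau> / v" using v \<tau> by (simp add: v_def)
    fix \<sigma> :: real assume \<sigma>: "\<sigma> = 1 \<or> \<sigma> = -1"
    have "\<bar>\<sigma> * (\<tau> / v) * v\<bar> = \<tau>" "\<tau> / v * (s * v) = \<tau> * s" using \<sigma> v \<tau> by (auto simp: v_def)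
    then show "(\<integral>\<^sup>+Z. ennreal (exp (\<sigma> * (\<tau> / v) * (q Z - d * v) - \<tau> / v * (s * v))) \<partial>?P)
        \<le> ennreal (exp (- \<tau> * s + 4 * d * \<tau>\<^sup>2))"
      using mgf by presburger
  qed auto
  then show ?thesis by (simp add: v_def q_def)
qed

text \<open>Stated on the finite net, the event is measurable and open to a union bound. The level
  \<open>\<rho> / 4\<close> offsets the factor 4 lost by \<open>quadratic_form_net\<close> in
  passing to all vectors.\<close>

definition good_noise :: "nat \<Rightarrow> nat \<Rightarrow> (nat \<Rightarrow> real) \<Rightarrow> real \<Rightarrow> real \<Rightarrow> (nat \<times> nat \<Rightarrow> real) \<Rightarrow> bool" where
  "good_noise n d \<mu> r2 \<rho> Z \<longleftrightarrow>
     (\<forall>k\<in>int_net n. \<bar>sqn d (tmul n (curry Z) (\<lambda>i. of_int (k i))) - d * ip n (\<lambda>i. of_int (k i)) (\<lambda>i. of_int (k i))\<bar>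
        \<le> \<rho> / 4 * (n * r2) * ip n (\<lambda>i. of_int (k i)) (\<lambda>i. of_int (k i)))
     \<and> sqn n (noise_proj d \<mu> Z) \<le> \<rho>\<^sup>2 * n * r2\<^sup>2"

lemma good_noise_forms:
  assumes n: "1 \<le> n" and r2: "0 \<le> r2" and \<rho>: "0 \<le> \<rho>" and g: "good_noise n d \<mu> r2 \<rho> Z"
  shows "\<bar>sqn d (tmul n (curry Z) x) - d * ip n x x\<bar> \<le> \<rho> * (n * r2) * ip n x x"
    and "nrm n (noise_proj d \<mu> Z) \<le> \<rho> * sqrt n * r2"
proof -
  define M where "M = (\<lambda>i j. (\<Sum>k<d. Z (i, k) * Z (j, k)) - (if i = j then real d else 0))"
  have form: "ip n x (mv n M x) = sqn d (tmul n (curry Z) x) - d * ip n x x" for x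
  proof -
    have "sqn d (tmul n (curry Z) x) = (\<Sum>k<d. \<Sum>i<n. \<Sum>j<n. (x i * Z (i, k)) * (x j * Z (j, k)))"
      unfolding ip_def tmul_def sum_product curry_def ..
    also have "\<dots> = (\<Sum>i<n. \<Sum>k<d. \<Sum>j<n. (x i * Z (i, k)) * (x j * Z (j, k)))" by (rule sum.swap)
    also have "\<dots> = (\<Sum>i<n. \<Sum>j<n. \<Sum>k<d. (x i * Z (i, k)) * (x j * Z (j, k)))"
      by (intro sum.cong refl sum.swap)
    also have "\<dots> = (\<Sum>i<n. \<Sum>j<n. M i j * x i * x j + (if j = i then d * x i * x i else 0))"
      by (intro sum.cong refl) (auto simp: M_def sum_distrib_left sum_distrib_right algebra_simps)
    finally show ?thesis by (simp add: ip_mv sum.distrib ip_def[of n x x] sum_distrib_left mult.assoc)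
  qed
  have "\<bar>ip n x (mv n M x)\<bar> \<le> 4 * (\<rho> / 4 * (n * r2)) * ip n x x"
  proof (rule quadratic_form_net[OF n])
    show "sym_mat n M" by (auto simp: sym_mat_def M_def mult.commute)
    show "0 \<le> \<rho> / 4 * (n * r2)" using \<rho> r2 by simp
  qed (use g in \<open>simp add: form good_noise_def\<close>)
  then show "\<bar>sqn d (tmul n (curry Z) x) - d * ip n x x\<bar> \<le> \<rho> * (n * r2) * ip n x x"
    by (simp add: form)
  have "sqrt (sqn n (noise_proj d \<mu> Z)) \<le> sqrt (\<rho>\<^sup>2 * n * r2\<^sup>2)"
    using g by (intro real_sqrt_le_mono) (simp add: good_noise_def)
  then show "nrm n (noise_proj d \<mu> Z) \<le> \<rho> * sqrt n * r2"
    using \<rho> r2 by (simp add: nrm_def real_sqrt_mult)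
qed

lemma measurable_tmul_form [measurable]:
  "(\<lambda>Z. sqn d (tmul n (curry Z) x)) \<in> borel_measurable (gaussians ({..<n} \<times> {..<d}))"
  unfolding ip_def tmul_def curry_def by measurable

lemma measurable_noise_proj_form [measurable]:
  "(\<lambda>Z. sqn n (noise_proj d \<mu> Z)) \<in> borel_measurable (gaussians ({..<n} \<times> {..<d}))"
  unfolding ip_def noise_proj_def by measurable

lemma measurable_good_noise [measurable]:
  "Measurable.pred (gaussians ({..<n} \<times> {..<d})) (good_noise n d \<mu> r2 \<rho>)"
  unfolding good_noise_def by (intro pred_intros_logic pred_intros_finite finite_int_net) measurable

lemma noise_proj_tail:
  assumes n: "1 \<le> n" "1 \<le> d" and r2: "sqn d \<mu> = r2" "0 < r2" and \<rho>: "12 \<le> \<rho>\<^sup>2 * r2"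
  shows "emeasure (gaussians ({..<n} \<times> {..<d}))
     {Z \<in> space (gaussians ({..<n} \<times> {..<d})). \<rho>\<^sup>2 * n * r2\<^sup>2 < sqn n (noise_proj d \<mu> Z)}
     \<le> ennreal (exp (- 2 * real n))"
proof -
  let ?P = "gaussians ({..<n} \<times> {..<d})"
  \<comment> \<open>With this tilt, \<open>inverse_sqrt_le_exp\<close> is applied at
    \<open>1/4\<close> and each of the \<open>n\<close> factors is at most \<open>exp 1\<close>,
    while \<open>12 \<le> \<rho>\<^sup>2 * r2\<close> gives
    \<open>t * s \<ge> 3 * n\<close>.\<close>
  define t where "t = 1 / (4 * r2)"
  define s where "s = \<rho>\<^sup>2 * n * r2\<^sup>2"
  define q where "q Z = sqn n (noise_proj d \<mu> Z)" for Z
  have q_eq: "q Z = (\<Sum>j<n. (\<Sum>e\<in>{j} \<times> {..<d}. \<mu> (snd e) * Z e)\<^sup>2)" for Z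
    by (simp add: q_def ip_def noise_proj_def power2_eq_square sum_Times_singleton)
  have [measurable]: "q \<in> borel_measurable ?P" unfolding q_def by measurable
  have "emeasure ?P {Z \<in> space ?P. s < q Z} \<le> (\<integral>\<^sup>+Z. ennreal (exp (- (t * s))) * ennreal (exp (t * q Z)) \<partial>?P)"
  proof (rule emeasure_le_nn_integral)
    fix Z assume "Z \<in> {Z \<in> space ?P. s < q Z}"
    then have "t * s \<le> t * q Z" using r2 by (intro mult_left_mono) (auto simp: t_def)
    then show "1 \<le> ennreal (exp (- (t * s))) * ennreal (exp (t * q Z))"
      by (simp flip: ennreal_mult exp_add)
  qed measurable
  also have "\<dots> = ennreal (exp (- (t * s))) * (\<integral>\<^sup>+Z. ennreal (exp (t * q Z)) \<partial>?P)"
    by (intro nn_integral_cmult) auto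
  also have "(\<integral>\<^sup>+Z. ennreal (exp (t * q Z)) \<partial>?P) = ennreal ((1 / sqrt (1 - 2 * t * r2)) ^ card {..<n})"
    unfolding q_eq
  proof (rule gaussian_quadratic_mgf)
    show "2 * t * r2 < 1" using r2 by (simp add: t_def)
    show "(\<Sum>e\<in>{k} \<times> {..<d}. (\<mu> (snd e))\<^sup>2) = r2" for k
      using r2 by (simp add: ip_def power2_eq_square sum_Times_singleton)
  qed (use n r2 in \<open>auto simp: disjoint_family_on_def lessThan_empty_iff\<close>)
  also have "\<dots> \<le> ennreal (exp 1 ^ n)"
  proof -
    have "1 / sqrt (1 - 2 * t * r2) \<le> exp (t * r2 + 4 * (t * r2)\<^sup>2)"
      using inverse_sqrt_le_exp[of "t * r2"] r2 by (simp add: t_def)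
    also have "\<dots> \<le> exp 1" using r2 by (simp add: t_def power2_eq_square)
    finally show ?thesis using r2 by (auto intro!: ennreal_leI power_mono simp: t_def)
  qed
  also have "ennreal (exp (- (t * s))) * \<dots> = ennreal (exp (- (t * s) + n))"
    by (simp add: mult_exp_exp flip: ennreal_mult exp_of_nat_mult)
  also have "\<dots> \<le> ennreal (exp (- 2 * real n))"
  proof -
    have "12 * real n \<le> \<rho>\<^sup>2 * r2 * n" using \<rho> by (intro mult_right_mono) auto
    also have "\<dots> = 4 * (t * s)" using r2 by (simp add: t_def s_def power2_eq_square)
    finally show ?thesis by (intro ennreal_leI) (simp add: mult.commute)
  qed
  finally show ?thesis by (simp add: q_def s_def mult_left_mono)
qed

text \<open>A union bound over the net. The upper bounds on \<open>Q\<close> are the two halves of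
  the signal-to-noise relation: \<open>Q \<le> r2\<close> keeps the tilt small, and
  \<open>Q * d / n \<le> r2\<^sup>2\<close> controls the term \<open>4 * d * \<tau>\<^sup>2\<close>
  of the Wishart form.\<close>

lemma good_noise_prob:
  fixes Q :: real
  assumes n: "1 \<le> n" "1 \<le> d" and r2: "sqn d \<mu> = r2" "0 < r2" and \<rho>: "0 < \<rho>" "\<rho> \<le> 1"
    and Q: "57600 / \<rho>\<^sup>2 \<le> Q" "Q \<le> r2" "Q * d / n \<le> r2\<^sup>2"
  shows "emeasure (gaussians ({..<n} \<times> {..<d}))
     {Z \<in> space (gaussians ({..<n} \<times> {..<d})). \<not> good_noise n d \<mu> r2 \<rho> Z}
     \<le> ennreal (3 * exp (- 2 * real n))"
proof -
  let ?P = "gaussians ({..<n} \<times> {..<d})"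
  define s where "s = \<rho> / 4 * (n * r2)"
  \<comment> \<open>The tail starts at \<open>exp (- 30 * n)\<close>, of which
    \<open>4 * d * \<tau>\<^sup>2\<close> takes back \<open>n\<close>; against a net of at most
    \<open>exp (27 * n)\<close> points there remains \<open>exp (- 2 * n)\<close>. As
    \<open>\<tau> = 120 / (\<rho> * r2)\<close>, the constant 57600 is 4 times the square of
    120.\<close>
  define \<tau> where "\<tau> = 30 * n / s"
  define k' where "k' k = (\<lambda>i::nat. real_of_int (k i))" for k
  have "57600 \<le> \<rho>\<^sup>2 * Q" using Q(1) \<rho> by (simp add: field_simps)
  also have "\<dots> \<le> \<rho>\<^sup>2 * r2" using Q(2) by (intro mult_left_mono) auto
  finally have Qr: "57600 \<le> \<rho>\<^sup>2 * r2" .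
  have "\<rho>\<^sup>2 * r2 \<le> \<rho> * r2"
    using \<rho> r2 by (intro mult_right_mono) (auto simp: power2_eq_square mult_left_le_one_le)
  then have Qr': "57600 \<le> \<rho> * r2" using Qr by simp
  have s: "0 < s" using \<rho> r2 n by (simp add: s_def)
  have \<tau>: "0 < \<tau>" "\<tau> \<le> 1 / 4" "\<tau> * s = 30 * n"
    using s n Qr' by (auto simp: \<tau>_def) (simp add: s_def field_simps)
  have \<tau>d: "4 * d * \<tau>\<^sup>2 \<le> n"
  proof -
    have "\<tau> = 120 / (\<rho> * r2)" using n \<rho> r2 by (simp add: \<tau>_def s_def)
    then have "4 * d * \<tau>\<^sup>2 = 57600 * d / (\<rho>\<^sup>2 * r2\<^sup>2)" by (simp add: power_divide power_mult_distrib)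
    also have "\<dots> \<le> n"
    proof -
      have "57600 * real d \<le> \<rho>\<^sup>2 * Q * d"
        using Q(1) \<rho> by (intro mult_right_mono) (auto simp: field_simps)
      also have "\<dots> \<le> \<rho>\<^sup>2 * (r2\<^sup>2 * n)"
        using Q(3) n \<rho> by (simp add: divide_le_eq mult.assoc)
      finally show ?thesis using \<rho> r2 by (simp add: divide_le_eq mult_ac)
    qed
    finally show ?thesis .
  qed
  have m1: "{Z \<in> space ?P. s * ip n (k' k) (k' k) < \<bar>sqn d (tmul n (curry Z) (k' k)) - d * ip n (k' k) (k' k)\<bar>} \<in> sets ?P" for k
    by measurable
  have m2: "{Z \<in> space ?P. \<rho>\<^sup>2 * n * r2\<^sup>2 < sqn n (noise_proj d \<mu> Z)} \<in> sets ?P"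
    by measurable
  have sub: "{Z \<in> space ?P. \<not> good_noise n d \<mu> r2 \<rho> Z} \<subseteq>
     (\<Union>k\<in>int_net n. {Z \<in> space ?P. s * ip n (k' k) (k' k) < \<bar>sqn d (tmul n (curry Z) (k' k)) - d * ip n (k' k) (k' k)\<bar>})
     \<union> {Z \<in> space ?P. \<rho>\<^sup>2 * n * r2\<^sup>2 < sqn n (noise_proj d \<mu> Z)}"
    by (auto simp: good_noise_def s_def k'_def not_le)
  have "emeasure ?P {Z \<in> space ?P. \<not> good_noise n d \<mu> r2 \<rho> Z} \<le>
     emeasure ?P (\<Union>k\<in>int_net n. {Z \<in> space ?P. s * ip n (k' k) (k' k) < \<bar>sqn d (tmul n (curry Z) (k' k)) - d * ip n (k' k) (k' k)\<bar>})
     + emeasure ?P {Z \<in> space ?P. \<rho>\<^sup>2 * n * r2\<^sup>2 < sqn n (noise_proj d \<mu> Z)}"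
    by (intro order_trans[OF emeasure_mono[OF sub] emeasure_subadditive] sets.Un sets.finite_UN m1 m2 finite_int_net)
  also have "\<dots> \<le> (\<Sum>k\<in>int_net n. ennreal (2 * exp (- \<tau> * s + 4 * d * \<tau>\<^sup>2))) + ennreal (exp (- 2 * real n))"
  proof (intro add_mono order_trans[OF emeasure_subadditive_finite] sum_mono)
    show "emeasure ?P {Z \<in> space ?P. \<rho>\<^sup>2 * n * r2\<^sup>2 < sqn n (noise_proj d \<mu> Z)} \<le> ennreal (exp (- 2 * real n))"
      using Qr by (intro noise_proj_tail n r2) simp
  qed (use quadratic_noise_tail[OF n \<tau>(1,2)] m1 in auto)
  also have "(\<Sum>k\<in>int_net n. ennreal (2 * exp (- \<tau> * s + 4 * d * \<tau>\<^sup>2)))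
      = ennreal (card (int_net n) * (2 * exp (- \<tau> * s + 4 * d * \<tau>\<^sup>2)))"
    by (simp add: ennreal_mult ennreal_of_nat_eq_real_of_nat)
  also have "\<dots> \<le> ennreal (exp (27 * n) * (2 * exp (- 29 * real n)))"
  proof (intro ennreal_leI mult_mono)
    have "2 \<le> exp (1::real)" using exp_ge_add_one_self[of 1] by simp
    moreover have "3 \<le> exp (2::real)" using exp_ge_add_one_self[of 2] by simp
    ultimately have "(2::real) ^ (25 * n) * 3 ^ n \<le> exp 1 ^ (25 * n) * exp 2 ^ n"
      by (intro mult_mono power_mono) auto
    also have "\<dots> = exp (27 * n)" by (simp flip: exp_of_nat_mult exp_add)
    finally show "real (card (int_net n)) \<le> exp (27 * n)" using card_int_net[of n] by linarith
  qed (use \<tau>(3) \<tau>d in auto)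
  also have "exp (27 * n) * (2 * exp (- 29 * real n)) = 2 * exp (- 2 * real n)"
    by (simp add: mult_exp_exp)
  also have "ennreal (2 * exp (- 2 * real n)) + ennreal (exp (- 2 * real n)) = ennreal (3 * exp (- 2 * real n))"
    by (simp flip: ennreal_plus)
  finally show ?thesis
    by (simp add: add_mono)
qed

section \<open>The leave-one-out score as a function of the noise\<close>

lemma loo_mat_gram_cong:
  assumes "\<And>j k. j < n \<Longrightarrow> j \<noteq> i \<Longrightarrow> k < d \<Longrightarrow> Z (j, k) = Z' (j, k)"
  shows "loo_mat i (gram_hollow n d (gmm_X y \<mu> Z)) = loo_mat i (gram_hollow n d (gmm_X y \<mu> Z'))"
  using assms by (intro ext) (auto simp: loo_mat_def gram_hollow_def gmm_X_def intro!: sum.cong)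

lemma loo_vec_cong: "loo_mat i G = loo_mat i G' \<Longrightarrow> loo_vec n G y i = loo_vec n G' y i"
  by (auto simp: loo_vec_def)

context
  fixes n d :: nat and y \<mu> :: "nat \<Rightarrow> real" and i :: nat
begin

abbreviation (input) "noise_space \<equiv> gaussians ({..<n} \<times> {..<d})"

definition "gram Z = gram_hollow n d (gmm_X y \<mu> Z)"
definition "loo_p Z = loo_vec n (gram Z) y i"
definition "loo_W Z = tmul n (gmm_X y \<mu> Z) (loo_p Z)"

lemma measurable_gmm [measurable]: "a < n \<Longrightarrow> k < d \<Longrightarrow> (\<lambda>Z. gmm_X y \<mu> Z a k) \<in> borel_measurable noise_space"
  unfolding gmm_X_def by measurable

lemma measurable_gram [measurable]: "(\<lambda>Z. gram Z a b) \<in> borel_measurable noise_space"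
  unfolding gram_def gram_hollow_def
  by (cases "a < n \<and> b < n \<and> a \<noteq> b") (auto intro!: borel_measurable_sum borel_measurable_times measurable_gmm)

lemma measurable_loo_mat [measurable]: "(\<lambda>Z. loo_mat i (gram Z) a b) \<in> borel_measurable noise_space"
  unfolding loo_mat_def by measurable

lemma measurable_power_iterate [measurable]: "(\<lambda>Z. (mv n (loo_mat i (gram Z)) ^^ k) y a) \<in> borel_measurable noise_space"
  by (induction k arbitrary: a) (auto simp: mv_def intro!: borel_measurable_sum borel_measurable_times)

lemma measurable_loo_p [measurable]: "(\<lambda>Z. loo_p Z a) \<in> borel_measurable noise_space"
  unfolding loo_p_def loo_vec_def ip_def by measurable

lemma measurable_loo_W [measurable]: "k < d \<Longrightarrow> (\<lambda>Z. loo_W Z k) \<in> borel_measurable noise_space"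
  unfolding loo_W_def tmul_def by (intro borel_measurable_sum borel_measurable_times) auto

lemma measurable_loo_score:
  assumes i: "i < n"
  shows "(\<lambda>Z. indicator {Z. loo_p Z i = 0 \<and> A \<le> ip d \<mu> (loo_W Z) \<and> sqn d (loo_W Z) \<le> B} Z
       * ennreal (exp (- t * (y i * ip d (gmm_X y \<mu> Z i) (loo_W Z) / \<Lambda>)))) \<in> borel_measurable noise_space"
proof -
  have [measurable]: "(\<lambda>Z. ip d \<mu> (loo_W Z)) \<in> borel_measurable noise_space" "(\<lambda>Z. sqn d (loo_W Z)) \<in> borel_measurable noise_space"
    unfolding ip_def by (intro borel_measurable_sum borel_measurable_times; simp)+
  have [measurable]: "Measurable.pred noise_space (\<lambda>Z. \<bar>loo_p Z i\<bar> \<le> 0 \<and> A \<le> ip d \<mu> (loo_W Z) \<and> sqn d (loo_W Z) \<le> B)"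
    by measurable
  have "(\<lambda>Z. indicator {Z. loo_p Z i = 0 \<and> A \<le> ip d \<mu> (loo_W Z) \<and> sqn d (loo_W Z) \<le> B} Z :: ennreal)
      = (\<lambda>Z. if \<bar>loo_p Z i\<bar> \<le> 0 \<and> A \<le> ip d \<mu> (loo_W Z) \<and> sqn d (loo_W Z) \<le> B then 1 else 0)"
    by (auto simp: indicator_def)
  then have [measurable]: "(\<lambda>Z. indicator {Z. loo_p Z i = 0 \<and> A \<le> ip d \<mu> (loo_W Z) \<and> sqn d (loo_W Z) \<le> B} Z :: ennreal)
      \<in> borel_measurable noise_space"
    by simp
  have [measurable]: "(\<lambda>Z. exp (- t * (y i * ip d (gmm_X y \<mu> Z i) (loo_W Z) / \<Lambda>))) \<in> borel_measurable noise_space"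
    unfolding ip_def using i by measurable
  show ?thesis by measurable
qed

text \<open>The row \<open>i\<close> of the noise is independent of \<open>loo_W\<close>, so given the other rows the
  linearised score of vertex \<open>i\<close> is Gaussian.\<close>

lemma loo_score_mgf:
  assumes i: "i < n" and yi: "(y i)\<^sup>2 = 1" and \<Lambda>: "0 < \<Lambda>" and t: "0 \<le> t"
  shows "(\<integral>\<^sup>+Z. indicator {Z. loo_p Z i = 0 \<and> A \<le> ip d \<mu> (loo_W Z) \<and> sqn d (loo_W Z) \<le> B} Z
       * ennreal (exp (- t * (y i * ip d (gmm_X y \<mu> Z i) (loo_W Z) / \<Lambda>))) \<partial>noise_space)
     \<le> ennreal (exp (- t * A / \<Lambda> + t\<^sup>2 * B / (2 * \<Lambda>\<^sup>2)))"
proof -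
  define S where "S = {Z. loo_p Z i = 0 \<and> A \<le> ip d \<mu> (loo_W Z) \<and> sqn d (loo_W Z) \<le> B}"
  define F where "F Z = indicator S Z * ennreal (exp (- t * (y i * ip d (gmm_X y \<mu> Z i) (loo_W Z) / \<Lambda>)))" for Z
  define I where "I = ({..<n} - {i}) \<times> {..<d}"
  define J where "J = {i} \<times> {..<d}"
  have IJ: "{..<n} \<times> {..<d} = I \<union> J" "I \<inter> J = {}" "finite I" "finite J" using i by (auto simp: I_def J_def)
  have meas: "F \<in> borel_measurable noise_space"
    unfolding F_def S_def by (rule measurable_loo_score[OF i])
  have inner: "(\<integral>\<^sup>+z. F (merge I J (x, z)) \<partial>gaussians J) \<le> ennreal (exp (- t * A / \<Lambda> + t\<^sup>2 * B / (2 * \<Lambda>\<^sup>2)))"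
    for x
  proof -
    \<comment> \<open>Row \<open>i\<close> of the noise is set to zero in \<open>Z0\<close>.
      \<open>loo_p\<close> never sees that row, and where its entry \<open>i\<close> vanishes,
      neither does \<open>loo_W\<close>; hence \<open>Z0\<close> alone decides membership in
      \<open>S\<close>, and row \<open>i\<close> enters only through the exponential.\<close>
    define Z0 where "Z0 = merge I J (x, \<lambda>_. 0)"
    have off: "merge I J (x, z) (j, k) = Z0 (j, k)" if "j < n" "j \<noteq> i" "k < d" for z j k
      using that by (auto simp: Z0_def merge_def I_def)
    have on: "merge I J (x, z) (i, k) = z (i, k)" if "k < d" for z k
      using that by (auto simp: merge_def I_def J_def)
    have p_eq: "loo_p (merge I J (x, z)) = loo_p Z0" for z
      unfolding loo_p_def gram_def by (intro loo_vec_cong loo_mat_gram_cong off) auto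
    have W_eq: "loo_W (merge I J (x, z)) k = loo_W Z0 k" if "loo_p Z0 i = 0" "k < d" for z k
      unfolding loo_W_def p_eq tmul_def
    proof (intro sum.cong refl)
      fix j assume "j \<in> {..<n}"
      then show "loo_p Z0 j * gmm_X y \<mu> (merge I J (x, z)) j k = loo_p Z0 j * gmm_X y \<mu> Z0 j k"
        using that off by (cases "j = i") (auto simp: gmm_X_def)
    qed
    show ?thesis
    proof (cases "Z0 \<in> S")
      case False
      have "merge I J (x, z) \<notin> S" for z
      proof
        assume *: "merge I J (x, z) \<in> S"
        then have p0: "loo_p Z0 i = 0" by (simp add: S_def p_eq)
        have "ip d v (loo_W (merge I J (x, z))) = ip d v (loo_W Z0)" for v
          using p0 by (intro ip_cong) (auto simp: W_eq)
        moreover have "sqn d (loo_W (merge I J (x, z))) = sqn d (loo_W Z0)"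
          using p0 by (intro ip_cong) (auto simp: W_eq)
        ultimately show False using * False p0 by (auto simp: S_def)
      qed
      then have "F (merge I J (x, z)) = 0" for z by (simp add: F_def)
      then show ?thesis by simp
    next
      case True
      define W where "W = loo_W Z0"
      have W: "loo_p Z0 i = 0" "A \<le> ip d \<mu> W" "sqn d W \<le> B" using True by (auto simp: S_def W_def)
      define c where "c e = - t * y i * W (snd e) / \<Lambda>" for e :: "nat \<times> nat"
      have F: "F (merge I J (x, z)) \<le> ennreal (exp (- t * ip d \<mu> W / \<Lambda>)) * ennreal (exp (\<Sum>e\<in>J. c e * z e))" for z
      proof -
        have "ip d (gmm_X y \<mu> (merge I J (x, z)) i) (loo_W (merge I J (x, z))) = ip d (\<lambda>k. y i * \<mu> k + z (i, k)) W"
          using W by (intro ip_cong) (auto simp: W_eq W_def gmm_X_def on)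
        also have "\<dots> = y i * ip d \<mu> W + ip d (\<lambda>k. z (i, k)) W" by (simp add: ip_lin)
        finally have "y i * ip d (gmm_X y \<mu> (merge I J (x, z)) i) (loo_W (merge I J (x, z)))
            = ip d \<mu> W + y i * ip d (\<lambda>k. z (i, k)) W"
          using yi by (simp add: distrib_left power2_eq_square flip: mult.assoc)
        moreover have "(\<Sum>e\<in>J. c e * z e) = - t * (y i * ip d (\<lambda>k. z (i, k)) W) / \<Lambda>"
          unfolding J_def sum_Times_singleton c_def ip_def
          by (simp add: sum_distrib_left sum_negf sum_divide_distrib mult_ac)
        ultimately have "- t * (y i * ip d (gmm_X y \<mu> (merge I J (x, z)) i) (loo_W (merge I J (x, z))) / \<Lambda>)
            = - t * ip d \<mu> W / \<Lambda> + (\<Sum>e\<in>J. c e * z e)"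
          by (simp add: add_divide_distrib algebra_simps)
        then show ?thesis
          unfolding F_def by (auto simp: indicator_def mult_exp_exp simp flip: ennreal_mult)
      qed
      have "(\<integral>\<^sup>+z. F (merge I J (x, z)) \<partial>gaussians J)
          \<le> (\<integral>\<^sup>+z. ennreal (exp (- t * ip d \<mu> W / \<Lambda>)) * ennreal (exp (\<Sum>e\<in>J. c e * z e)) \<partial>gaussians J)"
        by (intro nn_integral_mono F)
      also have "\<dots> = ennreal (exp (- t * ip d \<mu> W / \<Lambda>)) * (\<integral>\<^sup>+z. ennreal (exp (\<Sum>e\<in>J. c e * z e)) \<partial>gaussians J)"
        by (intro nn_integral_cmult) measurable
      also have "\<dots> = ennreal (exp (- t * ip d \<mu> W / \<Lambda> + (\<Sum>e\<in>J. (c e)\<^sup>2) / 2))"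
        unfolding gaussian_linear_mgf[OF IJ(4)] by (simp add: mult_exp_exp flip: ennreal_mult)
      also have "(\<Sum>e\<in>J. (c e)\<^sup>2) = t\<^sup>2 * sqn d W / \<Lambda>\<^sup>2"
        unfolding J_def sum_Times_singleton c_def ip_def using yi
        by (simp add: sum_distrib_left sum_divide_distrib power_divide power_mult_distrib power2_eq_square[of "W _"])
      also have "ennreal (exp (- t * ip d \<mu> W / \<Lambda> + t\<^sup>2 * sqn d W / \<Lambda>\<^sup>2 / 2)) \<le> ennreal (exp (- t * A / \<Lambda> + t\<^sup>2 * B / (2 * \<Lambda>\<^sup>2)))"
      proof -
        have "t * A / \<Lambda> \<le> t * ip d \<mu> W / \<Lambda>"
          using W t \<Lambda> by (intro divide_right_mono mult_left_mono) auto
        moreover have "t\<^sup>2 * sqn d W / \<Lambda>\<^sup>2 / 2 \<le> t\<^sup>2 * B / \<Lambda>\<^sup>2 / 2"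
          using W by (intro divide_right_mono mult_left_mono) auto
        ultimately show ?thesis by (intro ennreal_leI) (simp add: mult.commute)
      qed
      finally show ?thesis .
    qed
  qed
  interpret PI: prob_space "gaussians I" by (rule prob_space_gaussians)
  \<comment> \<open>Fubini with row \<open>i\<close> as the inner variable; the inner bound is the
    same for all values of the other rows.\<close>
  have "(\<integral>\<^sup>+Z. F Z \<partial>noise_space) = (\<integral>\<^sup>+x. (\<integral>\<^sup>+z. F (merge I J (x, z)) \<partial>gaussians J) \<partial>gaussians I)"
    using meas unfolding IJ(1) by (rule SNP.product_nn_integral_fold[OF IJ(2-4)])
  also have "\<dots> \<le> (\<integral>\<^sup>+x. ennreal (exp (- t * A / \<Lambda> + t\<^sup>2 * B / (2 * \<Lambda>\<^sup>2))) \<partial>gaussians I)"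
    by (intro nn_integral_mono inner)
  also have "\<dots> = ennreal (exp (- t * A / \<Lambda> + t\<^sup>2 * B / (2 * \<Lambda>\<^sup>2)))"
    by (simp add: PI.emeasure_space_1)
  finally show ?thesis unfolding F_def S_def .
qed

end

section \<open>Random edges\<close>

abbreviation edges :: "nat \<Rightarrow> (nat \<times> nat) set" where
  "edges n \<equiv> {(i, j). i < j \<and> j < n}"

abbreviation unif01 :: "real measure" where
  "unif01 \<equiv> uniform_measure lborel {0..1}"

abbreviation edge_unif :: "nat \<Rightarrow> (nat \<times> nat \<Rightarrow> real) measure" where
  "edge_unif n \<equiv> PiM (edges n) (\<lambda>_. unif01)"

lemma finite_edges [simp]: "finite (edges n)"
  by (rule finite_subset[of _ "{..<n} \<times> {..<n}"]) auto

lemma prob_space_unif01: "prob_space unif01"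
  by (rule prob_space_uniform_measure) auto

interpretation U01: prob_space unif01 by (rule prob_space_unif01)
interpretation U01P: product_sigma_finite "\<lambda>_. unif01" by standard

text \<open>The Bernoulli transform \<open>1 + p * (exp c - 1)\<close> is bounded by that of a
  Poisson variable, so that independent edges simply add in the exponent.\<close>

lemma edge_mgf:
  assumes E: "finite E" and p: "\<And>e. e \<in> E \<Longrightarrow> 0 \<le> p e" "\<And>e. e \<in> E \<Longrightarrow> p e \<le> 1"
  shows "(\<integral>\<^sup>+U. ennreal (exp (\<Sum>e\<in>E. c e * (if U e < p e then 1 else 0))) \<partial>PiM E (\<lambda>_. unif01))
     \<le> ennreal (exp (\<Sum>e\<in>E. p e * (exp (c e) - 1)))"
proof -
  have one: "(\<integral>\<^sup>+u. ennreal (exp (c e * (if u < p e then 1 else 0))) \<partial>unif01) = ennreal (1 + p e * (exp (c e) - 1))"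
    if e: "e \<in> E" for e
  proof -
    have "emeasure unif01 {..<p e} = ennreal (p e)"
    proof -
      have "{0..1} \<inter> {..<p e} = {0..<p e}" using p[OF e] by auto
      then show ?thesis using p[OF e] by (simp add: emeasure_uniform_measure divide_ennreal[of _ 1, simplified])
    qed
    moreover have "emeasure unif01 (- {..<p e}) = ennreal (1 - p e)"
    proof -
      have "{0..1} \<inter> - {..<p e} = {p e..1}" using p[OF e] by auto
      then show ?thesis using p[OF e] by (simp add: emeasure_uniform_measure divide_ennreal[of _ 1, simplified])
    qed
    moreover have "(\<integral>\<^sup>+u. ennreal (exp (c e * (if u < p e then 1 else 0))) \<partial>unif01)
       = (\<integral>\<^sup>+u. ennreal (exp (c e)) * indicator {..<p e} u + indicator (- {..<p e}) u \<partial>unif01)"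
      by (intro nn_integral_cong) (auto simp: indicator_def)
    ultimately have "(\<integral>\<^sup>+u. ennreal (exp (c e * (if u < p e then 1 else 0))) \<partial>unif01) = ennreal (exp (c e)) * ennreal (p e) + ennreal (1 - p e)"
      by (simp add: nn_integral_add nn_integral_cmult)
    also have "\<dots> = ennreal (exp (c e) * p e + (1 - p e))"
      using p[OF e] by (subst ennreal_plus) (auto simp: ennreal_mult)
    finally show ?thesis by (simp add: algebra_simps)
  qed
  have "(\<integral>\<^sup>+U. ennreal (exp (\<Sum>e\<in>E. c e * (if U e < p e then 1 else 0))) \<partial>PiM E (\<lambda>_. unif01))
      = (\<integral>\<^sup>+U. (\<Prod>e\<in>E. ennreal (exp (c e * (if U e < p e then 1 else 0)))) \<partial>PiM E (\<lambda>_. unif01))"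
    using E by (intro nn_integral_cong) (simp only: exp_sum prod_ennreal exp_ge_zero)
  also have "\<dots> = (\<Prod>e\<in>E. \<integral>\<^sup>+u. ennreal (exp (c e * (if u < p e then 1 else 0))) \<partial>unif01)"
    by (rule U01P.product_nn_integral_prod[OF E]) measurable
  also have "\<dots> = (\<Prod>e\<in>E. ennreal (1 + p e * (exp (c e) - 1)))"
    by (intro prod.cong refl one)
  also have "\<dots> \<le> (\<Prod>e\<in>E. ennreal (exp (p e * (exp (c e) - 1))))"
    by (intro prod_mono_ennreal ennreal_leI exp_ge_add_one_self)
  also have "\<dots> = ennreal (exp (\<Sum>e\<in>E. p e * (exp (c e) - 1)))"
    using E by (simp add: prod_ennreal exp_sum)
  finally show ?thesis .
qed

lemma sum_edges: "(\<Sum>e\<in>edges n. g (fst e) (snd e)) = (\<Sum>j<n. \<Sum>i<j. g i j)"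
proof -
  have "(\<Sum>j<n. \<Sum>i<j. g i j) = (\<Sum>(j, i)\<in>Sigma {..<n} (\<lambda>j. {..<j}). g i j)"
    by (rule sum.Sigma) auto
  also have "\<dots> = (\<Sum>e\<in>edges n. g (fst e) (snd e))"
    by (rule sum.reindex_bij_witness[of _ prod.swap prod.swap]) auto
  finally show ?thesis ..
qed

lemma sum_incident_edges:
  fixes g :: "nat \<Rightarrow> real"
  assumes "i < n"
  shows "(\<Sum>e\<in>edges n. if fst e = i then g (snd e) else if snd e = i then g (fst e) else 0)
     = (\<Sum>m<n. if m = i then 0 else g m)"
proof -
  have "(\<Sum>e\<in>edges n. if fst e = i then g (snd e) else if snd e = i then g (fst e) else 0)
     = (\<Sum>m<n. \<Sum>k<m. if k = i then g m else if m = i then g k else 0)"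
    by (rule sum_edges)
  also have "\<dots> = (\<Sum>m<n. (if i < m then g m else 0) + (if m = i then (\<Sum>k<i. g k) else 0))"
  proof (intro sum.cong refl)
    fix m
    show "(\<Sum>k<m. if k = i then g m else if m = i then g k else 0)
        = (if i < m then g m else 0) + (if m = i then (\<Sum>k<i. g k) else 0)"
      by (cases "m = i") (simp_all cong: if_cong)
  qed
  also have "\<dots> = (\<Sum>m<n. if i < m then g m else 0) + (\<Sum>m<i. g m)"
    using assms by (simp add: sum.distrib)
  also have "(\<Sum>m<i. g m) = (\<Sum>m<n. if m < i then g m else 0)"
    using assms by (intro sum.mono_neutral_cong_left) auto
  also have "(\<Sum>m<n. if i < m then g m else 0) + \<dots> = (\<Sum>m<n. if m = i then 0 else g m)"
    unfolding sum.distrib[symmetric] by (intro sum.cong) auto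
  finally show ?thesis .
qed

lemma sum_symmetric_edges:
  fixes g :: "nat \<Rightarrow> nat \<Rightarrow> real"
  assumes "\<And>i j. g i j = g j i"
  shows "(\<Sum>i<n. \<Sum>j<n. g i j) = 2 * (\<Sum>e\<in>edges n. g (fst e) (snd e)) + (\<Sum>i<n. g i i)"
proof (induction n)
  case (Suc n)
  have "(\<Sum>i<Suc n. \<Sum>j<Suc n. g i j) = (\<Sum>i<n. \<Sum>j<n. g i j) + 2 * (\<Sum>i<n. g i n) + g n n"
    using assms by (simp add: sum.distrib)
  also have "\<dots> = 2 * (\<Sum>e\<in>edges (Suc n). g (fst e) (snd e)) + (\<Sum>i<Suc n. g i i)"
    using Suc unfolding sum_edges by simp
  finally show ?case .
qed (simp add: sum_edges)

definition edge_prob :: "real \<Rightarrow> real \<Rightarrow> (nat \<Rightarrow> real) \<Rightarrow> nat \<times> nat \<Rightarrow> real" where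
  "edge_prob \<alpha> \<beta> y e = (if y (fst e) = y (snd e) then \<alpha> else \<beta>)"

lemma sbm_adj_sym: "sbm_adj n \<alpha> \<beta> y U i j = sbm_adj n \<alpha> \<beta> y U j i"
  by (auto simp: sbm_adj_def min.commute max.commute)

lemma sbm_adj_edge:
  "e \<in> edges n \<Longrightarrow> sbm_adj n \<alpha> \<beta> y U (fst e) (snd e) = (if U e < edge_prob \<alpha> \<beta> y e then 1 else 0)"
  by (auto simp: sbm_adj_def edge_prob_def)

text \<open>Each edge at \<open>i\<close> appears once in the row, with \<open>i\<close> as its
  smaller or larger endpoint, so the row is a weighted sum of independent edge variables.\<close>

lemma row_mgf:
  assumes i: "i < n" and p: "0 \<le> \<alpha>" "\<alpha> \<le> 1" "0 \<le> \<beta>" "\<beta> \<le> 1"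
  shows "(\<integral>\<^sup>+U. ennreal (exp (\<Sum>m<n. \<theta> m * sbm_adj n \<alpha> \<beta> y U i m)) \<partial>edge_unif n)
     \<le> ennreal (exp (\<Sum>m<n. if m = i then 0 else edge_prob \<alpha> \<beta> y (i, m) * (exp (\<theta> m) - 1)))"
proof -
  define c where "c e = (if fst e = i then \<theta> (snd e) else if snd e = i then \<theta> (fst e) else 0)" for e
  have "(\<Sum>m<n. \<theta> m * sbm_adj n \<alpha> \<beta> y U i m)
      = (\<Sum>e\<in>edges n. c e * (if U e < edge_prob \<alpha> \<beta> y e then 1 else 0))" for U
  proof -
    have "(\<Sum>m<n. \<theta> m * sbm_adj n \<alpha> \<beta> y U i m) = (\<Sum>m<n. if m = i then 0 else \<theta> m * sbm_adj n \<alpha> \<beta> y U i m)"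
      by (intro sum.cong) (auto simp: sbm_adj_def)
    also have "\<dots> = (\<Sum>e\<in>edges n. if fst e = i then \<theta> (snd e) * sbm_adj n \<alpha> \<beta> y U i (snd e)
        else if snd e = i then \<theta> (fst e) * sbm_adj n \<alpha> \<beta> y U i (fst e) else 0)"
      by (rule sum_incident_edges[OF i, symmetric])
    also have "\<dots> = (\<Sum>e\<in>edges n. c e * sbm_adj n \<alpha> \<beta> y U (fst e) (snd e))"
      by (intro sum.cong refl) (auto simp: c_def sbm_adj_sym[of n \<alpha> \<beta> y U i])
    also have "\<dots> = (\<Sum>e\<in>edges n. c e * (if U e < edge_prob \<alpha> \<beta> y e then 1 else 0))"
      by (intro sum.cong refl) (simp only: sbm_adj_edge)
    finally show ?thesis .
  qed
  then have "(\<integral>\<^sup>+U. ennreal (exp (\<Sum>m<n. \<theta> m * sbm_adj n \<alpha> \<beta> y U i m)) \<partial>edge_unif n)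
     \<le> ennreal (exp (\<Sum>e\<in>edges n. edge_prob \<alpha> \<beta> y e * (exp (c e) - 1)))"
    using edge_mgf[of "edges n" "edge_prob \<alpha> \<beta> y" c] p by (simp add: edge_prob_def)
  also have "(\<Sum>e\<in>edges n. edge_prob \<alpha> \<beta> y e * (exp (c e) - 1))
    = (\<Sum>e\<in>edges n. if fst e = i then edge_prob \<alpha> \<beta> y (i, snd e) * (exp (\<theta> (snd e)) - 1)
        else if snd e = i then edge_prob \<alpha> \<beta> y (i, fst e) * (exp (\<theta> (fst e)) - 1) else 0)"
    by (intro sum.cong refl) (auto simp: c_def edge_prob_def)
  also have "\<dots> = (\<Sum>m<n. if m = i then 0 else edge_prob \<alpha> \<beta> y (i, m) * (exp (\<theta> m) - 1))"
    by (rule sum_incident_edges[OF i])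
  finally show ?thesis .
qed

lemma exp_minus_one_le:
  fixes x :: real
  assumes "\<bar>x\<bar> \<le> 1"
  shows "exp x - 1 \<le> x + x\<^sup>2"
proof (cases "0 \<le> x")
  case True
  then show ?thesis using exp_bound[of x] assms by simp
next
  case False
  then have "1 \<le> (1 - x) * (1 + x + x\<^sup>2)"
    using mult_nonneg_nonneg[of "- x" "x\<^sup>2"] by (simp add: algebra_simps power2_eq_square)
  then have "1 / (1 - x) \<le> 1 + x + x\<^sup>2" using False by (simp add: divide_le_eq mult.commute)
  moreover have "exp x \<le> 1 / (1 - x)"
  proof -
    have "1 / exp (- x) \<le> 1 / (1 - x)"
      using exp_ge_add_one_self[of "- x"] False by (intro divide_left_mono) auto
    then show ?thesis by (simp add: exp_minus divide_inverse)
  qed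
  ultimately show ?thesis by linarith
qed

section \<open>Error probability given the features\<close>

text \<open>A Bernstein-type bound: the weights lie in the unit interval, so
  \<open>c e * c e \<le> c e\<close> and the mean \<open>m\<close> dominates the second
  moments.\<close>

lemma edge_tail:
  assumes E: "finite E" and p: "\<And>e. e \<in> E \<Longrightarrow> 0 \<le> p e" "\<And>e. e \<in> E \<Longrightarrow> p e \<le> 1"
    and c: "\<And>e. e \<in> E \<Longrightarrow> 0 \<le> c e" "\<And>e. e \<in> E \<Longrightarrow> c e \<le> 1" and \<theta>: "0 < \<theta>" "\<theta> \<le> 1"
    and m: "m = (\<Sum>e\<in>E. p e * c e)"
  shows "emeasure (PiM E (\<lambda>_. unif01)) {U \<in> space (PiM E (\<lambda>_. unif01)).
        t < \<bar>(\<Sum>e\<in>E. c e * (if U e < p e then 1 else 0)) - m\<bar>}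
     \<le> ennreal (2 * exp (- \<theta> * t + \<theta>\<^sup>2 * m))"
proof -
  let ?P = "PiM E (\<lambda>_. unif01)"
  define T where "T U = (\<Sum>e\<in>E. c e * (if U e < p e then 1 else 0))" for U
  have [measurable]: "T \<in> borel_measurable ?P" unfolding T_def by measurable
  have mgf: "(\<integral>\<^sup>+U. ennreal (exp (\<sigma> * \<theta> * (T U - m) - \<theta> * t)) \<partial>?P) \<le> ennreal (exp (- \<theta> * t + \<theta>\<^sup>2 * m))"
    if \<sigma>: "\<sigma> = 1 \<or> \<sigma> = -1" for \<sigma> :: real
  proof -
    have "(\<integral>\<^sup>+U. ennreal (exp (\<sigma> * \<theta> * (T U - m) - \<theta> * t)) \<partial>?P)
        = (\<integral>\<^sup>+U. ennreal (exp (- \<sigma> * \<theta> * m - \<theta> * t)) * ennreal (exp (\<Sum>e\<in>E. (\<sigma> * \<theta> * c e) * (if U e < p e then 1 else 0))) \<partial>?P)"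
    proof (intro nn_integral_cong)
      fix U
      have "(\<Sum>e\<in>E. (\<sigma> * \<theta> * c e) * (if U e < p e then 1 else 0)) = \<sigma> * \<theta> * T U"
        by (simp add: T_def sum_distrib_left mult.assoc)
      then show "ennreal (exp (\<sigma> * \<theta> * (T U - m) - \<theta> * t))
        = ennreal (exp (- \<sigma> * \<theta> * m - \<theta> * t)) * ennreal (exp (\<Sum>e\<in>E. (\<sigma> * \<theta> * c e) * (if U e < p e then 1 else 0)))"
        by (simp add: mult_exp_exp algebra_simps flip: ennreal_mult)
    qed
    also have "\<dots> = ennreal (exp (- \<sigma> * \<theta> * m - \<theta> * t)) * (\<integral>\<^sup>+U. ennreal (exp (\<Sum>e\<in>E. (\<sigma> * \<theta> * c e) * (if U e < p e then 1 else 0))) \<partial>?P)"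
      by (intro nn_integral_cmult) measurable
    also have "\<dots> \<le> ennreal (exp (- \<sigma> * \<theta> * m - \<theta> * t)) * ennreal (exp (\<Sum>e\<in>E. p e * (exp (\<sigma> * \<theta> * c e) - 1)))"
      by (intro mult_left_mono edge_mgf E p) auto
    also have "\<dots> \<le> ennreal (exp (- \<sigma> * \<theta> * m - \<theta> * t)) * ennreal (exp (\<sigma> * \<theta> * m + \<theta>\<^sup>2 * m))"
    proof (intro mult_left_mono ennreal_leI, unfold exp_le_cancel_iff)
      have "(\<Sum>e\<in>E. p e * (exp (\<sigma> * \<theta> * c e) - 1)) \<le> (\<Sum>e\<in>E. \<sigma> * \<theta> * (p e * c e) + \<theta>\<^sup>2 * (p e * c e))"
      proof (rule sum_mono)
        fix e assume e: "e \<in> E"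
        have "\<theta> * c e \<le> 1 * 1" using \<theta> c[OF e] by (intro mult_mono) auto
        then have "exp (\<sigma> * \<theta> * c e) - 1 \<le> \<sigma> * \<theta> * c e + (\<sigma> * \<theta> * c e)\<^sup>2"
          using \<sigma> \<theta> c[OF e] by (intro exp_minus_one_le) (auto simp: abs_mult)
        also have "(\<sigma> * \<theta> * c e)\<^sup>2 = \<theta>\<^sup>2 * (c e * c e)"
          using \<sigma> by (auto simp: power2_eq_square)
        also have "\<dots> \<le> \<theta>\<^sup>2 * c e"
          using c[OF e] by (intro mult_left_mono) (auto simp: mult_left_le_one_le)
        finally have "exp (\<sigma> * \<theta> * c e) - 1 \<le> \<sigma> * \<theta> * c e + \<theta>\<^sup>2 * c e" by simp
        from mult_left_mono[OF this p(1)[OF e]]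
        show "p e * (exp (\<sigma> * \<theta> * c e) - 1) \<le> \<sigma> * \<theta> * (p e * c e) + \<theta>\<^sup>2 * (p e * c e)"
          by (simp add: algebra_simps)
      qed
      then show "(\<Sum>e\<in>E. p e * (exp (\<sigma> * \<theta> * c e) - 1)) \<le> \<sigma> * \<theta> * m + \<theta>\<^sup>2 * m"
        by (simp add: m sum.distrib sum_distrib_left)
    qed auto
    also have "\<dots> = ennreal (exp (- \<theta> * t + \<theta>\<^sup>2 * m))"
      by (simp add: mult_exp_exp algebra_simps flip: ennreal_mult)
    finally show ?thesis .
  qed
  have "0 \<le> exp (- \<theta> * t + \<theta>\<^sup>2 * m)" by simp
  then show ?thesis
    using two_sided_chernoff[of "\<lambda>U. T U - m" ?P \<theta> "exp (- \<theta> * t + \<theta>\<^sup>2 * m)" t] \<theta>(1) mgf by (simp add: T_def)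
qed

lemma measurable_edge_sum:
  fixes c p :: "'e \<Rightarrow> real"
  shows "(\<lambda>U. \<Sum>e\<in>E. c e * (if U e < p e then 1 else 0)) \<in> borel_measurable (PiM E (\<lambda>_. unif01))"
  by measurable

definition score_weight :: "nat \<Rightarrow> nat \<Rightarrow> real \<Rightarrow> real" where
  "score_weight n d l = 2 * l\<^sup>2 / (real n * l + real n * real d)"

lemma mismatch_bounds:
  assumes "1 \<le> n"
  shows "0 \<le> mismatch n w y" "mismatch n w y \<le> 1"
proof -
  have "card {i. i < n \<and> w i \<noteq> y i} \<le> card {..<n}" by (intro card_mono) auto
  then show "mismatch n w y \<le> 1" using assms by (simp add: mismatch_def field_simps min_def)
qed (simp add: mismatch_def)

text \<open>The features are frozen: \<open>u\<close> and \<open>s\<close> are deterministic and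
  only the edges are random. One \<open>\<epsilon>\<close> bounds both the imbalance of the classes
  and the fraction of wrong initial labels, and \<open>1 \<le> \<epsilon> * n\<close> absorbs single
  vertices such as the one under study.\<close>

locale label_estimate =
  fixes n :: nat and a b q \<epsilon> :: real and y u :: "nat \<Rightarrow> real" and s :: real
  assumes n: "1 \<le> n" and ab: "0 < a" "0 < b" and q: "0 < q" "a * q / n \<le> 1" "b * q / n \<le> 1"
    and \<epsilon>: "0 < \<epsilon>" "\<epsilon> \<le> 1" "1 \<le> \<epsilon> * n"
    and y: "\<And>j. j < n \<Longrightarrow> y j = 1 \<or> y j = -1" and bal: "\<bar>\<Sum>j<n. y j\<bar> \<le> \<epsilon> * n"
    and s: "s = 1 \<or> s = -1" and wrong: "card {j. j < n \<and> sgn (u j) \<noteq> s * y j} \<le> \<epsilon> * n"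
begin

abbreviation "yh j \<equiv> sgn (u j)"
abbreviation "Wr \<equiv> {j. j < n \<and> yh j \<noteq> s * y j}"
abbreviation "PU \<equiv> edge_unif n"
abbreviation "pe \<equiv> edge_prob (a * q / n) (b * q / n) y"
abbreviation "adj U \<equiv> sbm_adj n (a * q / n) (b * q / n) y U"

lemma n_pos: "0 < real n" using n by simp

lemma yh_le: "\<bar>yh j\<bar> \<le> 1" by (simp add: sgn_real_def)

lemma pe: "0 \<le> pe e" "pe e \<le> 1" "pe e \<le> (a + b) * q / n"
  using ab q n_pos by (auto simp: edge_prob_def divide_right_mono mult_right_mono)

text \<open>The weights split the edges into those inside (\<open>\<sigma> = 1\<close>) and across
  (\<open>\<sigma> = -1\<close>) the estimated classes. A vanishing entry of \<open>u\<close> has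
  sign 0, and its edges count half on either side.\<close>

definition "cc \<sigma> = (\<lambda>e. (1 + \<sigma> * (yh (fst e) * yh (snd e))) / 2)" for \<sigma> :: real
definition "agree \<sigma> U = (\<Sum>e\<in>edges n. cc \<sigma> e * (if U e < pe e then 1 else 0))" for \<sigma> :: real
definition "agree_mean \<sigma> = (\<Sum>e\<in>edges n. pe e * cc \<sigma> e)" for \<sigma> :: real

lemma cc_bounds: "\<sigma> = 1 \<or> \<sigma> = -1 \<Longrightarrow> 0 \<le> cc \<sigma> e \<and> cc \<sigma> e \<le> 1"
proof -
  assume \<sigma>: "\<sigma> = 1 \<or> \<sigma> = -1"
  have "\<bar>yh (fst e) * yh (snd e)\<bar> \<le> 1 * 1"
    unfolding abs_mult by (intro mult_mono yh_le) auto
  then show ?thesis using \<sigma> by (auto simp: cc_def abs_le_iff)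
qed

text \<open>With the true labels about \<open>n\<^sup>2 / 4\<close> edges are possible inside the
  classes and as many across, which gives \<open>g * q * n / 4\<close> up to the squared imbalance
  and the diagonal. Passing to the estimated labels changes only pairs that contain a wrong vertex,
  at most \<open>n\<close> per wrong vertex. Each of the two comparisons costs one of the two
  units.\<close>

lemma agree_mean_close:
  assumes \<sigma>: "\<sigma> = 1 \<and> g = a \<or> \<sigma> = -1 \<and> g = b"
  shows "\<bar>agree_mean \<sigma> - g * q * n / 4\<bar> \<le> 2 * (a + b) * \<epsilon> * q * n"
proof -
  define S where "S = (\<Sum>j<n. y j)"
  define c0 where "c0 i j = (1 + \<sigma> * (y i * y j)) / 2" for i j
  have yy: "y j * y j = 1" if "j < n" for j using y[OF that] by auto
  have gq: "0 \<le> g * q / n" "g \<le> a + b" using ab q n_pos \<sigma> by auto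
  have "(\<Sum>i<n. \<Sum>j<n. c0 i j) = (\<Sum>i<n. (n + \<sigma> * (y i * S)) / 2)"
    by (intro sum.cong refl)
      (simp add: c0_def S_def sum.distrib add_divide_distrib sum_divide_distrib sum_distrib_left)
  also have "\<dots> = (real n * n + \<sigma> * S\<^sup>2) / 2"
    by (simp add: sum.distrib add_divide_distrib power2_eq_square S_def sum_divide_distrib sum_distrib_left sum_distrib_right mult_ac)
  finally have tot: "(\<Sum>i<n. \<Sum>j<n. c0 i j) = (real n * n + \<sigma> * S\<^sup>2) / 2" .
  have diag: "(\<Sum>i<n. c0 i i) = n * ((1 + \<sigma>) / 2)" by (simp add: c0_def yy)
  have c0sum: "(\<Sum>e\<in>edges n. c0 (fst e) (snd e)) = (real n * n + \<sigma> * S\<^sup>2) / 4 - n * ((1 + \<sigma>) / 4)"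
  proof -
    have "2 * (\<Sum>e\<in>edges n. c0 (fst e) (snd e)) + n * ((1 + \<sigma>) / 2) = (real n * n + \<sigma> * S\<^sup>2) / 2"
      unfolding tot[symmetric] diag[symmetric]
      by (rule sum_symmetric_edges[symmetric]) (simp add: c0_def mult.commute)
    then show ?thesis by (simp add: algebra_simps add_divide_distrib)
  qed
  have m0: "(\<Sum>e\<in>edges n. pe e * c0 (fst e) (snd e)) = g * q / n * (\<Sum>e\<in>edges n. c0 (fst e) (snd e))"
    unfolding sum_distrib_left
  proof (intro sum.cong refl)
    fix e assume e: "e \<in> edges n"
    then have "fst e < n" "snd e < n" by auto
    then have "y (fst e) = 1 \<or> y (fst e) = -1" "y (snd e) = 1 \<or> y (snd e) = -1" by (auto dest: y)
    then show "pe e * c0 (fst e) (snd e) = g * q / n * c0 (fst e) (snd e)"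
      using \<sigma> by (auto simp: edge_prob_def c0_def)
  qed
  have "\<bar>(\<Sum>e\<in>edges n. pe e * c0 (fst e) (snd e)) - g * q * n / 4\<bar> \<le> (a + b) * \<epsilon> * q * n"
  proof -
    have "(\<Sum>e\<in>edges n. pe e * c0 (fst e) (snd e)) - g * q * n / 4 = g * q / n * ((\<sigma> * S\<^sup>2 - n * (1 + \<sigma>)) / 4)"
      unfolding m0 c0sum using n_pos by (simp add: field_simps)
    moreover have "\<bar>(\<sigma> * S\<^sup>2 - n * (1 + \<sigma>)) / 4\<bar> \<le> \<epsilon> * n * n"
    proof -
      have "S\<^sup>2 \<le> (\<epsilon> * n)\<^sup>2" using bal power_mono[of "\<bar>S\<bar>" "\<epsilon> * n" 2] by (simp add: S_def)
      also have "\<dots> \<le> \<epsilon> * n * n"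
        using \<epsilon> mult_right_mono[of "\<epsilon> * \<epsilon>" \<epsilon> "real n * n"] by (simp add: power2_eq_square mult_ac mult_left_le_one_le)
      finally have "S\<^sup>2 \<le> \<epsilon> * n * n" .
      moreover have "real n \<le> \<epsilon> * n * n" using mult_right_mono[OF \<epsilon>(3), of n] by simp
      moreover define X where "X = S\<^sup>2"
      moreover have "0 \<le> X" by (simp add: X_def)
      ultimately show ?thesis using \<sigma> unfolding X_def[symmetric]
        by (elim disjE conjE) (simp_all add: abs_le_iff)
    qed
    ultimately have "\<bar>(\<Sum>e\<in>edges n. pe e * c0 (fst e) (snd e)) - g * q * n / 4\<bar> \<le> g * q / n * (\<epsilon> * n * n)"
      using gq by (simp only: abs_mult abs_of_nonneg mult_left_mono)
    also have "\<dots> = g * (\<epsilon> * q * n)" using n_pos by simp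
    also have "\<dots> \<le> (a + b) * (\<epsilon> * q * n)" using gq(2) \<epsilon> q by (intro mult_right_mono) auto
    finally show ?thesis by (simp add: mult.assoc)
  qed
  moreover have "\<bar>agree_mean \<sigma> - (\<Sum>e\<in>edges n. pe e * c0 (fst e) (snd e))\<bar> \<le> (a + b) * \<epsilon> * q * n"
  proof -
    define w where "w i j = (if i \<in> Wr then 1 else 0) + (if j \<in> Wr then 1 else 0 :: real)" for i j
    have "\<bar>agree_mean \<sigma> - (\<Sum>e\<in>edges n. pe e * c0 (fst e) (snd e))\<bar>
        \<le> (\<Sum>e\<in>edges n. \<bar>pe e * (cc \<sigma> e - c0 (fst e) (snd e))\<bar>)"
      unfolding agree_mean_def sum_subtractf[symmetric] right_diff_distrib by (rule sum_abs)
    also have "\<dots> \<le> (\<Sum>e\<in>edges n. (a + b) * q / n * w (fst e) (snd e))"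
    proof (rule sum_mono)
      fix e assume e: "e \<in> edges n"
      have "\<bar>cc \<sigma> e - c0 (fst e) (snd e)\<bar> \<le> w (fst e) (snd e)"
      proof (cases "fst e \<in> Wr \<or> snd e \<in> Wr")
        case True
        have "fst e < n" "snd e < n" using e by auto
        then have "y (fst e) = 1 \<or> y (fst e) = -1" "y (snd e) = 1 \<or> y (snd e) = -1" by (auto dest: y)
        then have "0 \<le> c0 (fst e) (snd e) \<and> c0 (fst e) (snd e) \<le> 1" using \<sigma> by (auto simp: c0_def)
        moreover have "0 \<le> cc \<sigma> e \<and> cc \<sigma> e \<le> 1" using cc_bounds \<sigma> by blast
        moreover have "1 \<le> w (fst e) (snd e)" using True by (auto simp: w_def)
        ultimately show ?thesis by linarith
      next
        case False
        then have "yh (fst e) = s * y (fst e)" "yh (snd e) = s * y (snd e)" using e by auto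
        then have "cc \<sigma> e = c0 (fst e) (snd e)" using s by (auto simp: cc_def c0_def)
        then show ?thesis by (simp add: w_def)
      qed
      then show "\<bar>pe e * (cc \<sigma> e - c0 (fst e) (snd e))\<bar> \<le> (a + b) * q / n * w (fst e) (snd e)"
        unfolding abs_mult using pe[of e] ab q by (intro mult_mono) auto
    qed
    also have "\<dots> = (a + b) * q / n * (\<Sum>e\<in>edges n. w (fst e) (snd e))" by (simp add: sum_distrib_left)
    also have "\<dots> \<le> (a + b) * q / n * (n * (\<epsilon> * n))"
    proof (rule mult_left_mono)
      have cardW: "(\<Sum>j<n. if j \<in> Wr then 1 else 0) = real (card Wr)"
        by (subst sum.If_cases) (auto intro!: arg_cong[of _ _ card])
      have "(\<Sum>i<n. \<Sum>j<n. w i j) = 2 * n * card Wr"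
      proof -
        have "(\<Sum>j<n. w i j) = real n * (if i \<in> Wr then 1 else 0) + real (card Wr)" for i
          unfolding w_def sum.distrib cardW by simp
        then have "(\<Sum>i<n. \<Sum>j<n. w i j) = (\<Sum>i<n. real n * (if i \<in> Wr then 1 else 0) + real (card Wr))"
          by presburger
        also have "\<dots> = real n * (\<Sum>i<n. if i \<in> Wr then 1 else 0) + n * card Wr"
          unfolding sum.distrib sum_distrib_left by simp
        finally have "(\<Sum>i<n. \<Sum>j<n. w i j) = real n * (\<Sum>i<n. if i \<in> Wr then 1 else 0) + n * card Wr" .
        then show ?thesis unfolding cardW by simp
      qed
      moreover have "0 \<le> (\<Sum>i<n. w i i)" by (intro sum_nonneg) (auto simp: w_def)
      moreover have "(\<Sum>i<n. \<Sum>j<n. w i j) = 2 * (\<Sum>e\<in>edges n. w (fst e) (snd e)) + (\<Sum>i<n. w i i)"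
        by (rule sum_symmetric_edges) (simp add: w_def)
      ultimately have "(\<Sum>e\<in>edges n. w (fst e) (snd e)) \<le> n * card Wr" by simp
      also have "\<dots> \<le> n * (\<epsilon> * n)" using wrong by (simp add: mult_left_mono)
      finally show "(\<Sum>e\<in>edges n. w (fst e) (snd e)) \<le> n * (\<epsilon> * n)" .
    qed (use ab q in auto)
    also have "\<dots> = (a + b) * \<epsilon> * q * n" using n_pos by simp
    finally show ?thesis .
  qed
  ultimately show ?thesis by linarith
qed

lemma agree_mean_le:
  assumes \<sigma>: "\<sigma> = 1 \<or> \<sigma> = -1"
  shows "agree_mean \<sigma> \<le> (a + b) * q * n"
proof -
  have "agree_mean \<sigma> \<le> (\<Sum>e\<in>edges n. (a + b) * q / n * 1)"
    unfolding agree_mean_def using cc_bounds[OF \<sigma>] pe ab q by (intro sum_mono mult_mono) auto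
  also have "\<dots> = (a + b) * q / n * card (edges n)" by simp
  also have "\<dots> \<le> (a + b) * q / n * (real n * n)"
  proof (rule mult_left_mono)
    have "card (edges n) \<le> card ({..<n} \<times> {..<n})" by (intro card_mono) auto
    then show "real (card (edges n)) \<le> real n * n" by (simp flip: of_nat_mult)
  qed (use ab q in auto)
  finally show ?thesis using n_pos by simp
qed

text \<open>The double sums run over ordered pairs and so count each edge twice; the weights
  \<open>cc\<close> contain a factor one half. Together this makes 4, which cancels in the
  ratio.\<close>

lemma log_ratio_eq:
  "(\<Sum>k<n. \<Sum>m<n. adj U k m) + (\<Sum>k<n. \<Sum>m<n. yh k * adj U k m * yh m) = 4 * agree 1 U"
  "(\<Sum>k<n. \<Sum>m<n. adj U k m) - (\<Sum>k<n. \<Sum>m<n. yh k * adj U k m * yh m) = 4 * agree (-1) U"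
proof -
  have 1: "(\<Sum>k<n. \<Sum>m<n. adj U k m) = 2 * (\<Sum>e\<in>edges n. adj U (fst e) (snd e))"
    using sum_symmetric_edges[of "adj U" n] sbm_adj_sym by (simp add: sbm_adj_def)
  have 2: "(\<Sum>k<n. \<Sum>m<n. yh k * adj U k m * yh m) = 2 * (\<Sum>e\<in>edges n. yh (fst e) * adj U (fst e) (snd e) * yh (snd e))"
    using sum_symmetric_edges[of "\<lambda>k m. yh k * adj U k m * yh m" n] sbm_adj_sym
    by (simp add: sbm_adj_def mult_ac)
  have 3: "4 * agree \<sigma> U = 2 * (\<Sum>e\<in>edges n. adj U (fst e) (snd e)) + \<sigma> * (2 * (\<Sum>e\<in>edges n. yh (fst e) * adj U (fst e) (snd e) * yh (snd e)))" for \<sigma>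
    unfolding agree_def sum_distrib_left sum.distrib[symmetric]
  proof (intro sum.cong refl)
    fix e assume e: "e \<in> edges n"
    show "4 * (cc \<sigma> e * (if U e < pe e then 1 else 0))
      = 2 * adj U (fst e) (snd e) + \<sigma> * (2 * (yh (fst e) * adj U (fst e) (snd e) * yh (snd e)))"
      unfolding sbm_adj_edge[OF e] by (simp add: cc_def algebra_simps)
  qed
  show "(\<Sum>k<n. \<Sum>m<n. adj U k m) + (\<Sum>k<n. \<Sum>m<n. yh k * adj U k m * yh m) = 4 * agree 1 U"
    "(\<Sum>k<n. \<Sum>m<n. adj U k m) - (\<Sum>k<n. \<Sum>m<n. yh k * adj U k m * yh m) = 4 * agree (-1) U"
    unfolding 1 2 3 by simp_all
qed

text \<open>For a correctly labelled neighbour the tilt sends both \<open>a\<close> and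
  \<open>b\<close> to \<open>sqrt (a * b)\<close>, up to the correction by \<open>\<delta>\<close>.
  Averaged over the two classes this leaves \<open>sqrt (a * b) - (a + b) / 2\<close>, that is
  \<open>- (sqrt a - sqrt b)\<^sup>2 / 2\<close>. Imbalance, wrong neighbours and the missing index
  \<open>m = i\<close> are of order \<open>\<epsilon>\<close>.\<close>

lemma row_exponent:
  fixes \<delta> :: real
  assumes i: "i < n" and \<delta>: "0 \<le> \<delta>"
  defines "K \<equiv> exp (\<bar>ln (a / b)\<bar> / 2 + \<delta> / 2)"
    and "\<theta> \<equiv> \<lambda>m. - (ln (a / b) / 2) * (s * y i * yh m) + \<delta> / 2"
  shows "(\<Sum>m<n. if m = i then 0 else pe (i, m) * (exp (\<theta> m) - 1))
     \<le> q * (sqrt (a * b) * exp (\<delta> / 2) - (a + b) / 2 + \<epsilon> * (5 * ((a + b) * (K + 1))))"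
proof -
  define D where "D = sqrt (a * b) * exp (\<delta> / 2)"
  define B where "B = (a + b) * (K + 1)"
  \<comment> \<open>One formula for both classes: \<open>y i * y m\<close> selects
    \<open>- a\<close> or \<open>- b\<close>, and the sum of these signs over \<open>m\<close> is
    controlled by the imbalance.\<close>
  define G where "G m = q / n * (D - (a + b) / 2 + y i * y m * ((b - a) / 2))" for m
  have K: "0 < K" by (simp add: K_def)
  have qn: "0 < q / n" using q n_pos by simp
  have B: "a + b \<le> B" using ab K by (simp add: B_def algebra_simps)
  have sq: "exp (ln x / 2) = sqrt x" if "0 < x" for x :: real
    using that by (simp flip: ln_sqrt)
  have ea: "a * exp (- (ln (a / b) / 2)) = sqrt (a * b)" "b * exp (ln (a / b) / 2) = sqrt (a * b)"
  proof -
    have "exp (- (ln (a / b) / 2)) = sqrt b / sqrt a" "exp (ln (a / b) / 2) = sqrt a / sqrt b"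
      using ab sq[of a] sq[of b] by (simp_all add: ln_div diff_divide_distrib exp_diff)
    moreover have "a * (sqrt b / sqrt a) = a / sqrt a * sqrt b" "b * (sqrt a / sqrt b) = b / sqrt b * sqrt a"
      by simp_all
    ultimately show "a * exp (- (ln (a / b) / 2)) = sqrt (a * b)" "b * exp (ln (a / b) / 2) = sqrt (a * b)"
      using ab by (simp_all add: real_div_sqrt real_sqrt_mult)
  qed
  have D: "0 \<le> D" "D \<le> a * K"
  proof -
    show "0 \<le> D" using ab by (simp add: D_def)
    have "D = a * exp (- (ln (a / b) / 2) + \<delta> / 2)" unfolding D_def ea(1)[symmetric] exp_add by simp
    also have "\<dots> \<le> a * K" unfolding K_def using ab by (intro mult_left_mono) auto
    finally show "D \<le> a * K" .
  qed
  have G_abs: "\<bar>G m\<bar> \<le> q / n * B" if "m < n" for m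
  proof -
    define w where "w = y i * y m * ((b - a) / 2)"
    define h where "h = (a + b) / 2"
    have h: "2 * h = a + b" by (simp add: h_def)
    have "\<bar>w\<bar> \<le> h" unfolding h_def using y[OF i] y[OF that] ab by (auto simp: w_def)
    moreover have "D \<le> B - (a + b)" using D(2) mult_pos_pos[OF K ab(2)] by (simp add: B_def algebra_simps)
    ultimately have "\<bar>D - h + w\<bar> \<le> B" using D(1) ab B h by linarith
    then have "\<bar>D - (a + b) / 2 + y i * y m * ((b - a) / 2)\<bar> \<le> B" by (simp add: w_def h_def)
    then show ?thesis unfolding G_def abs_mult using qn by (intro mult_mono) auto
  qed
  have good: "pe (i, m) * (exp (\<theta> m) - 1) = G m" if m: "m < n" "m \<notin> Wr" for m
  proof -
    have "yh m = s * y m" using m by simp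
    then have syy: "s * y i * yh m = y i * y m" using s by auto
    show ?thesis
    proof (cases "y i = y m")
      case True
      then have "y i * y m = 1" using y[OF i] by auto
      then have "pe (i, m) * (exp (\<theta> m) - 1) = q / n * (a * exp (- (ln (a / b) / 2)) * exp (\<delta> / 2) - a)"
      proof -
        have "\<theta> m = - (ln (a / b) / 2) + \<delta> / 2" unfolding \<theta>_def syy \<open>y i * y m = 1\<close> by simp
        then have "exp (\<theta> m) = exp (- (ln (a / b) / 2)) * exp (\<delta> / 2)" by (simp only: exp_add)
        then show ?thesis using True by (simp add: edge_prob_def right_diff_distrib mult_ac)
      qed
      then show ?thesis unfolding ea using \<open>y i * y m = 1\<close> by (simp add: G_def D_def algebra_simps add_divide_distrib diff_divide_distrib)
    next
      case False
      then have "y i * y m = -1" using y[OF i] y[OF m(1)] by auto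
      then have "pe (i, m) * (exp (\<theta> m) - 1) = q / n * (b * exp (ln (a / b) / 2) * exp (\<delta> / 2) - b)"
      proof -
        have "\<theta> m = ln (a / b) / 2 + \<delta> / 2" unfolding \<theta>_def syy \<open>y i * y m = -1\<close> by simp
        then have "exp (\<theta> m) = exp (ln (a / b) / 2) * exp (\<delta> / 2)" by (simp only: exp_add)
        then show ?thesis using False by (simp add: edge_prob_def right_diff_distrib mult_ac)
      qed
      then show ?thesis unfolding ea using \<open>y i * y m = -1\<close> by (simp add: G_def D_def algebra_simps add_divide_distrib diff_divide_distrib)
    qed
  qed
  have any: "pe (i, m) * (exp (\<theta> m) - 1) \<le> q / n * B" if m: "m < n" for m
  proof -
    have "\<bar>s * y i * yh m\<bar> \<le> 1" using s y[OF i] yh_le[of m] by (auto simp: abs_mult)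
    then have "\<bar>ln (a / b) / 2 * (s * y i * yh m)\<bar> \<le> \<bar>ln (a / b)\<bar> / 2 * 1"
      unfolding abs_mult[of "ln (a / b) / 2"] by (intro mult_mono) auto
    then have "\<theta> m \<le> \<bar>ln (a / b)\<bar> / 2 + \<delta> / 2" by (simp add: \<theta>_def abs_le_iff)
    then have "exp (\<theta> m) - 1 \<le> K + 1" unfolding K_def by (smt (verit) exp_le_cancel_iff)
    then have "pe (i, m) * (exp (\<theta> m) - 1) \<le> pe (i, m) * (K + 1)"
      using pe(1) by (intro mult_left_mono) auto
    also have "\<dots> \<le> (a + b) * q / n * (K + 1)" using pe(3) K by (intro mult_right_mono) auto
    finally show ?thesis by (simp add: B_def mult_ac)
  qed
  \<comment> \<open>At a wrong vertex and at \<open>i\<close> the true term exceeds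
    \<open>G m\<close> by at most \<open>q / n * (2 * B)\<close>. There are at most
    \<open>2 * \<epsilon> * n\<close> such indices, which makes 4 of the 5 units of
    \<open>\<epsilon> * B\<close>; the imbalance is the fifth.\<close>
  have "(\<Sum>m<n. if m = i then 0 else pe (i, m) * (exp (\<theta> m) - 1))
      \<le> (\<Sum>m<n. G m + q / n * (2 * B) * ((if m \<in> Wr then 1 else 0) + (if m = i then 1 else 0)))"
  proof (rule sum_mono)
    fix m assume "m \<in> {..<n}"
    then have m: "m < n" by simp
    define x where "x = q / n * B"
    have x2: "q / n * (2 * B) = 2 * x" by (simp add: x_def)
    have x: "0 \<le> x" "pe (i, m) * (exp (\<theta> m) - 1) \<le> x" "- x \<le> G m"
      using G_abs[OF m, folded x_def] any[OF m, folded x_def] by linarith+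
    show "(if m = i then 0 else pe (i, m) * (exp (\<theta> m) - 1))
        \<le> G m + q / n * (2 * B) * ((if m \<in> Wr then 1 else 0) + (if m = i then 1 else 0))"
      unfolding x2 using x good[OF m] by (cases "m = i"; cases "m \<in> Wr") simp_all
  qed
  also have "\<dots> = (\<Sum>m<n. G m) + q / n * (2 * B) * (card Wr + 1)"
  proof -
    have "(\<Sum>j<n. if j \<in> Wr then 1 else 0) = real (card Wr)"
      by (subst sum.If_cases) (auto intro!: arg_cong[of _ _ card])
    then show ?thesis using i unfolding sum.distrib sum_distrib_left[symmetric] by simp
  qed
  also have "(\<Sum>m<n. G m) = q * (D - (a + b) / 2) + q / n * (y i * (\<Sum>j<n. y j) * ((b - a) / 2))"
  proof -
    have "(\<Sum>m<n. G m) = (\<Sum>m<n. q / n * (D - (a + b) / 2) + q / n * (y i * ((b - a) / 2)) * y m)"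
      by (intro sum.cong refl) (simp add: G_def algebra_simps)
    also have "\<dots> = n * (q / n * (D - (a + b) / 2)) + q / n * (y i * ((b - a) / 2)) * (\<Sum>j<n. y j)"
      by (simp add: sum.distrib sum_distrib_left)
    finally show ?thesis using n_pos by simp
  qed
  also have "q / n * (y i * (\<Sum>j<n. y j) * ((b - a) / 2)) \<le> q / n * (\<epsilon> * n * (a + b))"
  proof (rule mult_left_mono)
    have "\<bar>y i * (\<Sum>j<n. y j) * ((b - a) / 2)\<bar> \<le> 1 * (\<epsilon> * n) * (a + b)"
      unfolding abs_mult using bal y[OF i] ab \<epsilon> by (intro mult_mono) auto
    then show "y i * (\<Sum>j<n. y j) * ((b - a) / 2) \<le> \<epsilon> * n * (a + b)" by simp
  qed (use qn in simp)
  also have "q / n * (\<epsilon> * n * (a + b)) \<le> q / n * (\<epsilon> * n * B)"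
    using qn B \<epsilon> by (intro mult_left_mono) auto
  also have "q / n * (2 * B) * (card Wr + 1) \<le> q / n * (2 * B) * (\<epsilon> * n + \<epsilon> * n)"
  proof (rule mult_left_mono)
    show "0 \<le> q / n * (2 * B)" using qn B ab by (intro mult_nonneg_nonneg) linarith+
  qed (use wrong \<epsilon> in auto)
  also have "q * (D - (a + b) / 2) + q / n * (\<epsilon> * n * B) + q / n * (2 * B) * (\<epsilon> * n + \<epsilon> * n)
      = q * (D - (a + b) / 2 + \<epsilon> * (5 * B))"
    using n_pos by (simp add: algebra_simps)
  finally show ?thesis by (simp add: D_def B_def)
qed

lemma u_tilde_eq:
  "u_tilde n d (adj U) l u i = 1 / sqrt n * ln (agree 1 U / agree (-1) U) * (\<Sum>m<n. adj U i m * yh m)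
     + score_weight n d l * u i"
  unfolding u_tilde_def Let_def log_ratio_eq score_weight_def by simp

text \<open>The minimum in \<open>mismatch\<close> is over both global signs, so it may be estimated
  with the sign \<open>s\<close> that aligns \<open>u\<close>. A score equal to zero is counted as
  an error.\<close>

lemma mismatch_le_sum: "mismatch n (\<lambda>i. sgn (v i)) y \<le> (1 / n) * (\<Sum>i<n. if s * y i * v i \<le> 0 then 1 else 0)"
proof -
  have "{i. i < n \<and> sgn (v i) \<noteq> s * y i} \<subseteq> {i. i < n \<and> s * y i * v i \<le> 0}"
  proof clarsimp
    fix i assume i: "i < n" "sgn (v i) \<noteq> s * y i"
    show "s * y i * v i \<le> 0"
      using s y[OF i(1)] i(2) by (auto simp: sgn_real_def split: if_splits)
  qed
  then have "card {i. i < n \<and> sgn (v i) \<noteq> s * y i} \<le> card {i. i < n \<and> s * y i * v i \<le> 0}"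
    by (intro card_mono) auto
  also have "real (card {i. i < n \<and> s * y i * v i \<le> 0}) = (\<Sum>i<n. if s * y i * v i \<le> 0 then 1 else 0)"
    by (subst sum.If_cases) (auto intro!: arg_cong[of _ _ card])
  finally have "real (card {i. i < n \<and> sgn (v i) \<noteq> s * y i}) \<le> (\<Sum>i<n. if s * y i * v i \<le> 0 then 1 else 0)"
    by simp
  moreover
  have "min (card {i. i < n \<and> sgn (v i) \<noteq> y i}) (card {i. i < n \<and> sgn (v i) \<noteq> - y i})
      \<le> card {i. i < n \<and> sgn (v i) \<noteq> s * y i}"
    using s by auto
  then have "real (min (card {i. i < n \<and> sgn (v i) \<noteq> y i}) (card {i. i < n \<and> sgn (v i) \<noteq> - y i}))
      \<le> real (card {i. i < n \<and> sgn (v i) \<noteq> s * y i})"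
    by (rule of_nat_mono)
  ultimately have "real (min (card {i. i < n \<and> sgn (v i) \<noteq> y i}) (card {i. i < n \<and> sgn (v i) \<noteq> - y i}))
      \<le> (\<Sum>i<n. if s * y i * v i \<le> 0 then 1 else 0)"
    by (rule order_trans[rotated])
  then show ?thesis unfolding mismatch_def by (rule mult_left_mono) simp
qed

text \<open>An error at \<open>i\<close> means that the signed score is nonpositive, so its
  indicator is at most the exponential of minus half the score. The feature part of that exponential
  is a constant here and factors out; the graph part is integrated by \<open>row_mgf\<close>. The
  first summand pays for the event that the logarithm is off.\<close>

lemma conditional_error:
  fixes \<delta> \<theta> l :: real and d :: nat
  assumes \<delta>: "0 \<le> \<delta>" and \<theta>: "0 < \<theta>" "\<theta> \<le> 1"
    and cont: "\<And>x z. \<bar>x - a / 4\<bar> \<le> 4 * (a + b) * \<epsilon> \<Longrightarrow> \<bar>z - b / 4\<bar> \<le> 4 * (a + b) * \<epsilon> \<Longrightarrow> \<bar>ln (x / z) - ln (a / b)\<bar> \<le> \<delta>"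
  defines "K \<equiv> exp (\<bar>ln (a / b)\<bar> / 2 + \<delta> / 2)"
  shows "(\<integral>\<^sup>+U. ennreal (mismatch n (\<lambda>i. sgn (u_tilde n d (adj U) l u i)) y) \<partial>PU)
     \<le> ennreal (4 * exp (- \<theta> * (2 * (a + b) * \<epsilon> * q * n) + \<theta>\<^sup>2 * ((a + b) * q * n))
        + (1 / n) * (\<Sum>i<n. exp (- (1/2) * score_weight n d l * (s * sqrt n * y i * u i)))
          * exp (q * (sqrt (a * b) * exp (\<delta> / 2) - (a + b) / 2 + \<epsilon> * (5 * ((a + b) * (K + 1))))))"
proof -
  \<comment> \<open>The permitted fluctuation equals the deterministic error of
    \<open>agree_mean_close\<close>; their sum \<open>2 * \<kappa>\<close>, divided by
    \<open>q * n\<close>, is the radius \<open>4 * (a + b) * \<epsilon>\<close> in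
    \<open>cont\<close>.\<close>
  define \<kappa> where "\<kappa> = 2 * (a + b) * \<epsilon> * q * n"
  define Bad where "Bad \<sigma> = {U \<in> space PU. \<kappa> < \<bar>agree \<sigma> U - agree_mean \<sigma>\<bar>}" for \<sigma>
  define ex where "ex = exp (q * (sqrt (a * b) * exp (\<delta> / 2) - (a + b) / 2 + \<epsilon> * (5 * ((a + b) * (K + 1)))))"
  define V where "V i = exp (- (1/2) * score_weight n d l * (s * sqrt n * y i * u i))" for i
  define th where "th i m = - (ln (a / b) / 2) * (s * y i * yh m) + \<delta> / 2" for i m
  have qn: "0 < q * n" using q n_pos by simp
  have adj_meas [measurable]: "(\<lambda>U. adj U i j) \<in> borel_measurable PU" for i j
  proof (cases "i < n \<and> j < n \<and> i \<noteq> j")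
    case True
    then have "(min i j, max i j) \<in> edges n" by (auto simp: min_def max_def)
    then have [measurable]: "(\<lambda>U. U (min i j, max i j)) \<in> borel_measurable PU"
      using measurable_component_singleton[of "(min i j, max i j)" "edges n" "\<lambda>_. unif01"] by simp
    show ?thesis unfolding sbm_adj_def by measurable
  next
    case False
    then have "adj U i j = 0" for U by (auto simp: sbm_adj_def)
    then show ?thesis by simp
  qed
  have [measurable]: "agree \<sigma> \<in> borel_measurable PU" for \<sigma>
    unfolding agree_def by (rule measurable_edge_sum)
  have BadP: "emeasure PU (Bad \<sigma>) \<le> ennreal (2 * exp (- \<theta> * \<kappa> + \<theta>\<^sup>2 * ((a + b) * q * n)))" if \<sigma>: "\<sigma> = 1 \<or> \<sigma> = -1" for \<sigma>
  proof -
    have "emeasure PU (Bad \<sigma>) \<le> ennreal (2 * exp (- \<theta> * \<kappa> + \<theta>\<^sup>2 * agree_mean \<sigma>))"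
      unfolding Bad_def agree_def using cc_bounds[OF \<sigma>] pe \<theta>
      by (intro edge_tail) (simp_all add: agree_mean_def)
    also have "\<dots> \<le> ennreal (2 * exp (- \<theta> * \<kappa> + \<theta>\<^sup>2 * ((a + b) * q * n)))"
      using agree_mean_le[OF \<sigma>] by (intro ennreal_leI mult_left_mono) (simp_all add: mult_left_mono)
    finally show ?thesis .
  qed
  have pointwise: "ennreal (mismatch n (\<lambda>i. sgn (u_tilde n d (adj U) l u i)) y)
     \<le> (indicator (Bad 1) U + indicator (Bad (-1)) U)
       + (\<Sum>i<n. ennreal (1 / n * V i) * ennreal (exp (\<Sum>m<n. th i m * adj U i m)))" if U: "U \<in> space PU" for U
  proof (cases "U \<in> Bad 1 \<or> U \<in> Bad (-1)")
    case True
    have "ennreal (mismatch n (\<lambda>i. sgn (u_tilde n d (adj U) l u i)) y) \<le> 1"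
      using mismatch_bounds(2)[OF n] by (simp add: ennreal_le_1)
    also have "\<dots> \<le> indicator (Bad 1) U + indicator (Bad (-1)) U" using True by (auto simp: indicator_def)
    finally show ?thesis by (rule order_trans) simp
  next
    case False
    define L where "L = ln (agree 1 U / agree (-1) U)"
    have close: "\<bar>agree \<sigma> U / (q * n) - g / 4\<bar> \<le> 4 * (a + b) * \<epsilon>" if \<sigma>: "\<sigma> = 1 \<and> g = a \<or> \<sigma> = -1 \<and> g = b" for \<sigma> g
    proof -
      have "\<bar>agree \<sigma> U - agree_mean \<sigma>\<bar> \<le> \<kappa>" using False U \<sigma> by (auto simp: Bad_def)
      then have "\<bar>agree \<sigma> U - g * q * n / 4\<bar> \<le> 2 * \<kappa>"
        using agree_mean_close[OF \<sigma>] by (simp add: \<kappa>_def)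
      then have "\<bar>agree \<sigma> U - g * q * n / 4\<bar> / (q * n) \<le> 2 * \<kappa> / (q * n)"
        using qn by (intro divide_right_mono) auto
      moreover have "\<bar>agree \<sigma> U - g * q * n / 4\<bar> / (q * n) = \<bar>agree \<sigma> U / (q * n) - g / 4\<bar>"
      proof -
        have "agree \<sigma> U / (q * n) - g / 4 = (agree \<sigma> U - g * q * n / 4) / (q * n)"
          using q n_pos by (simp add: diff_divide_distrib)
        then show ?thesis using qn by (simp add: abs_divide)
      qed
      moreover have "2 * \<kappa> / (q * n) = 4 * (a + b) * \<epsilon>" using q n_pos by (simp add: \<kappa>_def)
      ultimately show ?thesis by simp
    qed
    have L: "\<bar>L - ln (a / b)\<bar> \<le> \<delta>"
      using cont[OF close[of 1 a] close[of "-1" b]] qn q n_pos by (simp add: L_def)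
    have "(if s * y i * u_tilde n d (adj U) l u i \<le> 0 then 1 else 0) \<le> V i * exp (\<Sum>m<n. th i m * adj U i m)" if i: "i < n" for i
    proof (cases "s * y i * u_tilde n d (adj U) l u i \<le> 0")
      case True
      define X where "X = (\<Sum>m<n. adj U i m * (s * y i * yh m))"
      define deg where "deg = (\<Sum>m<n. adj U i m)"
      have adj_nn: "0 \<le> adj U i m" for m by (simp add: sbm_adj_def)
      have "\<bar>X\<bar> \<le> (\<Sum>m<n. \<bar>adj U i m * (s * y i * yh m)\<bar>)" unfolding X_def by (rule sum_abs)
      also have "\<dots> \<le> (\<Sum>m<n. adj U i m * 1)"
      proof (rule sum_mono)
        fix m
        have "\<bar>s * y i * yh m\<bar> \<le> 1" using s y[OF i] yh_le[of m] by (auto simp: abs_mult)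
        then show "\<bar>adj U i m * (s * y i * yh m)\<bar> \<le> adj U i m * 1"
          unfolding abs_mult[of "adj U i m"] using adj_nn by (intro mult_mono) auto
      qed
      finally have X: "\<bar>X\<bar> \<le> deg" by (simp add: deg_def)
      have "sqrt n * (s * y i * u_tilde n d (adj U) l u i) = L * X + score_weight n d l * (s * sqrt n * y i * u i)"
        unfolding u_tilde_eq L_def X_def using n_pos
        by (simp add: sum_distrib_left algebra_simps)
      then have le0: "L * X + score_weight n d l * (s * sqrt n * y i * u i) \<le> 0"
        using mult_left_mono[OF True, of "sqrt n"] by simp
      \<comment> \<open>The random logarithm \<open>L\<close>, which is not independent of row
        \<open>i\<close>, is exchanged for its limit. As \<open>X\<close> is bounded by the degree,
        the price is \<open>\<delta>\<close> per edge at \<open>i\<close>; half of it is the summand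
        \<open>\<delta> / 2\<close> in \<open>th\<close>.\<close>
      have "\<bar>(L - ln (a / b)) * X\<bar> \<le> \<delta> * deg"
        unfolding abs_mult using L X \<delta> by (intro mult_mono) auto
      then have "ln (a / b) * X - \<delta> * deg \<le> L * X" by (simp add: algebra_simps abs_le_iff)
      moreover have "(\<Sum>m<n. th i m * adj U i m) = - (1/2) * (ln (a / b) * X) + 1/2 * (\<delta> * deg)"
        unfolding th_def X_def deg_def sum_distrib_left sum.distrib[symmetric]
        by (intro sum.cong refl) (simp add: algebra_simps)
      ultimately have "0 \<le> - (1/2) * score_weight n d l * (s * sqrt n * y i * u i) + (\<Sum>m<n. th i m * adj U i m)"
        using le0 by simp
      then have "1 \<le> V i * exp (\<Sum>m<n. th i m * adj U i m)"
        unfolding V_def mult_exp_exp by simp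
      then show ?thesis using True by simp
    qed (simp add: V_def)
    then have "(1 / n) * (\<Sum>i<n. if s * y i * u_tilde n d (adj U) l u i \<le> 0 then 1 else 0)
        \<le> (1 / n) * (\<Sum>i<n. V i * exp (\<Sum>m<n. th i m * adj U i m))"
      by (intro mult_left_mono sum_mono) auto
    then have "mismatch n (\<lambda>i. sgn (u_tilde n d (adj U) l u i)) y \<le> (\<Sum>i<n. 1 / n * V i * exp (\<Sum>m<n. th i m * adj U i m))"
      using mismatch_le_sum[of "u_tilde n d (adj U) l u"] by (simp add: sum_distrib_left mult.assoc)
    then have "ennreal (mismatch n (\<lambda>i. sgn (u_tilde n d (adj U) l u i)) y)
      \<le> (\<Sum>i<n. ennreal (1 / n * V i) * ennreal (exp (\<Sum>m<n. th i m * adj U i m)))"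
      by (subst ennreal_mult[symmetric], simp add: V_def, simp, subst sum_ennreal, simp add: V_def, rule ennreal_leI)
    then show ?thesis by (rule order_trans) simp
  qed
  have "(\<integral>\<^sup>+U. ennreal (mismatch n (\<lambda>i. sgn (u_tilde n d (adj U) l u i)) y) \<partial>PU)
    \<le> (\<integral>\<^sup>+U. (indicator (Bad 1) U + indicator (Bad (-1)) U)
       + (\<Sum>i<n. ennreal (1 / n * V i) * ennreal (exp (\<Sum>m<n. th i m * adj U i m))) \<partial>PU)"
    by (intro nn_integral_mono pointwise)
  also have "\<dots> = (emeasure PU (Bad 1) + emeasure PU (Bad (-1)))
      + (\<Sum>i<n. ennreal (1 / n * V i) * (\<integral>\<^sup>+U. ennreal (exp (\<Sum>m<n. th i m * adj U i m)) \<partial>PU))"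
  proof -
    have [measurable]: "Bad \<sigma> \<in> sets PU" for \<sigma> unfolding Bad_def by measurable
    show ?thesis by (simp add: nn_integral_add nn_integral_sum nn_integral_cmult)
  qed
  also have "\<dots> \<le> (ennreal (2 * exp (- \<theta> * \<kappa> + \<theta>\<^sup>2 * ((a + b) * q * n))) + ennreal (2 * exp (- \<theta> * \<kappa> + \<theta>\<^sup>2 * ((a + b) * q * n))))
      + (\<Sum>i<n. ennreal (1 / n * V i) * ennreal ex)"
  proof (intro add_mono BadP sum_mono mult_left_mono)
    fix i assume "i \<in> {..<n}"
    then have i: "i < n" by simp
    have "(\<integral>\<^sup>+U. ennreal (exp (\<Sum>m<n. th i m * adj U i m)) \<partial>PU)
       \<le> ennreal (exp (\<Sum>m<n. if m = i then 0 else pe (i, m) * (exp (th i m) - 1)))"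
      using q ab n_pos by (intro row_mgf i) auto
    also have "\<dots> \<le> ennreal ex"
      using row_exponent[OF i \<delta>] unfolding ex_def th_def K_def by (intro ennreal_leI) simp
    finally show "(\<integral>\<^sup>+U. ennreal (exp (\<Sum>m<n. th i m * adj U i m)) \<partial>PU) \<le> ennreal ex" .
  qed auto
  also have "\<dots> = ennreal (4 * exp (- \<theta> * \<kappa> + \<theta>\<^sup>2 * ((a + b) * q * n)) + (1 / n) * (\<Sum>i<n. V i) * ex)"
  proof -
    have "(\<Sum>i<n. ennreal (1 / n * V i) * ennreal ex) = ennreal (\<Sum>i<n. 1 / n * V i * ex)"
      by (subst ennreal_mult[symmetric]) (auto simp: V_def ex_def sum_ennreal)
    also have "(\<Sum>i<n. 1 / n * V i * ex) = (1 / n) * (\<Sum>i<n. V i) * ex"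
      by (simp add: sum_distrib_left sum_distrib_right)
    finally show ?thesis by (simp add: V_def ex_def sum_nonneg flip: ennreal_plus)
  qed
  finally show ?thesis unfolding \<kappa>_def V_def ex_def .
qed

end

section \<open>Choice of the constants for the graph\<close>

lemma ln_close:
  fixes x0 \<delta> :: real
  assumes "0 < x0" "0 < \<delta>"
  obtains \<eta> where "0 < \<eta>" "\<And>x. \<bar>x - x0\<bar> \<le> \<eta> \<Longrightarrow> 0 < x \<and> \<bar>ln x - ln x0\<bar> \<le> \<delta>"
proof -
  have "isCont ln x0" using assms by (intro isCont_ln) auto
  then obtain r where r: "0 < r" "\<And>x. dist x x0 < r \<Longrightarrow> dist (ln x) (ln x0) < \<delta>"
    using assms(2) unfolding continuous_at_eps_delta by blast
  show ?thesis
  proof (rule that[of "min (r/2) (x0/2)"])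
    show "0 < min (r / 2) (x0 / 2)" using r assms by simp
    fix x assume x: "\<bar>x - x0\<bar> \<le> min (r / 2) (x0 / 2)"
    then have "dist (ln x) (ln x0) < \<delta>" using r by (intro r(2)) (simp add: dist_real_def)
    moreover have "0 < x"
    proof -
      have "2 * \<bar>x - x0\<bar> \<le> x0" "x0 - x \<le> \<bar>x - x0\<bar>" using x by auto
      then show ?thesis using assms(1) by (smt (verit))
    qed
    ultimately show "0 < x \<and> \<bar>ln x - ln x0\<bar> \<le> \<delta>" by (simp add: dist_real_def)
  qed
qed

lemma log_ratio_close:
  fixes a b \<delta> :: real
  assumes ab: "0 < a" "0 < b" and \<delta>: "0 < \<delta>"
  obtains \<eta> where "0 < \<eta>"
    "\<And>x z. \<bar>x - a / 4\<bar> \<le> \<eta> \<Longrightarrow> \<bar>z - b / 4\<bar> \<le> \<eta> \<Longrightarrow> \<bar>ln (x / z) - ln (a / b)\<bar> \<le> \<delta>"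
proof -
  obtain \<eta>1 where 1: "0 < \<eta>1" "\<And>x. \<bar>x - a / 4\<bar> \<le> \<eta>1 \<Longrightarrow> 0 < x \<and> \<bar>ln x - ln (a / 4)\<bar> \<le> \<delta> / 2"
    using ln_close[of "a / 4" "\<delta> / 2"] ab \<delta> by auto
  obtain \<eta>2 where 2: "0 < \<eta>2" "\<And>x. \<bar>x - b / 4\<bar> \<le> \<eta>2 \<Longrightarrow> 0 < x \<and> \<bar>ln x - ln (b / 4)\<bar> \<le> \<delta> / 2"
    using ln_close[of "b / 4" "\<delta> / 2"] ab \<delta> by auto
  show ?thesis
  proof (rule that[of "min \<eta>1 \<eta>2"])
    show "0 < min \<eta>1 \<eta>2" using 1 2 by simp
    fix x z assume "\<bar>x - a / 4\<bar> \<le> min \<eta>1 \<eta>2" "\<bar>z - b / 4\<bar> \<le> min \<eta>1 \<eta>2"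
    then have x: "0 < x" "\<bar>ln x - ln (a / 4)\<bar> \<le> \<delta> / 2" and z: "0 < z" "\<bar>ln z - ln (b / 4)\<bar> \<le> \<delta> / 2"
      using 1(2)[of x] 2(2)[of z] by auto
    have "ln (x / z) - ln (a / b) = (ln x - ln (a / 4)) - (ln z - ln (b / 4))"
      using x z ab by (simp add: ln_div)
    then show "\<bar>ln (x / z) - ln (a / b)\<bar> \<le> \<delta>" using x z by linarith
  qed
qed

text \<open>The bound is uniform in labels, vector, sign, dimension and eigenvalue. It can therefore
  be applied to each realisation of the features, with \<open>\<epsilon>\<close> fixed before the
  noise level \<open>\<rho>\<close> is chosen.\<close>

definition sbm_error_le :: "nat \<Rightarrow> real \<Rightarrow> real \<Rightarrow> real \<Rightarrow> real \<Rightarrow> bool" where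
  "sbm_error_le n \<alpha> \<beta> \<epsilon> E \<longleftrightarrow> (\<forall>(y :: nat \<Rightarrow> real) (u :: nat \<Rightarrow> real) (s :: real) (d :: nat) (l :: real).
     (\<forall>j<n. y j = 1 \<or> y j = -1) \<longrightarrow> \<bar>\<Sum>j<n. y j\<bar> \<le> \<epsilon> * real n \<longrightarrow> s = 1 \<or> s = -1 \<longrightarrow>
     real (card {j. j < n \<and> sgn (u j) \<noteq> s * y j}) \<le> \<epsilon> * real n \<longrightarrow>
     (\<integral>\<^sup>+U. ennreal (mismatch n (\<lambda>i. sgn (u_tilde n d (sbm_adj n \<alpha> \<beta> y U) l u i)) y) \<partial>edge_unif n)
      \<le> ennreal (4 * exp (- real n) + (1 / n) * (\<Sum>i<n. exp (- (1/2) * score_weight n d l * (s * sqrt n * y i * u i))) * E))"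

lemma sbm_error_le_mono:
  assumes "sbm_error_le n \<alpha> \<beta> \<epsilon>' E" "\<epsilon> \<le> \<epsilon>'"
  shows "sbm_error_le n \<alpha> \<beta> \<epsilon> E"
proof -
  have "\<epsilon> * real n \<le> \<epsilon>' * real n" using assms(2) by (intro mult_right_mono) auto
  then have "x \<le> \<epsilon> * real n \<Longrightarrow> x \<le> \<epsilon>' * real n" for x by linarith
  then show ?thesis using assms(1) unfolding sbm_error_le_def by blast
qed

lemma sbm_error_bound:
  fixes a b \<delta> :: real and q :: "nat \<Rightarrow> real"
  assumes ab: "0 < a" "0 < b" and qlim: "filterlim q at_top sequentially"
    and qle: "\<forall>n\<ge>1. q n \<le> ln (real n)" and \<delta>: "0 < \<delta>"
  obtains \<epsilon> where "0 < \<epsilon>"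
    "\<forall>\<^sub>F n in sequentially. sbm_error_le n (a * q n / n) (b * q n / n) \<epsilon> (exp (q n * (\<delta> - (sqrt a - sqrt b)\<^sup>2 / 2)))"
proof -
  \<comment> \<open>The solution of \<open>sqrt (a * b) * exp (\<delta>' / 2) = sqrt (a * b) +
    \<delta> / 2\<close>: the logarithm consumes half of \<open>\<delta>\<close>, and the other half
    is left for \<open>\<epsilon> * (5 * B)\<close>.\<close>
  define \<delta>' where "\<delta>' = 2 * ln (1 + \<delta> / (2 * sqrt (a * b)))"
  have sq: "0 < sqrt (a * b)" using ab by simp
  have "1 < 1 + \<delta> / (2 * sqrt (a * b))" using sq \<delta> by simp
  then have \<delta>': "0 < \<delta>'" unfolding \<delta>'_def by (simp only: ln_gt_zero mult_pos_pos zero_less_numeral)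
  have e\<delta>: "sqrt (a * b) * exp (\<delta>' / 2) = sqrt (a * b) + \<delta> / 2"
    using ab \<delta> by (simp add: \<delta>'_def add_pos_pos distrib_left)
  obtain \<eta> where \<eta>: "0 < \<eta>"
    "\<And>x z. \<bar>x - a / 4\<bar> \<le> \<eta> \<Longrightarrow> \<bar>z - b / 4\<bar> \<le> \<eta> \<Longrightarrow> \<bar>ln (x / z) - ln (a / b)\<bar> \<le> \<delta>'"
    using log_ratio_close[OF ab \<delta>'] by blast
  define K where "K = exp (\<bar>ln (a / b)\<bar> / 2 + \<delta>' / 2)"
  define B where "B = (a + b) * (K + 1)"
  have B: "0 < B" using ab by (simp add: B_def K_def add_pos_pos)
  define \<epsilon> where "\<epsilon> = min 1 (min (\<eta> / (4 * (a + b))) (\<delta> / (10 * B)))"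
  have "0 < \<epsilon>" using ab \<eta> \<delta> B by (simp add: \<epsilon>_def)
  moreover have \<epsilon>1: "\<epsilon> \<le> 1" by (simp add: \<epsilon>_def)
  moreover have "\<epsilon> * (4 * (a + b)) \<le> \<eta>"
    using ab by (subst pos_le_divide_eq[symmetric]) (auto simp: \<epsilon>_def)
  moreover have "\<epsilon> * (10 * B) \<le> \<delta>"
    using B by (subst pos_le_divide_eq[symmetric]) (auto simp: \<epsilon>_def)
  ultimately have eps: "0 < \<epsilon>" "\<epsilon> \<le> 1" "4 * (a + b) * \<epsilon> \<le> \<eta>" "\<epsilon> * (5 * B) \<le> \<delta> / 2"
    by (simp_all add: mult_ac)
  have tendsto: "((\<lambda>n. c * (ln (real n) / n)) \<longlongrightarrow> c * 0) sequentially" for c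
    by (intro tendsto_mult tendsto_const lim_ln_over_n)
  have lnsmall: "\<forall>\<^sub>F n in sequentially. c * (ln (real n) / n) < 1" for c
    using order_tendstoD(2)[OF tendsto[of c], of 1] by simp
  have small: "\<forall>\<^sub>F n in sequentially. c * q n / n \<le> 1" if c: "0 < c" for c
    using lnsmall[of c] eventually_ge_at_top[of 1]
  proof eventually_elim
    case (elim n)
    have "c * q n / n \<le> c * ln n / n" using qle elim c by (intro divide_right_mono mult_left_mono) auto
    also have "\<dots> = c * (ln n / n)" by simp
    finally show ?case using elim by linarith
  qed
  have qbig: "\<forall>\<^sub>F n in sequentially. c \<le> q n" for c
    using qlim by (simp add: filterlim_at_top)
  have nbig: "\<forall>\<^sub>F n in sequentially. 1 \<le> \<epsilon> * real n"
    using eventually_ge_at_top[of "nat \<lceil>1 / \<epsilon>\<rceil>"]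
  proof eventually_elim
    case (elim n)
    then have "1 / \<epsilon> \<le> n" by linarith
    then show ?case using eps by (simp add: field_simps)
  qed
  show ?thesis
  proof (rule that[OF eps(1)])
    show "\<forall>\<^sub>F n in sequentially. sbm_error_le n (a * q n / n) (b * q n / n) \<epsilon> (exp (q n * (\<delta> - (sqrt a - sqrt b)\<^sup>2 / 2)))"
      using small[OF ab(1)] small[OF ab(2)] qbig[of 1] qbig[of "1 / ((a + b) * \<epsilon>\<^sup>2)"] nbig eventually_ge_at_top[of 1]
    proof eventually_elim
      case (elim n)
      show ?case
        unfolding sbm_error_le_def
      proof (intro allI impI)
        fix y u :: "nat \<Rightarrow> real" and s l :: real and d :: nat
        assume H: "\<forall>j<n. y j = 1 \<or> y j = -1" "\<bar>\<Sum>j<n. y j\<bar> \<le> \<epsilon> * n" "s = 1 \<or> s = -1"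
          "card {j. j < n \<and> sgn (u j) \<noteq> s * y j} \<le> \<epsilon> * n"
        interpret label_estimate n a b "q n" \<epsilon> y u s
          using elim H ab eps by unfold_locales auto
        have cont: "\<bar>ln (x / z) - ln (a / b)\<bar> \<le> \<delta>'"
          if "\<bar>x - a / 4\<bar> \<le> 4 * (a + b) * \<epsilon>" "\<bar>z - b / 4\<bar> \<le> 4 * (a + b) * \<epsilon>" for x z
          using that eps(3) by (intro \<eta>(2)) linarith+
        \<comment> \<open>The tilt for the bad event is \<open>\<theta> = \<epsilon>\<close>. Its
          exponent becomes \<open>- (a + b) * \<epsilon>\<^sup>2 * q n * n\<close>, which falls
          below \<open>- n\<close> because \<open>q\<close> tends to infinity.\<close>
        have "(\<integral>\<^sup>+U. ennreal (mismatch n (\<lambda>i. sgn (u_tilde n d (adj U) l u i)) y) \<partial>PU)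
         \<le> ennreal (4 * exp (- \<epsilon> * (2 * (a + b) * \<epsilon> * q n * n) + \<epsilon>\<^sup>2 * ((a + b) * q n * n))
            + (1 / n) * (\<Sum>i<n. exp (- (1/2) * score_weight n d l * (s * sqrt n * y i * u i)))
              * exp (q n * (sqrt (a * b) * exp (\<delta>' / 2) - (a + b) / 2 + \<epsilon> * (5 * ((a + b) * (K + 1))))))"
          unfolding K_def using \<delta>' \<epsilon> by (intro conditional_error cont) auto
        also have "\<dots> \<le> ennreal (4 * exp (- real n) + (1 / n) * (\<Sum>i<n. exp (- (1/2) * score_weight n d l * (s * sqrt n * y i * u i)))
            * exp (q n * (\<delta> - (sqrt a - sqrt b)\<^sup>2 / 2)))"
        proof (intro ennreal_leI add_mono mult_left_mono, unfold exp_le_cancel_iff)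
          have "1 \<le> (a + b) * \<epsilon>\<^sup>2 * q n" 
          proof -
            have "0 < (a + b) * \<epsilon>\<^sup>2" using ab \<epsilon> by simp
            then show ?thesis using elim(4) by (simp add: pos_divide_le_eq mult_ac)
          qed
          then have "1 * real n \<le> (a + b) * \<epsilon>\<^sup>2 * q n * n" by (intro mult_right_mono) auto
          moreover have "- \<epsilon> * (2 * (a + b) * \<epsilon> * q n * n) + \<epsilon>\<^sup>2 * ((a + b) * q n * n) = - ((a + b) * \<epsilon>\<^sup>2 * q n * n)"
            by (simp add: power2_eq_square algebra_simps)
          ultimately show "- \<epsilon> * (2 * (a + b) * \<epsilon> * q n * n) + \<epsilon>\<^sup>2 * ((a + b) * q n * n) \<le> - real n" by linarith
          have "(sqrt a - sqrt b)\<^sup>2 = a + b - 2 * sqrt (a * b)"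
            using ab by (simp add: power2_diff real_sqrt_mult)
          then have "sqrt (a * b) * exp (\<delta>' / 2) - (a + b) / 2 + \<epsilon> * (5 * B) \<le> \<delta> - (sqrt a - sqrt b)\<^sup>2 / 2"
            unfolding e\<delta> using eps(4) by (simp add: field_simps)
          then show "q n * (sqrt (a * b) * exp (\<delta>' / 2) - (a + b) / 2 + \<epsilon> * (5 * ((a + b) * (K + 1))))
              \<le> q n * (\<delta> - (sqrt a - sqrt b)\<^sup>2 / 2)"
            using elim(3) by (intro mult_left_mono) (auto simp: B_def)
        qed (auto intro!: divide_nonneg_nonneg sum_nonneg)
        finally show "(\<integral>\<^sup>+U. ennreal (mismatch n (\<lambda>i. sgn (u_tilde n d (adj U) l u i)) y) \<partial>PU)
          \<le> ennreal (4 * exp (- real n) + (1 / n) * (\<Sum>i<n. exp (- (1/2) * score_weight n d l * (s * sqrt n * y i * u i)))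
            * exp (q n * (\<delta> - (sqrt a - sqrt b)\<^sup>2 / 2)))" .
      qed
    qed
  qed
qed

section \<open>The Gaussian score\<close>

text \<open>The parameters \<open>r2 = R\<^sup>2\<close> and \<open>Q = c q\<close> are tied by \<open>R\<^sup>4 = Q (R\<^sup>2 + d / n)\<close>.\<close>

locale mixture =
  fixes n d :: nat and y \<mu> :: "nat \<Rightarrow> real" and r2 Q \<rho> :: real
    and eig :: "nat \<Rightarrow> (nat \<Rightarrow> nat \<Rightarrow> real) \<Rightarrow> real \<times> (nat \<Rightarrow> real)"
  assumes n: "1 \<le> n" and d: "1 \<le> d" and y: "\<And>j. j < n \<Longrightarrow> (y j)\<^sup>2 = 1" and r2: "sqn d \<mu> = r2" "0 < r2"
    and \<rho>: "0 < \<rho>" "\<rho> \<le> 1 / 100" "1 \<le> \<rho>\<^sup>2 * n" "7 \<le> \<rho> * n"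
    and snr: "r2\<^sup>2 = Q * (r2 + d / n)"
    and Q: "57600 / (\<rho> / 7)\<^sup>2 \<le> Q"
    and eig: "\<forall>n\<ge>1. \<forall>G. sym_mat n G \<longrightarrow> top_eigpair n G (fst (eig n G)) (snd (eig n G))"
begin

abbreviation "Gm \<equiv> gram n d y \<mu>"
abbreviation "PZ \<equiv> gaussians ({..<n} \<times> {..<d})"
abbreviation "good Z \<equiv> good_noise n d \<mu> r2 (\<rho> / 7) Z"
definition "lz Z = fst (eig n (Gm Z))"
definition "uz Z = snd (eig n (Gm Z))"
abbreviation "coef Z \<equiv> score_weight n d (lz Z)"
text \<open>\<open>f i\<close> is the score of \<open>entry_lower_bound\<close> and
  \<open>S i\<close> the event on which \<open>loo_score_mgf\<close> bounds its transform. Both are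
  built from power iterates, whereas \<open>lz\<close> and \<open>uz\<close> come from an arbitrary
  selection of eigenpairs.\<close>

definition "f i Z = y i * ip d (gmm_X y \<mu> Z i) (loo_W n d y \<mu> i Z) / (n * r2)"
definition "S i = {Z. loo_p n d y \<mu> i Z i = 0 \<and> (1 - 2 * \<rho>) * (n * r2) \<le> ip d \<mu> (loo_W n d y \<mu> i Z)
   \<and> sqn d (loo_W n d y \<mu> i Z) \<le> (1 + 10 * \<rho>) * (n * (n * r2 + d))}"

lemma n_pos: "0 < real n" using n by simp

lemma Q_pos: "0 < Q"
proof -
  have "0 < 57600 / (\<rho> / 7)\<^sup>2" using \<rho> by simp
  then show ?thesis using Q by linarith
qed

lemma Q_bounds: "Q \<le> r2" "Q * d / n \<le> r2\<^sup>2"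
proof -
  have "Q * r2 \<le> r2 * r2" using snr Q_pos n_pos by (simp add: power2_eq_square distrib_left)
  then show "Q \<le> r2" using r2 by simp
  show "Q * d / n \<le> r2\<^sup>2" unfolding snr using Q_pos r2 by (simp add: distrib_left)
qed

lemma bad_noise_prob: "emeasure PZ {Z \<in> space PZ. \<not> good Z} \<le> ennreal (3 * exp (- 2 * real n))"
  using n d r2 \<rho> Q Q_bounds by (intro good_noise_prob[of n d \<mu> r2 "\<rho> / 7" Q]) auto

lemma sym_gram: "sym_mat n (Gm Z)"
  by (auto simp: sym_mat_def gram_def gram_hollow_def mult.commute intro!: sum.cong)

text \<open>The noise event is taken at level \<open>\<rho> / 7\<close> to offset the factor 7 of
  \<open>gram_noise_bound\<close>.\<close>

lemma gram_noise:
  assumes "good Z"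
  shows "\<bar>ip n x (mv n (Gm Z) z) - r2 * ip n y x * ip n y z\<bar> \<le> \<rho> * (n * r2) * nrm n x * nrm n z"
proof -
  have "\<bar>ip n x (mv n (Gm Z) z) - r2 * ip n y x * ip n y z\<bar> \<le> 7 * (\<rho> / 7) * (n * r2) * nrm n x * nrm n z"
    unfolding gram_def
    using n y r2 \<rho> good_noise_forms[OF n _ _ assms] by (intro gram_noise_bound) auto
  then show ?thesis by simp
qed

text \<open>For the eigenvalue \<open>m * (n * r2)\<close>, half the weight of \<open>u\<close>
  equals \<open>Q * (m\<^sup>2 * (r2 + D) / (m * r2 + D))\<close> with \<open>D = d / n\<close>. The
  quotient is close to 1 when \<open>m\<close> is, uniformly in \<open>D\<close>, whichever of
  \<open>r2\<close> and \<open>D\<close> dominates.\<close>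

lemma coef_bounds:
  fixes m :: real
  assumes m: "1 - \<rho> \<le> m" "m \<le> 1 + \<rho>"
  shows "Q * (1 - 4 * \<rho>) \<le> (m * (n * r2))\<^sup>2 / (n * (m * (n * r2)) + real n * d)"
    and "(m * (n * r2))\<^sup>2 / (n * (m * (n * r2)) + real n * d) \<le> Q * (1 + 4 * \<rho>)"
proof -
  define D where "D = d / n"
  have D: "0 \<le> D" by (simp add: D_def)
  have mp: "0 < m" using m \<rho> by linarith
  have den: "0 < m * r2 + D" using mp r2 D by (simp add: add_pos_nonneg)
  have "(m * (n * r2))\<^sup>2 / (n * (m * (n * r2)) + real n * d) = (real n * n) * (m\<^sup>2 * r2\<^sup>2) / ((real n * n) * (m * r2 + D))"
    using n_pos by (simp add: D_def power_mult_distrib power2_eq_square distrib_left mult_ac)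
  also have "\<dots> = m\<^sup>2 * r2\<^sup>2 / (m * r2 + D)" using n_pos by simp
  also have "\<dots> = Q * (m\<^sup>2 * (r2 + D) / (m * r2 + D))" unfolding snr D_def by simp
  finally have eq: "(m * (n * r2))\<^sup>2 / (n * (m * (n * r2)) + real n * d) = Q * (m\<^sup>2 * (r2 + D) / (m * r2 + D))" .
  have sq: "\<rho>\<^sup>2 \<le> \<rho>" using \<rho> by (simp add: power2_eq_square mult_left_le_one_le)
  have m2: "(1 - \<rho>)\<^sup>2 \<le> m\<^sup>2" "m\<^sup>2 \<le> (1 + \<rho>)\<^sup>2" using m \<rho> mp by (auto intro!: power_mono)
  have lo: "(1 - 4 * \<rho>) * (m * r2 + D) \<le> m\<^sup>2 * (r2 + D)"
  proof -
    have "(1 - 4 * \<rho>) * m \<le> m * m" using m \<rho> mp by (intro mult_right_mono) auto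
    then have "(1 - 4 * \<rho>) * m * r2 \<le> m * m * r2" by (rule mult_right_mono) (use r2(2) in simp)
    moreover have "(1 - 4 * \<rho>) * D \<le> m\<^sup>2 * D"
    proof (rule mult_right_mono)
      have "(1 - \<rho>)\<^sup>2 = 1 - 2 * \<rho> + \<rho>\<^sup>2" by (simp add: power2_diff)
      then show "1 - 4 * \<rho> \<le> m\<^sup>2" using m2(1) \<rho> zero_le_power2[of \<rho>] by linarith
    qed (rule D)
    ultimately show ?thesis by (simp add: power2_eq_square algebra_simps)
  qed
  have hi: "m\<^sup>2 * (r2 + D) \<le> (1 + 4 * \<rho>) * (m * r2 + D)"
  proof -
    have "m * m \<le> (1 + 4 * \<rho>) * m" using m \<rho> mp by (intro mult_right_mono) auto
    then have "m * m * r2 \<le> (1 + 4 * \<rho>) * m * r2" by (rule mult_right_mono) (use r2(2) in simp)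
    moreover have "m\<^sup>2 * D \<le> (1 + 4 * \<rho>) * D"
    proof (rule mult_right_mono)
      have "(1 + \<rho>)\<^sup>2 = 1 + 2 * \<rho> + \<rho>\<^sup>2" by (simp add: power2_sum)
      then show "m\<^sup>2 \<le> 1 + 4 * \<rho>" using m2(2) \<rho> sq by linarith
    qed (rule D)
    ultimately show ?thesis by (simp add: power2_eq_square algebra_simps)
  qed
  show "Q * (1 - 4 * \<rho>) \<le> (m * (n * r2))\<^sup>2 / (n * (m * (n * r2)) + real n * d)"
    unfolding eq using lo den Q_pos by (intro mult_left_mono) (simp_all add: pos_le_divide_eq)
  show "(m * (n * r2))\<^sup>2 / (n * (m * (n * r2)) + real n * d) \<le> Q * (1 + 4 * \<rho>)"
    unfolding eq using hi den Q_pos by (intro mult_left_mono) (simp_all add: pos_divide_le_eq)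
qed

text \<open>A relative error shifts the tilt in a direction that depends on the sign of
  \<open>g\<close>. Keeping both shifted tilts removes the case distinction and leaves two Gaussian
  transforms.\<close>

lemma exp_score_le:
  fixes h V g :: real
  assumes h: "Q * (1 - 4 * \<rho>) \<le> h" "h \<le> Q * (1 + 4 * \<rho>)" and V: "g - 30 * \<rho> * \<bar>g\<bar> \<le> V"
  shows "exp (- (h * V)) \<le> exp (- (Q * (1 - 40 * \<rho>) * g)) + exp (- (Q * (1 + 40 * \<rho>) * g))"
proof -
  have h0: "0 \<le> h" using h(1) Q_pos \<rho> mult_nonneg_nonneg[of Q "1 - 4 * \<rho>"] by linarith
  have hV: "h * (g - 30 * \<rho> * \<bar>g\<bar>) \<le> h * V" using V h0 by (rule mult_left_mono)
  have "Q * (1 - 40 * \<rho>) * g \<le> h * V \<or> Q * (1 + 40 * \<rho>) * g \<le> h * V"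
  proof (cases "0 \<le> g")
    case True
    have "1 - 40 * \<rho> \<le> (1 - 4 * \<rho>) * (1 - 30 * \<rho>)" using \<rho> by (simp add: algebra_simps)
    then have "Q * (1 - 40 * \<rho>) \<le> Q * ((1 - 4 * \<rho>) * (1 - 30 * \<rho>))" using Q_pos by simp
    also have "\<dots> = Q * (1 - 4 * \<rho>) * (1 - 30 * \<rho>)" by simp
    also have "\<dots> \<le> h * (1 - 30 * \<rho>)" using h \<rho> by (intro mult_right_mono) auto
    finally have "Q * (1 - 40 * \<rho>) * g \<le> h * (1 - 30 * \<rho>) * g" using True by (rule mult_right_mono)
    then show ?thesis using hV True by (simp add: algebra_simps)
  next
    case False
    have "h * (1 + 30 * \<rho>) \<le> Q * (1 + 4 * \<rho>) * (1 + 30 * \<rho>)" using h \<rho> by (intro mult_right_mono) auto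
    also have "\<dots> = Q * ((1 + 4 * \<rho>) * (1 + 30 * \<rho>))" by simp
    also have "\<dots> \<le> Q * (1 + 40 * \<rho>)"
    proof (rule mult_left_mono)
      have "120 * \<rho> * \<rho> \<le> 6 * \<rho>" using \<rho> by (intro mult_right_mono) auto
      then show "(1 + 4 * \<rho>) * (1 + 30 * \<rho>) \<le> 1 + 40 * \<rho>" by (simp add: algebra_simps)
    qed (use Q_pos in simp)
    finally have "Q * (1 + 40 * \<rho>) * g \<le> h * (1 + 30 * \<rho>) * g" using False by (intro mult_right_mono_neg) auto
    then show ?thesis using hV False by (simp add: algebra_simps)
  qed
  then have "exp (- (h * V)) \<le> exp (- (Q * (1 - 40 * \<rho>) * g)) \<or> exp (- (h * V)) \<le> exp (- (Q * (1 + 40 * \<rho>) * g))"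
    by auto
  then show ?thesis by (smt (verit) exp_gt_zero)
qed

text \<open>All that the eigenvector analysis provides for one realisation of the noise. The sign
  \<open>s\<close> is chosen before \<open>i\<close>, since \<open>mismatch\<close> permits only one
  global flip, and the final bound no longer mentions \<open>eig\<close>.\<close>

lemma good_noise_scores:
  assumes g: "good Z"
  obtains s where "s = 1 \<or> s = -1" "card {j. j < n \<and> sgn (uz Z j) \<noteq> s * y j} \<le> 4 * \<rho> * n"
    "\<And>i. i < n \<Longrightarrow> Z \<in> S i \<and> exp (- (1/2) * coef Z * (s * sqrt n * y i * uz Z i))
        \<le> exp (- (Q * (1 - 40 * \<rho>)) * f i Z) + exp (- (Q * (1 + 40 * \<rho>)) * f i Z)"
proof -
  have Lr: "n * r2 / n = r2" using n_pos by simp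
  interpret N: noisy_signs n "Gm Z" y "n * r2" \<rho> "lz Z" "uz Z"
  proof
    show "\<bar>ip n x (mv n (Gm Z) z) - n * r2 / n * ip n y x * ip n y z\<bar> \<le> \<rho> * (n * r2) * nrm n x * nrm n z" for x z
      unfolding Lr by (rule gram_noise[OF g])
    show "top_eigpair n (Gm Z) (lz Z) (uz Z)" unfolding lz_def uz_def using eig n sym_gram by blast
  qed (use n y r2 \<rho> sym_gram n_pos in auto)
  define m where "m = lz Z / (n * r2)"
  have L: "0 < n * r2" using n_pos r2 by simp
  have lm: "lz Z = m * (n * r2)" using L by (metis m_def less_irrefl nonzero_eq_divide_eq)
  have m: "1 - \<rho> \<le> m" "m \<le> 1 + \<rho>"
    using N.l_bounds by (simp_all add: m_def pos_le_divide_eq[OF L] pos_divide_le_eq[OF L])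
  have half: "1/2 * coef Z = (m * (n * r2))\<^sup>2 / (n * (m * (n * r2)) + real n * d)"
    unfolding score_weight_def lm by simp
  show ?thesis
  proof (rule that[of N.s])
    show "N.s = 1 \<or> N.s = -1" by (rule N.s_cases)
    show "card {j. j < n \<and> sgn (uz Z j) \<noteq> N.s * y j} \<le> 4 * \<rho> * n" by (rule N.mismatch_le)
    fix i assume i: "i < n"
    define lm where "lm = fst (eig n (loo_mat i (Gm Z)))"
    define \<psi> where "\<psi> = snd (eig n (loo_mat i (Gm Z)))"
    have symM: "sym_mat n (loo_mat i (Gm Z))" using sym_gram[of Z] by (auto simp: sym_mat_def loo_mat_def)
    then have top: "top_eigpair n (loo_mat i (Gm Z)) lm \<psi>" unfolding lm_def \<psi>_def using eig n by blast
    have Gii: "Gm Z i i = 0" by (simp add: gram_def gram_hollow_def)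
    note loo = i Gii top
    have p0: "loo_p n d y \<mu> i Z i = 0" unfolding loo_p_def by (rule N.loo_vec_i[OF loo])
    have fi: "y i * ip n (Gm Z i) (loo_vec n (Gm Z) y i) / (n * r2) = f i Z"
      unfolding f_def loo_W_def using gram_apply[of i n "loo_p n d y \<mu> i Z" d "gmm_X y \<mu> Z", OF i p0] by (simp add: gram_def loo_p_def)
    have "f i Z - 30 * \<rho> * \<bar>f i Z\<bar> \<le> N.s * sqrt n * y i * uz Z i"
      using N.entry_lower_bound[OF loo] unfolding fi .
    then have "exp (- (1/2 * coef Z * (N.s * sqrt n * y i * uz Z i)))
      \<le> exp (- (Q * (1 - 40 * \<rho>) * f i Z)) + exp (- (Q * (1 + 40 * \<rho>) * f i Z))"
      using coef_bounds[OF m] unfolding half by (intro exp_score_le)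
    moreover have "Z \<in> S i"
    proof -
      have E1: "\<bar>sqn d (tmul n (curry Z) x) - d * ip n x x\<bar> \<le> \<rho> * (n * r2) * ip n x x" for x
      proof -
        have "\<bar>sqn d (tmul n (curry Z) x) - d * ip n x x\<bar> \<le> \<rho> / 7 * (n * r2) * ip n x x"
          using n r2 \<rho> g by (intro good_noise_forms(1)) auto
        also have "\<dots> \<le> \<rho> * (n * r2) * ip n x x" using \<rho> L by (intro mult_right_mono) auto
        finally show ?thesis .
      qed
      have "nrm n (noise_proj d \<mu> Z) \<le> \<rho> / 7 * sqrt n * r2"
        using n r2 \<rho> g by (intro good_noise_forms(2)) auto
      also have "\<dots> \<le> \<rho> * sqrt n * r2" using \<rho> r2 by (intro mult_right_mono) auto
      finally have E2: "nrm n (noise_proj d \<mu> Z) \<le> \<rho> * sqrt n * r2" .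
      have "(1 - 2 * \<rho>) * (n * r2) \<le> ip d \<mu> (loo_W n d y \<mu> i Z)"
        "sqn d (loo_W n d y \<mu> i Z) \<le> (1 + 10 * \<rho>) * (n * (n * r2 + d))"
        unfolding loo_W_def loo_p_def
        using loo_projection_bounds[OF r2(1) _ _ E1 E2 N.ip_y_loo[OF loo] N.loo_sq[OF loo]] \<rho> by auto
      then show ?thesis by (simp add: S_def p0)
    qed
    ultimately show "Z \<in> S i \<and> exp (- (1/2) * coef Z * (N.s * sqrt n * y i * uz Z i))
        \<le> exp (- (Q * (1 - 40 * \<rho>)) * f i Z) + exp (- (Q * (1 + 40 * \<rho>)) * f i Z)"
      by simp
  qed
qed

text \<open>By the relation \<open>snr\<close> the conditional score has mean about 1 and variance
  about \<open>1 / Q\<close>, so at tilt \<open>Q * \<tau>\<close> the exponent is about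
  \<open>Q * (\<tau>\<^sup>2 / 2 - \<tau>)\<close>. It is stationary at \<open>\<tau> = 1\<close>,
  hence the shift by \<open>40 * \<rho>\<close> costs only second order; the generous
  \<open>100 * \<rho>\<close> covers it together with the errors in mean and variance.\<close>

lemma score_mgf:
  assumes i: "i < n" and \<sigma>: "\<sigma> = 40 * \<rho> \<or> \<sigma> = - 40 * \<rho>"
  shows "(\<integral>\<^sup>+Z. indicator (S i) Z * ennreal (exp (- (Q * (1 + \<sigma>)) * f i Z)) \<partial>PZ) \<le> ennreal (exp (Q * (100 * \<rho> - 1/2)))"
proof -
  define \<tau> where "\<tau> = 1 + \<sigma>"
  have \<tau>: "0 \<le> \<tau>" using \<sigma> \<rho> by (auto simp: \<tau>_def)
  have L: "0 < n * r2" using n_pos r2 by simp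
  have "(\<integral>\<^sup>+Z. indicator (S i) Z * ennreal (exp (- (Q * \<tau>) * f i Z)) \<partial>PZ)
     \<le> ennreal (exp (- (Q * \<tau>) * ((1 - 2 * \<rho>) * (n * r2)) / (n * r2)
         + (Q * \<tau>)\<^sup>2 * ((1 + 10 * \<rho>) * (n * (n * r2 + d))) / (2 * (n * r2)\<^sup>2)))"
    unfolding S_def f_def using i y L Q_pos \<tau> by (intro loo_score_mgf) auto
  also have "\<dots> \<le> ennreal (exp (Q * (100 * \<rho> - 1/2)))"
  proof (intro ennreal_leI, unfold exp_le_cancel_iff)
    define D where "D = d / n"
    have dD: "real d = n * D" using n_pos by (simp add: D_def)
    have "(Q * \<tau>)\<^sup>2 * ((1 + 10 * \<rho>) * (n * (n * r2 + d))) / (2 * (n * r2)\<^sup>2)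
        = (real n * n) * (Q\<^sup>2 * \<tau>\<^sup>2 * (1 + 10 * \<rho>) * (r2 + D)) / ((real n * n) * (2 * r2\<^sup>2))"
      unfolding dD by (simp add: power2_eq_square algebra_simps)
    also have "\<dots> = Q\<^sup>2 * \<tau>\<^sup>2 * (1 + 10 * \<rho>) * (r2 + D) / (2 * r2\<^sup>2)"
      using n_pos by simp
    also have "\<dots> = Q * (\<tau>\<^sup>2 * (1 + 10 * \<rho>) / 2) * (Q * (r2 + d / n) / r2\<^sup>2)"
      by (simp add: power2_eq_square D_def)
    also have "Q * (r2 + d / n) / r2\<^sup>2 = 1" unfolding snr[symmetric] using r2 by simp
    finally have e1: "(Q * \<tau>)\<^sup>2 * ((1 + 10 * \<rho>) * (n * (n * r2 + d))) / (2 * (n * r2)\<^sup>2) = Q * (\<tau>\<^sup>2 * (1 + 10 * \<rho>) / 2)"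
      by simp
    have e0: "- (Q * \<tau>) * ((1 - 2 * \<rho>) * (n * r2)) / (n * r2) = - (Q * \<tau>) * (1 - 2 * \<rho>)"
      using n_pos r2 by simp
    have e: "- (Q * \<tau>) * ((1 - 2 * \<rho>) * (n * r2)) / (n * r2)
         + (Q * \<tau>)\<^sup>2 * ((1 + 10 * \<rho>) * (n * (n * r2 + d))) / (2 * (n * r2)\<^sup>2)
        = Q * (- \<tau> * (1 - 2 * \<rho>) + \<tau>\<^sup>2 * (1 + 10 * \<rho>) / 2)"
      unfolding e0 e1 by (simp add: algebra_simps)
    have "- \<tau> * (1 - 2 * \<rho>) + \<tau>\<^sup>2 * (1 + 10 * \<rho>) / 2 \<le> 100 * \<rho> - 1/2"
    proof -
      have r: "\<rho>\<^sup>2 \<le> \<rho> / 100" "\<rho> ^ 3 \<le> \<rho> / 10000" "0 \<le> \<rho>\<^sup>2" "0 \<le> \<rho> ^ 3"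
      proof -
        show "\<rho>\<^sup>2 \<le> \<rho> / 100" using mult_right_mono[OF \<rho>(2), of \<rho>] \<rho> by (simp add: power2_eq_square)
        have "\<rho> * \<rho> \<le> (1/100) * (1/100)" using \<rho> by (intro mult_mono) auto
        from mult_right_mono[OF this, of \<rho>] show "\<rho> ^ 3 \<le> \<rho> / 10000" using \<rho> by (simp add: power3_eq_cube)
      qed (use \<rho> in auto)
      have "- (1 + 40 * \<rho>) * (1 - 2 * \<rho>) + (1 + 40 * \<rho>)\<^sup>2 * (1 + 10 * \<rho>) / 2 = - 1/2 + 7 * \<rho> + 1280 * \<rho>\<^sup>2 + 8000 * \<rho> ^ 3"
        "- (1 - 40 * \<rho>) * (1 - 2 * \<rho>) + (1 - 40 * \<rho>)\<^sup>2 * (1 + 10 * \<rho>) / 2 = - 1/2 + 7 * \<rho> + 320 * \<rho>\<^sup>2 + 8000 * \<rho> ^ 3"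
        by (simp_all add: field_simps power2_eq_square power3_eq_cube)
      then show ?thesis using \<sigma> r \<rho> unfolding \<tau>_def by (elim disjE) simp_all
    qed
    then show "- (Q * \<tau>) * ((1 - 2 * \<rho>) * (n * r2)) / (n * r2)
         + (Q * \<tau>)\<^sup>2 * ((1 + 10 * \<rho>) * (n * (n * r2 + d))) / (2 * (n * r2)\<^sup>2) \<le> Q * (100 * \<rho> - 1/2)"
      unfolding e using Q_pos by (intro mult_left_mono) auto
  qed
  finally show ?thesis by (simp add: \<tau>_def)
qed

end

section \<open>Labels and mean vector\<close>

lemma sets_sign_unif [simp, measurable_cong]: "sets sign_unif = UNIV"
  by (simp add: sign_unif_def)

lemma space_sign_unif [simp]: "space sign_unif = UNIV"
  by (simp add: sign_unif_def)

lemma prob_space_sign_unif: "prob_space sign_unif"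
  unfolding sign_unif_def by (rule measure_pmf.prob_space_axioms)

interpretation SG: prob_space sign_unif by (rule prob_space_sign_unif)
interpretation SGP: product_sigma_finite "\<lambda>_. sign_unif" by standard

lemma AE_signs:
  fixes n :: nat
  shows "AE y in PiM {..<n} (\<lambda>_. sign_unif). \<forall>j<n. y j = 1 \<or> y j = -1"
proof -
  have "AE x in sign_unif. x = 1 \<or> x = -1"
    unfolding sign_unif_def by (auto simp: AE_measure_pmf_iff)
  then have "AE y in PiM {..<n} (\<lambda>_. sign_unif). y j = 1 \<or> y j = -1" if "j \<in> {..<n}" for j
    using that by (intro AE_PiM_component) (auto intro: prob_space_sign_unif)
  then have "AE y in PiM {..<n} (\<lambda>_. sign_unif). \<forall>j\<in>{..<n}. y j = 1 \<or> y j = -1"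
    by (subst AE_finite_all) auto
  then show ?thesis by (simp only: lessThan_iff Ball_def)
qed

lemma measurable_sign_component:
  fixes n :: nat
  shows "j < n \<Longrightarrow> (\<lambda>y. y j) \<in> borel_measurable (PiM {..<n} (\<lambda>_. sign_unif))"
  by (rule measurable_compose[OF measurable_component_singleton]) (auto simp: measurable_def)

lemma sign_mgf:
  assumes t: "\<bar>t\<bar> \<le> 1"
  shows "(\<integral>\<^sup>+x. ennreal (exp (t * x)) \<partial>sign_unif) \<le> ennreal (exp (t\<^sup>2))"
proof -
  have "(\<integral>\<^sup>+x. ennreal (exp (t * x)) \<partial>sign_unif) = (ennreal (exp (- t)) + ennreal (exp t)) / 2"
    unfolding sign_unif_def by (subst nn_integral_pmf_of_set) auto
  also have "\<dots> = ennreal ((exp (- t) + exp t) / 2)"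
    by (simp add: ennreal_plus[symmetric] divide_ennreal[symmetric] del: ennreal_plus)
  also have "\<dots> \<le> ennreal (exp (t\<^sup>2))"
  proof (rule ennreal_leI)
    have "(exp (- t) + exp t) / 2 \<le> 1 + t\<^sup>2"
      using exp_minus_one_le[of t] exp_minus_one_le[of "- t"] t by simp
    then show "(exp (- t) + exp t) / 2 \<le> exp (t\<^sup>2)"
      using exp_ge_add_one_self[of "t\<^sup>2"] by linarith
  qed
  finally show ?thesis .
qed

lemma sign_balance:
  fixes n :: nat and \<epsilon> :: real
  assumes \<epsilon>: "0 < \<epsilon>" "\<epsilon> \<le> 1"
  shows "emeasure (PiM {..<n} (\<lambda>_. sign_unif)) {y \<in> space (PiM {..<n} (\<lambda>_. sign_unif)). \<epsilon> * n < \<bar>\<Sum>j<n. y j\<bar>}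
    \<le> ennreal (2 * exp (- (\<epsilon>\<^sup>2 * n / 4)))"
proof -
  let ?P = "PiM {..<n} (\<lambda>_. sign_unif)"
  note measurable_sign_component[measurable]
  \<comment> \<open>The minimiser of \<open>t\<^sup>2 - t * \<epsilon>\<close>, with value
    \<open>- \<epsilon>\<^sup>2 / 4\<close>.\<close>
  define t where "t = \<epsilon> / 2"
  have t: "0 < t" "t \<le> 1" using \<epsilon> by (auto simp: t_def)
  show ?thesis
  proof (rule two_sided_chernoff)
    fix s :: real assume s: "s = 1 \<or> s = -1"
    define \<sigma> where "\<sigma> = s * t"
    have \<sigma>: "\<bar>\<sigma>\<bar> \<le> 1" "\<sigma>\<^sup>2 = t\<^sup>2" using s t by (auto simp: \<sigma>_def)
    have "(\<integral>\<^sup>+y. ennreal (exp (\<sigma> * (\<Sum>j<n. y j) - t * (\<epsilon> * n))) \<partial>?P)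
        = (\<integral>\<^sup>+y. ennreal (exp (- t * (\<epsilon> * n))) * (\<Prod>j<n. ennreal (exp (\<sigma> * y j))) \<partial>?P)"
    proof (intro nn_integral_cong)
      fix y :: "nat \<Rightarrow> real"
      have "(\<Prod>j<n. ennreal (exp (\<sigma> * y j))) = ennreal (exp (\<sigma> * (\<Sum>j<n. y j)))"
        by (simp add: exp_sum prod_ennreal sum_distrib_left)
      then show "ennreal (exp (\<sigma> * (\<Sum>j<n. y j) - t * (\<epsilon> * n))) = ennreal (exp (- t * (\<epsilon> * n))) * (\<Prod>j<n. ennreal (exp (\<sigma> * y j)))"
        by (simp add: mult_exp_exp flip: ennreal_mult)
    qed
    also have "\<dots> = ennreal (exp (- t * (\<epsilon> * n))) * (\<integral>\<^sup>+y. (\<Prod>j<n. ennreal (exp (\<sigma> * y j))) \<partial>?P)"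
      by (intro nn_integral_cmult) measurable
    also have "(\<integral>\<^sup>+y. (\<Prod>j<n. ennreal (exp (\<sigma> * y j))) \<partial>?P) = (\<Prod>j<n. \<integral>\<^sup>+x. ennreal (exp (\<sigma> * x)) \<partial>sign_unif)"
      by (rule SGP.product_nn_integral_prod) (auto simp: sign_unif_def)
    also have "\<dots> \<le> (\<Prod>j<n. ennreal (exp (\<sigma>\<^sup>2)))"
      using \<sigma> by (intro prod_mono_ennreal sign_mgf) auto
    also have "ennreal (exp (- t * (\<epsilon> * n))) * \<dots> = ennreal (exp (- t * (\<epsilon> * n) + n * \<sigma>\<^sup>2))"
      by (simp add: ennreal_power mult_exp_exp flip: ennreal_mult exp_of_nat_mult)
    also have "- t * (\<epsilon> * n) + n * \<sigma>\<^sup>2 = - (\<epsilon>\<^sup>2 * n / 4)"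
      unfolding \<sigma>(2) by (simp add: t_def power2_eq_square field_simps)
    finally show "(\<integral>\<^sup>+y. ennreal (exp (s * t * (\<Sum>j<n. y j) - t * (\<epsilon> * n))) \<partial>?P) \<le> ennreal (exp (- (\<epsilon>\<^sup>2 * n / 4)))"
      by (simp add: \<sigma>_def mult_left_mono)
  qed (use t in \<open>auto intro: measurable_sign_component\<close>)
qed

interpretation LBP: product_sigma_finite "\<lambda>_. lborel :: real measure" by standard

text \<open>A cube of side \<open>1 / d\<close> fits into the ball, and the ball into the cube with
  sides \<open>{-1..1}\<close>; this is what makes the normalised measure on the ball a
  probability.\<close>

lemma unit_ball_emeasure:
  fixes d :: nat
  assumes d: "1 \<le> d"
  defines "B \<equiv> {x \<in> space (PiM {..<d} (\<lambda>_. lborel :: real measure)). (\<Sum>j<d. (x j)\<^sup>2) \<le> 1}"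
  shows "B \<in> sets (PiM {..<d} (\<lambda>_. lborel))"
    and "emeasure (PiM {..<d} (\<lambda>_. lborel)) B \<noteq> 0" and "emeasure (PiM {..<d} (\<lambda>_. lborel)) B < \<infinity>"
proof -
  let ?P = "PiM {..<d} (\<lambda>_. lborel :: real measure)"
  show B: "B \<in> sets ?P" unfolding B_def by measurable
  have "PiE {..<d} (\<lambda>_. {0..1 / real d}) \<subseteq> B"
  proof
    fix x assume x: "x \<in> PiE {..<d} (\<lambda>_. {0..1 / real d})"
    have "(\<Sum>j<d. (x j)\<^sup>2) \<le> (\<Sum>j<d. (1 / real d)\<^sup>2)"
      using x by (intro sum_mono power_mono) (auto simp: PiE_iff)
    also have "\<dots> = 1 / d" using d by (simp add: power2_eq_square)
    also have "\<dots> \<le> 1" using d by simp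
    finally show "x \<in> B" using x by (auto simp: B_def space_PiM PiE_iff)
  qed
  then have "emeasure ?P (PiE {..<d} (\<lambda>_. {0..1 / real d})) \<le> emeasure ?P B"
    by (intro emeasure_mono B)
  moreover have "emeasure ?P (PiE {..<d} (\<lambda>_. {0..1 / real d})) = ennreal ((1 / real d) ^ d)"
    by (subst LBP.emeasure_PiM) (auto simp: ennreal_power)
  moreover have "0 < ennreal ((1 / real d) ^ d)" using d by simp
  ultimately show "emeasure ?P B \<noteq> 0" by (metis leD)
  have "B \<subseteq> PiE {..<d} (\<lambda>_. {-1..1})"
  proof
    fix x assume x: "x \<in> B"
    have "x j \<in> {-1..1}" if j: "j < d" for j
    proof -
      have "(x j)\<^sup>2 \<le> (\<Sum>j<d. (x j)\<^sup>2)" using j by (intro member_le_sum) auto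
      then have "(x j)\<^sup>2 \<le> 1" using x by (simp add: B_def)
      then show ?thesis by (simp add: abs_square_le_1 abs_le_iff)
    qed
    then show "x \<in> PiE {..<d} (\<lambda>_. {-1..1})" using x by (auto simp: B_def space_PiM PiE_iff)
  qed
  then have "emeasure ?P B \<le> emeasure ?P (PiE {..<d} (\<lambda>_. {-1..1}))"
    by (intro emeasure_mono) auto
  also have "\<dots> = ennreal (2 ^ d)"
    by (subst LBP.emeasure_PiM) (auto simp flip: ennreal_power)
  also have "\<dots> < \<infinity>" by simp
  finally show "emeasure ?P B < \<infinity>" .
qed

lemma measurable_radial_projection [measurable]:
  "(\<lambda>x. \<lambda>j\<in>{..<d}. R * x j / sqrt (\<Sum>k<d. (x k)\<^sup>2)) \<in> measurable (unit_ball_unif d) (PiM {..<d} (\<lambda>_. borel))"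
  unfolding unit_ball_unif_def by (intro measurable_restrict) measurable

lemma prob_space_sphere_unif:
  assumes "1 \<le> d"
  shows "prob_space (sphere_unif d R)"
  unfolding sphere_unif_def
proof (rule prob_space.prob_space_distr)
  show "prob_space (unit_ball_unif d)"
    unfolding unit_ball_unif_def using unit_ball_emeasure[OF assms]
    by (intro prob_space_uniform_measure) (auto simp: less_top[symmetric])
qed measurable

text \<open>Division by zero sends the origin to the zero vector, where the identity may fail; for
  \<open>d \<ge> 1\<close> the origin is a null set.\<close>

lemma AE_sphere_norm:
  assumes d: "1 \<le> d"
  shows "AE \<mu> in sphere_unif d R. sqn d \<mu> = R\<^sup>2"
proof -
  let ?P = "PiM {..<d} (\<lambda>_. lborel :: real measure)"
  have "AE x in ?P. (\<Sum>k<d. (x k)\<^sup>2) \<noteq> 0"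
  proof (rule AE_I')
    have "emeasure ?P (PiE {..<d} (\<lambda>_. {0})) = 0"
      using d by (subst LBP.emeasure_PiM) (auto simp: prod_zero_iff lessThan_empty_iff)
    moreover have "PiE {..<d} (\<lambda>_. {0}) \<in> sets ?P" by (intro sets_PiM_I_finite) auto
    ultimately show "PiE {..<d} (\<lambda>_. {0}) \<in> null_sets ?P" by (rule null_setsI)
    show "{x \<in> space ?P. \<not> (\<Sum>k<d. (x k)\<^sup>2) \<noteq> 0} \<subseteq> PiE {..<d} (\<lambda>_. {0})"
      by (auto simp: space_PiM PiE_iff sum_nonneg_eq_0_iff extensional_def fun_eq_iff)
  qed
  then have "AE x in unit_ball_unif d. (\<Sum>k<d. (x k)\<^sup>2) \<noteq> 0"
    unfolding unit_ball_unif_def using unit_ball_emeasure[OF d] by (subst AE_uniform_measure) auto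
  then have "AE x in unit_ball_unif d. sqn d (\<lambda>j\<in>{..<d}. R * x j / sqrt (\<Sum>k<d. (x k)\<^sup>2)) = R\<^sup>2"
  proof eventually_elim
    case (elim x)
    define N where "N = (\<Sum>k<d. (x k)\<^sup>2)"
    have N: "0 < N" using elim by (auto simp: N_def less_le sum_nonneg)
    have "sqn d (\<lambda>j\<in>{..<d}. R * x j / sqrt N) = (\<Sum>j<d. R\<^sup>2 / N * (x j)\<^sup>2)"
      unfolding ip_def using N by (intro sum.cong) (auto simp: power2_eq_square)
    also have "\<dots> = R\<^sup>2 / N * N" by (simp add: N_def sum_distrib_left)
    finally show ?case using N by (simp add: N_def)
  qed
  then show ?thesis
    unfolding sphere_unif_def
    by (subst AE_distr_iff) (auto simp: ip_def)
qed

section \<open>The expected error\<close>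

context mixture
begin

text \<open>The edges are integrated first, with the features fixed, so \<open>sbm_error_le\<close>
  applies at each good \<open>Z\<close>; what is left are the two transforms bounded by
  \<open>score_mgf\<close>. On bad noise the error is at most 1.\<close>

lemma conditional_expectation_bound:
  fixes \<alpha> \<beta> \<epsilon> E :: real
  assumes E: "0 \<le> E" and \<epsilon>: "4 * \<rho> \<le> \<epsilon>" and sbm: "sbm_error_le n \<alpha> \<beta> \<epsilon> E"
    and signs: "\<forall>j<n. y j = 1 \<or> y j = -1" "\<bar>\<Sum>j<n. y j\<bar> \<le> \<epsilon> * n"
  shows "(\<integral>\<^sup>+Z. (\<integral>\<^sup>+U. ennreal (mismatch n (\<lambda>i. sgn (u_tilde n d (sbm_adj n \<alpha> \<beta> y U) (lz Z) (uz Z) i)) y)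
         \<partial>edge_unif n) \<partial>PZ)
     \<le> ennreal (3 * exp (- 2 * real n) + 4 * exp (- real n) + 2 * exp (Q * (100 * \<rho> - 1/2)) * E)"
proof -
  let ?PU = "edge_unif n"
  interpret PU: prob_space ?PU by (intro prob_space_PiM prob_space_unif01)
  interpret PZ: prob_space PZ by (rule prob_space_gaussians)
  define T where "T i \<sigma> Z = indicator (S i) Z * ennreal (exp (- (Q * (1 + \<sigma>)) * f i Z))" for i \<sigma> Z
  define g where "g i Z = exp (- (Q * (1 - 40 * \<rho>)) * f i Z) + exp (- (Q * (1 + 40 * \<rho>)) * f i Z)" for i Z
  define h where "h s i Z = exp (- (1/2) * score_weight n d (lz Z) * (s * sqrt n * y i * uz Z i))" for s i Z
  define err where "err Z U = mismatch n (\<lambda>i. sgn (u_tilde n d (sbm_adj n \<alpha> \<beta> y U) (lz Z) (uz Z) i)) y" for Z U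
  have T_meas [measurable]: "i < n \<Longrightarrow> T i \<sigma> \<in> borel_measurable PZ" for i \<sigma>
    unfolding T_def S_def f_def by (rule measurable_loo_score)
  have T_int: "(\<integral>\<^sup>+Z. T i \<sigma> Z \<partial>PZ) \<le> ennreal (exp (Q * (100 * \<rho> - 1/2)))"
    if "i < n" "\<sigma> = 40 * \<rho> \<or> \<sigma> = - 40 * \<rho>" for i \<sigma>
    unfolding T_def by (rule score_mgf[OF that])
  \<comment> \<open>The right-hand side is measurable in \<open>Z\<close> and free of
    \<open>eig\<close>; for the left-hand side only monotonicity of the integral is used.\<close>
  have pointwise: "(\<integral>\<^sup>+U. ennreal (err Z U) \<partial>?PU) \<le> indicator {Z \<in> space PZ. \<not> good Z} Z
     + (ennreal (4 * exp (- real n)) + (\<Sum>i<n. ennreal (E / n) * (T i (- 40 * \<rho>) Z + T i (40 * \<rho>) Z)))" if Z: "Z \<in> space PZ" for Z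
  proof (cases "good Z")
    case False
    have "(\<integral>\<^sup>+U. ennreal (err Z U) \<partial>?PU) \<le> (\<integral>\<^sup>+U. 1 \<partial>?PU)"
      using mismatch_bounds(2)[OF n] by (intro nn_integral_mono) (simp add: err_def ennreal_le_1)
    also have "\<dots> = 1" by (simp add: PU.emeasure_space_1)
    also have "\<dots> \<le> indicator {Z \<in> space PZ. \<not> good Z} Z" using False Z by (simp add: indicator_def)
    finally show ?thesis by (rule order_trans) simp
  next
    case True
    obtain s where s: "s = 1 \<or> s = -1" "card {j. j < n \<and> sgn (uz Z j) \<noteq> s * y j} \<le> 4 * \<rho> * n"
      and ex: "\<And>i. i < n \<Longrightarrow> Z \<in> S i \<and> h s i Z
        \<le> g i Z"
      using good_noise_scores[OF True] unfolding g_def h_def by blast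
    have "4 * \<rho> * n \<le> \<epsilon> * n" using \<epsilon> by (intro mult_right_mono) auto
    then have wr: "card {j. j < n \<and> sgn (uz Z j) \<noteq> s * y j} \<le> \<epsilon> * n" using s(2) by linarith
    have "(\<integral>\<^sup>+U. ennreal (err Z U) \<partial>?PU)
        \<le> ennreal (4 * exp (- real n) + (1 / n) * (\<Sum>i<n. h s i Z) * E)"
      unfolding err_def h_def using sbm signs s(1) wr unfolding sbm_error_le_def by blast
    also have "\<dots> \<le> ennreal (4 * exp (- real n) + (\<Sum>i<n. E / n * g i Z))"
    proof (intro ennreal_leI add_left_mono)
      have "(1 / n) * (\<Sum>i<n. h s i Z) * E
          = (\<Sum>i<n. E / n * h s i Z)"
        unfolding sum_distrib_left sum_distrib_right by (intro sum.cong refl) simp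
      also have "\<dots> \<le> (\<Sum>i<n. E / n * g i Z)"
        using ex E by (intro sum_mono mult_left_mono) auto
      finally show "(1 / n) * (\<Sum>i<n. h s i Z) * E
          \<le> (\<Sum>i<n. E / n * g i Z)" .
    qed
    also have "\<dots> = ennreal (4 * exp (- real n)) + (\<Sum>i<n. ennreal (E / n * g i Z))"
    proof -
      have nn: "0 \<le> E / n * g i Z" for i
        unfolding g_def using E by (intro mult_nonneg_nonneg add_nonneg_nonneg) auto
      have "ennreal (4 * exp (- real n) + (\<Sum>i<n. E / n * g i Z))
        = ennreal (4 * exp (- real n)) + ennreal (\<Sum>i<n. E / n * g i Z)"
        by (intro ennreal_plus sum_nonneg nn) simp
      then show ?thesis by (simp only: sum_ennreal[OF nn])
    qed
    also have "\<dots> = ennreal (4 * exp (- real n)) + (\<Sum>i<n. ennreal (E / n) * (T i (- 40 * \<rho>) Z + T i (40 * \<rho>) Z))"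
    proof (intro arg_cong2[where f = "(+)"] refl sum.cong)
      fix i assume "i \<in> {..<n}"
      then have "Z \<in> S i" using ex by auto
      then show "ennreal (E / n * g i Z)
          = ennreal (E / n) * (T i (- 40 * \<rho>) Z + T i (40 * \<rho>) Z)"
        using E by (subst ennreal_mult) (auto simp: T_def g_def)
    qed
    finally show ?thesis by (rule order_trans) simp
  qed
  have badm: "{Z \<in> space PZ. \<not> good Z} \<in> sets PZ" by measurable
  have "(\<integral>\<^sup>+Z. (\<integral>\<^sup>+U. ennreal (err Z U) \<partial>?PU) \<partial>PZ)
     \<le> (\<integral>\<^sup>+Z. indicator {Z \<in> space PZ. \<not> good Z} Z
        + (ennreal (4 * exp (- real n)) + (\<Sum>i<n. ennreal (E / n) * (T i (- 40 * \<rho>) Z + T i (40 * \<rho>) Z))) \<partial>PZ)"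
    by (intro nn_integral_mono pointwise)
  also have "\<dots> = emeasure PZ {Z \<in> space PZ. \<not> good Z}
      + (ennreal (4 * exp (- real n)) + (\<Sum>i<n. ennreal (E / n) * ((\<integral>\<^sup>+Z. T i (- 40 * \<rho>) Z \<partial>PZ) + (\<integral>\<^sup>+Z. T i (40 * \<rho>) Z \<partial>PZ))))"
  proof -
    have "(\<integral>\<^sup>+Z. (\<Sum>i<n. ennreal (E / n) * (T i (- 40 * \<rho>) Z + T i (40 * \<rho>) Z)) \<partial>PZ)
        = (\<Sum>i<n. \<integral>\<^sup>+Z. ennreal (E / n) * (T i (- 40 * \<rho>) Z + T i (40 * \<rho>) Z) \<partial>PZ)"
      by (intro nn_integral_sum) (auto intro!: borel_measurable_times_ennreal borel_measurable_add T_meas)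
    also have "\<dots> = (\<Sum>i<n. ennreal (E / n) * ((\<integral>\<^sup>+Z. T i (- 40 * \<rho>) Z \<partial>PZ) + (\<integral>\<^sup>+Z. T i (40 * \<rho>) Z \<partial>PZ)))"
      by (intro sum.cong refl) (simp add: nn_integral_cmult nn_integral_add)
    finally have *: "(\<integral>\<^sup>+Z. (\<Sum>i<n. ennreal (E / n) * (T i (- 40 * \<rho>) Z + T i (40 * \<rho>) Z)) \<partial>PZ)
      = (\<Sum>i<n. ennreal (E / n) * ((\<integral>\<^sup>+Z. T i (- 40 * \<rho>) Z \<partial>PZ) + (\<integral>\<^sup>+Z. T i (40 * \<rho>) Z \<partial>PZ)))" .
    have [measurable]: "(\<lambda>Z. \<Sum>i<n. ennreal (E / n) * (T i (- 40 * \<rho>) Z + T i (40 * \<rho>) Z)) \<in> borel_measurable PZ"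
      by (intro borel_measurable_sum) (auto intro!: borel_measurable_times_ennreal borel_measurable_add T_meas)
    show ?thesis
      using badm by (simp add: nn_integral_add *[simplified] PZ.emeasure_space_1)
  qed
  also have "\<dots> \<le> ennreal (3 * exp (- 2 * real n)) + (ennreal (4 * exp (- real n))
      + (\<Sum>i<n. ennreal (E / n) * (ennreal (exp (Q * (100 * \<rho> - 1/2))) + ennreal (exp (Q * (100 * \<rho> - 1/2))))))"
    by (intro add_mono bad_noise_prob sum_mono mult_left_mono T_int) auto
  also have "\<dots> = ennreal (3 * exp (- 2 * real n) + (4 * exp (- real n) + (\<Sum>i<n. E / n * (2 * exp (Q * (100 * \<rho> - 1/2))))))"
  proof -
    have "ennreal (E / n) * (ennreal (exp (Q * (100 * \<rho> - 1/2))) + ennreal (exp (Q * (100 * \<rho> - 1/2))))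
        = ennreal (E / n * (2 * exp (Q * (100 * \<rho> - 1/2))))"
    proof -
      have "ennreal x + ennreal x = ennreal (2 * x)" if "0 \<le> x" for x
        using that by (simp flip: ennreal_plus)
      then show ?thesis using E by (subst ennreal_mult) auto
    qed
    then show ?thesis using E by (simp add: ennreal_plus sum_nonneg sum_ennreal del: sum_constant)
  qed
  also have "(\<Sum>i<n. E / n * (2 * exp (Q * (100 * \<rho> - 1/2)))) = 2 * exp (Q * (100 * \<rho> - 1/2)) * E"
    using n_pos by simp
  finally show ?thesis by (simp add: err_def add.assoc)
qed

end

section \<open>Averaging over labels and mean vector\<close>

lemma prob_space_csbm: "1 \<le> d \<Longrightarrow> prob_space (csbm_space n d R)"
  unfolding csbm_space_def
  by (intro prob_space_pair prob_space_PiM prob_space_sign_unif prob_space_sphere_unif prob_space_unif01 prob_space_std_normal)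

text \<open>The error is a multiple of \<open>1 / n\<close>, so a nonzero value is at least
  \<open>1 / n\<close>. This discreteness later turns the bound on the expectation into exact
  recovery.\<close>

lemma csbm_error_bounds:
  assumes "1 \<le> n"
  shows "0 \<le> csbm_error n d \<alpha> \<beta> eig \<omega>" "csbm_error n d \<alpha> \<beta> eig \<omega> \<le> 1"
    and "csbm_error n d \<alpha> \<beta> eig \<omega> \<noteq> 0 \<Longrightarrow> 1 \<le> n * csbm_error n d \<alpha> \<beta> eig \<omega>"
proof -
  obtain y \<mu> U Z where \<omega>: "\<omega> = (y, \<mu>, U, Z)" by (cases \<omega>)
  obtain w where w: "csbm_error n d \<alpha> \<beta> eig \<omega> = mismatch n w y"
    by (auto simp: csbm_error_def \<omega> Let_def)
  show "0 \<le> csbm_error n d \<alpha> \<beta> eig \<omega>" "csbm_error n d \<alpha> \<beta> eig \<omega> \<le> 1"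
    unfolding w using mismatch_bounds[OF assms] by auto
  assume "csbm_error n d \<alpha> \<beta> eig \<omega> \<noteq> 0"
  then show "1 \<le> n * csbm_error n d \<alpha> \<beta> eig \<omega>"
    unfolding w mismatch_def using assms by (auto simp: min_def)
qed

text \<open>Fubini on the sample space, for which joint measurability of the error is assumed.
  Unbalanced labels are charged the trivial error 1, and \<open>sign_balance\<close> produces the
  first term.\<close>

lemma csbm_expectation_bound:
  fixes \<alpha> \<beta> \<epsilon> \<rho> Q E R :: real
  assumes n: "1 \<le> n" and d: "1 \<le> d" and snr: "R ^ 4 / (R\<^sup>2 + real d / real n) = Q"
    and \<rho>: "0 < \<rho>" "\<rho> \<le> 1 / 100" "1 \<le> \<rho>\<^sup>2 * n" "7 \<le> \<rho> * n" and Q: "57600 / (\<rho> / 7)\<^sup>2 \<le> Q"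
    and eig: "\<forall>n\<ge>1. \<forall>G. sym_mat n G \<longrightarrow> top_eigpair n G (fst (eig n G)) (snd (eig n G))"
    and meas: "csbm_error n d \<alpha> \<beta> eig \<in> borel_measurable (csbm_space n d R)"
    and E: "0 \<le> E" and \<epsilon>: "4 * \<rho> \<le> \<epsilon>" "\<epsilon> \<le> 1"
    and sbm: "sbm_error_le n \<alpha> \<beta> \<epsilon> E"
  shows "(\<integral>\<^sup>+\<omega>. ennreal (csbm_error n d \<alpha> \<beta> eig \<omega>) \<partial>csbm_space n d R)
    \<le> ennreal (2 * exp (- (\<epsilon>\<^sup>2 * n / 4)) + (3 * exp (- 2 * real n) + 4 * exp (- real n) + 2 * exp (Q * (100 * \<rho> - 1/2)) * E))"
proof -
  define Y where "Y = PiM {..<n} (\<lambda>_. sign_unif)"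
  define PU where "PU = edge_unif n"
  define PZ where "PZ = gaussians ({..<n} \<times> {..<d})"
  define K where "K = 3 * exp (- 2 * real n) + 4 * exp (- real n) + 2 * exp (Q * (100 * \<rho> - 1/2)) * E"
  define F where "F \<omega> = ennreal (csbm_error n d \<alpha> \<beta> eig \<omega>)" for \<omega>
  have space: "csbm_space n d R = Y \<Otimes>\<^sub>M (sphere_unif d R \<Otimes>\<^sub>M (PU \<Otimes>\<^sub>M PZ))"
    by (simp add: csbm_space_def Y_def PU_def PZ_def)
  interpret Y: prob_space Y unfolding Y_def by (intro prob_space_PiM prob_space_sign_unif)
  interpret PU: prob_space PU unfolding PU_def by (intro prob_space_PiM prob_space_unif01)
  interpret PZ: prob_space PZ unfolding PZ_def by (rule prob_space_gaussians)
  interpret SP: prob_space "sphere_unif d R" by (rule prob_space_sphere_unif[OF d])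
  interpret UZ: pair_prob_space PU PZ ..
  interpret SUZ: prob_space "sphere_unif d R \<Otimes>\<^sub>M (PU \<Otimes>\<^sub>M PZ)"
    by (intro prob_space_pair SP.prob_space_axioms UZ.prob_space_axioms)
  have K: "0 \<le> K" using E by (auto simp: K_def)
  have Qp: "0 < Q" using Q \<rho> by (smt (verit) divide_pos_pos zero_less_power)
  have r2: "0 < R\<^sup>2" using snr Qp by (cases "R = 0") auto
  have snr': "(R\<^sup>2)\<^sup>2 = Q * (R\<^sup>2 + d / n)"
  proof -
    have "0 < R\<^sup>2 + d / n" using r2 by (simp add: add_pos_nonneg)
    then show ?thesis using snr by (simp add: field_simps)
  qed
  have Fm: "F \<in> borel_measurable (Y \<Otimes>\<^sub>M (sphere_unif d R \<Otimes>\<^sub>M (PU \<Otimes>\<^sub>M PZ)))"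
    using meas unfolding F_def space by simp
  have F1: "F \<omega> \<le> 1" for \<omega> using csbm_error_bounds(2)[OF n] by (simp add: F_def ennreal_le_1)
  have inner: "(\<integral>\<^sup>+w. F (y, w) \<partial>(sphere_unif d R \<Otimes>\<^sub>M (PU \<Otimes>\<^sub>M PZ))) \<le> ennreal K"
    if y: "y \<in> space Y" "\<forall>j<n. y j = 1 \<or> y j = -1" "\<bar>\<Sum>j<n. y j\<bar> \<le> \<epsilon> * n" for y
  proof -
    have Fy: "(\<lambda>w. F (y, w)) \<in> borel_measurable (sphere_unif d R \<Otimes>\<^sub>M (PU \<Otimes>\<^sub>M PZ))"
      using measurable_compose[OF measurable_Pair1'[OF y(1)] Fm] .
    have "(\<integral>\<^sup>+w. F (y, w) \<partial>(sphere_unif d R \<Otimes>\<^sub>M (PU \<Otimes>\<^sub>M PZ)))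
        = (\<integral>\<^sup>+\<mu>. (\<integral>\<^sup>+v. F (y, \<mu>, v) \<partial>(PU \<Otimes>\<^sub>M PZ)) \<partial>sphere_unif d R)"
      using UZ.nn_integral_fst[OF Fy] by simp
    also have "\<dots> \<le> (\<integral>\<^sup>+\<mu>. ennreal K \<partial>sphere_unif d R)"
    proof (rule nn_integral_mono_AE)
      show "AE \<mu> in sphere_unif d R. (\<integral>\<^sup>+v. F (y, \<mu>, v) \<partial>(PU \<Otimes>\<^sub>M PZ)) \<le> ennreal K"
        using AE_sphere_norm[OF d, of R] AE_space
      proof eventually_elim
        case (elim \<mu>)
        have Fv: "(\<lambda>v. F (y, \<mu>, v)) \<in> borel_measurable (PU \<Otimes>\<^sub>M PZ)"
          using measurable_compose[OF measurable_Pair1'[OF elim(2)] Fy] .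
        interpret M: mixture n d y \<mu> "R\<^sup>2" Q \<rho> eig
          using n d y elim r2 \<rho> snr' Q eig by unfold_locales (auto simp: power2_eq_1_iff)
        have Feq: "F (y, \<mu>, U, Z) = ennreal (mismatch n (\<lambda>i. sgn (u_tilde n d (sbm_adj n \<alpha> \<beta> y U) (M.lz Z) (M.uz Z) i)) y)" for U Z
          by (simp add: F_def csbm_error_def Let_def M.lz_def M.uz_def gram_def)
        have "(\<integral>\<^sup>+v. F (y, \<mu>, v) \<partial>(PU \<Otimes>\<^sub>M PZ)) = (\<integral>\<^sup>+Z. (\<integral>\<^sup>+U. F (y, \<mu>, U, Z) \<partial>PU) \<partial>PZ)"
          using UZ.nn_integral_snd[OF Fv] by simp
        also have "\<dots> \<le> ennreal K"
          unfolding Feq K_def PU_def PZ_def using sbm y E \<epsilon>(1)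
          by (intro M.conditional_expectation_bound)
        finally show ?case .
      qed
    qed
    also have "\<dots> = ennreal K" by (simp add: SP.emeasure_space_1)
    finally show ?thesis .
  qed
  have ym: "{y \<in> space Y. \<epsilon> * n < \<bar>\<Sum>j<n. y j\<bar>} \<in> sets Y"
  proof -
    note measurable_sign_component[measurable]
    show ?thesis unfolding Y_def by measurable
  qed
  have "(\<integral>\<^sup>+\<omega>. F \<omega> \<partial>csbm_space n d R) = (\<integral>\<^sup>+y. (\<integral>\<^sup>+w. F (y, w) \<partial>(sphere_unif d R \<Otimes>\<^sub>M (PU \<Otimes>\<^sub>M PZ))) \<partial>Y)"
    unfolding space by (rule SUZ.nn_integral_fst[symmetric, OF Fm])
  also have "\<dots> \<le> (\<integral>\<^sup>+y. indicator {y \<in> space Y. \<epsilon> * n < \<bar>\<Sum>j<n. y j\<bar>} y + ennreal K \<partial>Y)"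
  proof (rule nn_integral_mono_AE)
    show "AE y in Y. (\<integral>\<^sup>+w. F (y, w) \<partial>(sphere_unif d R \<Otimes>\<^sub>M (PU \<Otimes>\<^sub>M PZ)))
        \<le> indicator {y \<in> space Y. \<epsilon> * n < \<bar>\<Sum>j<n. y j\<bar>} y + ennreal K"
      using AE_signs[of n, folded Y_def] AE_space
    proof eventually_elim
      case (elim y)
      show ?case
      proof (cases "\<bar>\<Sum>j<n. y j\<bar> \<le> \<epsilon> * n")
        case True
        then show ?thesis using inner[OF elim(2,1)] by (simp add: add_increasing)
      next
        case False
        have "(\<integral>\<^sup>+w. F (y, w) \<partial>(sphere_unif d R \<Otimes>\<^sub>M (PU \<Otimes>\<^sub>M PZ))) \<le> (\<integral>\<^sup>+w. 1 \<partial>(sphere_unif d R \<Otimes>\<^sub>M (PU \<Otimes>\<^sub>M PZ)))"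
          by (intro nn_integral_mono F1)
        also have "\<dots> = 1" by (simp add: SUZ.emeasure_space_1)
        also have "\<dots> \<le> indicator {y \<in> space Y. \<epsilon> * n < \<bar>\<Sum>j<n. y j\<bar>} y + ennreal K"
          using False elim(2) by (simp add: indicator_def)
        finally show ?thesis .
      qed
    qed
  qed
  also have "\<dots> = emeasure Y {y \<in> space Y. \<epsilon> * n < \<bar>\<Sum>j<n. y j\<bar>} + ennreal K"
    using ym by (simp add: nn_integral_add Y.emeasure_space_1)
  also have "\<dots> \<le> ennreal (2 * exp (- (\<epsilon>\<^sup>2 * n / 4))) + ennreal K"
    unfolding Y_def using \<epsilon> \<rho> by (intro add_right_mono sign_balance) auto
  also have "\<dots> = ennreal (2 * exp (- (\<epsilon>\<^sup>2 * n / 4)) + K)" using K by simp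
  finally show ?thesis by (simp add: F_def K_def)
qed

section \<open>Choice of the remaining constants and passage to the limit\<close>

lemma csbm_expectation_exponent:
  fixes a b c :: real and q R :: "nat \<Rightarrow> real" and d :: "nat \<Rightarrow> nat"
    and eig :: "nat \<Rightarrow> (nat \<Rightarrow> nat \<Rightarrow> real) \<Rightarrow> real \<times> (nat \<Rightarrow> real)"
  assumes abc: "a > 0" "b > 0" "c > 0"
    and qlim: "filterlim q at_top sequentially"
    and qle: "\<forall>n\<ge>1. q n \<le> ln (real n)"
    and d: "\<forall>n\<ge>1. d n \<ge> 2"
    and snr: "\<forall>n\<ge>1. R n ^ 4 / ((R n)\<^sup>2 + real (d n) / real n) = c * q n"
    and eig: "\<forall>n\<ge>1. \<forall>G. sym_mat n G \<longrightarrow> top_eigpair n G (fst (eig n G)) (snd (eig n G))"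
    and meas: "\<forall>n. csbm_error n (d n) (a * q n / real n) (b * q n / real n) eig
                   \<in> borel_measurable (csbm_space n (d n) (R n))"
    and \<delta>: "0 < \<delta>"
  shows "\<forall>\<^sub>F n in sequentially.
     (\<integral>\<^sup>+\<omega>. ennreal (csbm_error n (d n) (a * q n / real n) (b * q n / real n) eig \<omega>) \<partial>csbm_space n (d n) (R n))
      \<le> ennreal (exp (q n * (\<delta> - Istar a b c)))"
proof -
  obtain \<epsilon>0 where \<epsilon>0: "0 < \<epsilon>0" and sbm: "\<forall>\<^sub>F n in sequentially.
      sbm_error_le n (a * q n / n) (b * q n / n) \<epsilon>0 (exp (q n * (\<delta> / 4 - (sqrt a - sqrt b)\<^sup>2 / 2)))"
    by (rule sbm_error_bound[OF abc(1,2) qlim qle, of "\<delta> / 4"]) (use \<delta> in simp)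
  define \<epsilon> where "\<epsilon> = min 1 \<epsilon>0"
  \<comment> \<open>Three demands: the standing bound \<open>1 / 100\<close>;
    \<open>4 * \<rho> \<le> \<epsilon>\<close>, so that the wrong signs of the eigenvector are
    within the range of the graph bound; and
    \<open>c * (100 * \<rho>) \<le> \<delta> / 4\<close>.\<close>
  define \<rho> where "\<rho> = min (1 / 100) (min (\<epsilon> / 4) (\<delta> / (400 * c)))"
  have \<epsilon>: "0 < \<epsilon>" "\<epsilon> \<le> 1" "\<epsilon> \<le> \<epsilon>0" using \<epsilon>0 by (auto simp: \<epsilon>_def)
  have "\<rho> \<le> \<delta> / (400 * c)" "\<rho> \<le> \<epsilon> / 4" by (simp_all add: \<rho>_def)
  moreover have "0 < 400 * c" using abc by simp
  ultimately have \<rho>c: "\<rho> * (400 * c) \<le> \<delta>" "4 * \<rho> \<le> \<epsilon>" by (simp_all only: pos_le_divide_eq)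
  have "0 < \<epsilon> / 4" "0 < \<delta> / (400 * c)" using \<epsilon>(1) \<delta> abc(3) by simp_all
  then have \<rho>: "0 < \<rho>" "\<rho> \<le> 1 / 100" unfolding \<rho>_def min_less_iff_conj by auto
  have \<rho>c: "4 * \<rho> \<le> \<epsilon>" "c * (100 * \<rho>) \<le> \<delta> / 4" using \<rho>c by (simp_all add: mult.commute mult.left_commute)
  define \<kappa> where "\<kappa> = \<epsilon>\<^sup>2 / 4"
  have "\<epsilon>\<^sup>2 \<le> 1" using \<epsilon> by (intro power_le_one) auto
  then have \<kappa>: "0 < \<kappa>" "\<kappa> \<le> 1" using \<epsilon> by (auto simp: \<kappa>_def)
  define I where "I = Istar a b c"
  have I: "0 \<le> I" using abc by (simp add: I_def Istar_def)
  have qbig: "\<forall>\<^sub>F n in sequentially. x \<le> q n" for x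
    using qlim by (simp add: filterlim_at_top)
  have nbig: "\<forall>\<^sub>F n in sequentially. x \<le> real n" for x
    using filterlim_real_sequentially by (simp add: filterlim_at_top)
  \<comment> \<open>Terms exponentially small in \<open>n\<close> are negligible against
    \<open>exp (- I * q n)\<close> because \<open>q n \<le> ln n\<close>.\<close>
  have lnsmall: "\<forall>\<^sub>F n in sequentially. I * ln (real n) \<le> \<kappa> / 2 * n"
  proof -
    have "(\<lambda>n. I * (ln (real n) / n)) \<longlonglongrightarrow> I * 0" by (intro tendsto_mult tendsto_const lim_ln_over_n)
    then have "\<forall>\<^sub>F n in sequentially. I * (ln (real n) / n) < \<kappa> / 2"
      using \<kappa> by (intro order_tendstoD(2)[of _ "I * 0"]) auto
    then show ?thesis
      using eventually_gt_at_top[of 0]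
    proof eventually_elim
      case (elim n)
      then show ?case by (simp add: field_simps)
    qed
  qed
  show ?thesis
    using sbm qbig[of 0] qbig[of "57600 / (\<rho> / 7)\<^sup>2 / c"] qbig[of "2 * ln 4 / \<delta>"]
      nbig[of 1] nbig[of "1 / \<rho>\<^sup>2"] nbig[of "7 / \<rho>"] nbig[of "2 * ln 18 / \<kappa>"] lnsmall
  proof eventually_elim
    case (elim n)
    have n: "1 \<le> n" using elim(5) by simp
    define E where "E = exp (q n * (\<delta> / 4 - (sqrt a - sqrt b)\<^sup>2 / 2))"
    have "(\<integral>\<^sup>+\<omega>. ennreal (csbm_error n (d n) (a * q n / real n) (b * q n / real n) eig \<omega>) \<partial>csbm_space n (d n) (R n))
      \<le> ennreal (2 * exp (- (\<epsilon>\<^sup>2 * n / 4)) + (3 * exp (- 2 * real n) + 4 * exp (- real n) + 2 * exp (c * q n * (100 * \<rho> - 1/2)) * E))"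
    proof (rule csbm_expectation_bound[OF n _ _ \<rho>(1,2) _ _ _ eig _ _ \<rho>c(1) \<epsilon>(2)])
      show "1 \<le> d n" using d n by force
      show "R n ^ 4 / ((R n)\<^sup>2 + real (d n) / real n) = c * q n" using snr n by blast
      show "1 \<le> \<rho>\<^sup>2 * n" "7 \<le> \<rho> * n" using elim(6,7) \<rho>(1) by (auto simp: pos_divide_le_eq mult.commute)
      show "57600 / (\<rho> / 7)\<^sup>2 \<le> c * q n"
        using elim(3) abc(3) unfolding pos_divide_le_eq[OF abc(3)] by (simp only: mult.commute)
      show "csbm_error n (d n) (a * q n / real n) (b * q n / real n) eig \<in> borel_measurable (csbm_space n (d n) (R n))"
        using meas by blast
      show "0 \<le> E" by (simp add: E_def)
      show "sbm_error_le n (a * q n / n) (b * q n / n) \<epsilon> E"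
        unfolding E_def by (rule sbm_error_le_mono[OF elim(1) \<epsilon>(3)])
    qed
    also have "\<dots> \<le> ennreal (exp (q n * (\<delta> - I)))"
    proof (rule ennreal_leI)
      \<comment> \<open>The rare events contribute at most \<open>2 + 3 + 4 = 9\<close> times
        \<open>exp (- (\<kappa> * n))\<close>, to be at most half of the target, hence the 18 in
        \<open>e3\<close>. The main term carries a factor 2 and receives the other half, hence the 4
        in \<open>e4\<close>.\<close>
      have e1: "exp (- (\<epsilon>\<^sup>2 * n / 4)) = exp (- (\<kappa> * n))" by (simp add: \<kappa>_def)
      have \<kappa>n: "\<kappa> * n \<le> n" using \<kappa> by (simp add: mult_left_le_one_le)
      have e2: "exp (- 2 * real n) \<le> exp (- (\<kappa> * n))" "exp (- real n) \<le> exp (- (\<kappa> * n))" using \<kappa>n by auto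
      have e3: "18 * exp (- (\<kappa> * n)) \<le> exp (q n * (\<delta> - I))"
      proof -
        have "ln 18 \<le> \<kappa> / 2 * n" using elim(8) \<kappa> by (simp add: pos_divide_le_eq mult.commute)
        moreover have "I * q n \<le> \<kappa> / 2 * n" using elim(9) qle n I mult_left_mono[of "q n" "ln n" I] by force
        moreover have "0 \<le> q n * \<delta>" using elim(2) \<delta> by simp
        moreover have "\<kappa> / 2 * n + \<kappa> / 2 * n = \<kappa> * n" by simp
        ultimately have "ln 18 + - (\<kappa> * n) \<le> q n * (\<delta> - I)"
          unfolding right_diff_distrib using mult.commute[of I "q n"] by linarith
        then have "exp (ln 18 + - (\<kappa> * n)) \<le> exp (q n * (\<delta> - I))" by simp
        then show ?thesis by (simp add: exp_add exp_minus divide_inverse exp_diff)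
      qed
      have e4: "4 * (exp (c * q n * (100 * \<rho> - 1/2)) * E) \<le> exp (q n * (\<delta> - I))"
      proof -
        have "c * q n * (100 * \<rho> - 1/2) + q n * (\<delta> / 4 - (sqrt a - sqrt b)\<^sup>2 / 2)
            = q n * (c * (100 * \<rho>) + \<delta> / 4 - I)"
          by (simp add: I_def Istar_def algebra_simps add_divide_distrib)
        \<comment> \<open>Graph and features have each used \<open>\<delta> / 4\<close>; the
          remaining \<open>\<delta> / 2\<close> absorbs the factor 4.\<close>
        also have "\<dots> \<le> q n * (\<delta> / 2 - I)" using \<rho>c(2) elim(2) by (intro mult_left_mono) auto
        finally have "exp (c * q n * (100 * \<rho> - 1/2)) * E \<le> exp (q n * (\<delta> / 2 - I))"
          unfolding E_def mult_exp_exp by simp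
        moreover have "4 \<le> exp (q n * (\<delta> / 2))"
        proof -
          have "ln 4 \<le> q n * (\<delta> / 2)" using elim(4) \<delta> by (simp add: pos_divide_le_eq mult.commute)
          then have "exp (ln 4) \<le> exp (q n * (\<delta> / 2))" by (simp only: exp_le_cancel_iff)
          then show ?thesis by simp
        qed
        ultimately have "4 * (exp (c * q n * (100 * \<rho> - 1/2)) * E) \<le> exp (q n * (\<delta> / 2)) * exp (q n * (\<delta> / 2 - I))"
          by (intro mult_mono) (auto simp: E_def)
        also have "\<dots> = exp (q n * (\<delta> - I))" by (simp add: mult_exp_exp algebra_simps)
        finally show ?thesis .
      qed
      show "2 * exp (- (\<epsilon>\<^sup>2 * n / 4)) + (3 * exp (- 2 * real n) + 4 * exp (- real n) + 2 * exp (c * q n * (100 * \<rho> - 1/2)) * E)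
        \<le> exp (q n * (\<delta> - I))"
        unfolding e1 using e2 e3 e4 by linarith
    qed
    finally show ?case by (simp add: I_def)
  qed
qed

text \<open>A single bound on the expectation, valid for every \<open>\<delta> > 0\<close>, yields
  both halves: the first as \<open>\<delta>\<close> tends to 0, the second by Markov's inequality.
  \<open>eig\<close> is any selection of top eigenpairs, with arbitrary signs; such a selection may
  fail to be measurable, so measurability of the error is a hypothesis. A vanishing expectation has
  logarithm \<open>- \<infinity>\<close>, which the real-valued \<open>ln\<close> cannot
  express.\<close>

theorem theorem4p4:
  fixes a b c :: real and q R :: "nat \<Rightarrow> real" and d :: "nat \<Rightarrow> nat"
    and eig :: "nat \<Rightarrow> (nat \<Rightarrow> nat \<Rightarrow> real) \<Rightarrow> real \<times> (nat \<Rightarrow> real)"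
  assumes "a > 0" and "b > 0" and "c > 0" and "a \<noteq> b"
    and "filterlim q at_top sequentially"
    and "\<forall>n\<ge>1. q n \<le> ln (real n)"
    and "\<forall>n\<ge>1. d n \<ge> 2"
    and "\<forall>n\<ge>1. R n ^ 4 / ((R n)\<^sup>2 + real (d n) / real n) = c * q n"
    and eig: "\<forall>n\<ge>1. \<forall>G. sym_mat n G \<longrightarrow> top_eigpair n G (fst (eig n G)) (snd (eig n G))"
    and meas: "\<forall>n. csbm_error n (d n) (a * q n / real n) (b * q n / real n) eig
                   \<in> borel_measurable (csbm_space n (d n) (R n))"
  shows "(limsup (\<lambda>n. let E = (\<integral>\<omega>. csbm_error n (d n) (a * q n / real n) (b * q n / real n) eig \<omega>
                                   \<partial>csbm_space n (d n) (R n))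
                     in if E = 0 then - \<infinity> else ereal (ln E / q n))
           \<le> ereal (- Istar a b c)) \<and>
         ((\<forall>n\<ge>1. q n = ln (real n)) \<and> Istar a b c > 1 \<longrightarrow>
         ((\<lambda>n. measure (csbm_space n (d n) (R n))
                 {\<omega> \<in> space (csbm_space n (d n) (R n)).
                    csbm_error n (d n) (a * q n / real n) (b * q n / real n) eig \<omega> = 0})
          \<longlonglongrightarrow> 1))"
proof -
  define M where "M n = csbm_space n (d n) (R n)" for n
  define err where "err n = csbm_error n (d n) (a * q n / real n) (b * q n / real n) eig" for n
  define I where "I = Istar a b c"
  have err_meas [measurable]: "err n \<in> borel_measurable (M n)" for n
    using meas by (simp add: err_def M_def)
  have prob: "prob_space (M n)" if "1 \<le> n" for n
    unfolding M_def using assms(7) that by (intro prob_space_csbm) force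
  have bound: "\<forall>\<^sub>F n in sequentially. (\<integral>\<^sup>+\<omega>. ennreal (err n \<omega>) \<partial>M n) \<le> ennreal (exp (q n * (\<delta> - I)))"
    if "0 < \<delta>" for \<delta>
    unfolding err_def M_def I_def
    using csbm_expectation_exponent[OF assms(1-3,5-8) eig meas that] .
  have "limsup (\<lambda>n. let E = (\<integral>\<omega>. err n \<omega> \<partial>M n) in if E = 0 then - \<infinity> else ereal (ln E / q n)) \<le> ereal (- I)"
  proof (rule ereal_le_epsilon2)
    fix \<delta> :: real assume \<delta>: "0 < \<delta>"
    have "\<forall>\<^sub>F n in sequentially. 1 \<le> q n" using assms(5) by (simp add: filterlim_at_top)
    with bound[OF \<delta>] eventually_ge_at_top[of 1]
    have "\<forall>\<^sub>F n in sequentially. (let E = (\<integral>\<omega>. err n \<omega> \<partial>M n) in if E = 0 then - \<infinity> else ereal (ln E / q n)) \<le> ereal (- I + \<delta>)"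
    proof eventually_elim
      case (elim n)
      define E where "E = (\<integral>\<omega>. err n \<omega> \<partial>M n)"
      have nn: "0 \<le> err n \<omega>" for \<omega> using csbm_error_bounds(1)[OF elim(2)] by (simp add: err_def)
      have "E = enn2real (\<integral>\<^sup>+\<omega>. ennreal (err n \<omega>) \<partial>M n)"
        unfolding E_def by (intro integral_eq_nn_integral) (auto simp: nn)
      also have "\<dots> \<le> exp (q n * (\<delta> - I))" using elim(1) by (intro enn2real_leI) auto
      finally have E: "E \<le> exp (q n * (\<delta> - I))" .
      have "0 \<le> E" unfolding E_def by (intro Bochner_Integration.integral_nonneg nn)
      have "ln E / q n \<le> - I + \<delta>" if "E \<noteq> 0"
      proof -
        have "ln E \<le> ln (exp (q n * (\<delta> - I)))"
          using E that \<open>0 \<le> E\<close> by (subst ln_le_cancel_iff) auto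
        then have "ln E \<le> q n * (\<delta> - I)" by simp
        then show ?thesis using elim(3) by (simp add: pos_divide_le_eq mult.commute)
      qed
      then show ?case by (simp add: Let_def flip: E_def)
    qed
    then have "limsup (\<lambda>n. let E = (\<integral>\<omega>. err n \<omega> \<partial>M n) in if E = 0 then - \<infinity> else ereal (ln E / q n)) \<le> ereal (- I + \<delta>)"
      by (rule Limsup_bounded)
    then show "limsup (\<lambda>n. let E = (\<integral>\<omega>. err n \<omega> \<partial>M n) in if E = 0 then - \<infinity> else ereal (ln E / q n)) \<le> ereal (- I) + ereal \<delta>"
      by simp
  qed
  moreover have "(\<lambda>n. measure (M n) {\<omega> \<in> space (M n). err n \<omega> = 0}) \<longlonglongrightarrow> 1"
    if q: "\<forall>n\<ge>1. q n = ln (real n)" and I1: "1 < I"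
  proof -
    \<comment> \<open>Then \<open>1 + \<delta> - I = - \<delta>\<close>, so \<open>n\<close> times
      the expected error is at most \<open>n\<close> to the power \<open>- \<delta>\<close>.\<close>
    define \<delta> where "\<delta> = (I - 1) / 2"
    have \<delta>: "0 < \<delta>" using I1 by (simp add: \<delta>_def)
    have lo: "\<forall>\<^sub>F n in sequentially. 1 - exp (- \<delta> * ln (real n)) \<le> measure (M n) {\<omega> \<in> space (M n). err n \<omega> = 0}"
      using bound[OF \<delta>] eventually_ge_at_top[of 1]
    proof eventually_elim
      case (elim n)
      interpret prob_space "M n" by (rule prob[OF elim(2)])
      have A: "{\<omega> \<in> space (M n). err n \<omega> = 0} \<in> sets (M n)" by measurable
      have "emeasure (M n) {\<omega> \<in> space (M n). err n \<omega> \<noteq> 0} \<le> (\<integral>\<^sup>+\<omega>. ennreal (real n) * ennreal (err n \<omega>) \<partial>M n)"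
      proof (rule emeasure_le_nn_integral)
        show "{\<omega> \<in> space (M n). err n \<omega> \<noteq> 0} \<in> sets (M n)" by measurable
        fix \<omega> assume "\<omega> \<in> {\<omega> \<in> space (M n). err n \<omega> \<noteq> 0}"
        then have "1 \<le> n * err n \<omega>" using csbm_error_bounds(3)[OF elim(2)] by (auto simp: err_def)
        then show "1 \<le> ennreal (real n) * ennreal (err n \<omega>)"
          by (subst ennreal_mult[symmetric]) (auto simp: err_def csbm_error_bounds(1)[OF elim(2)])
      qed
      also have "\<dots> = ennreal n * (\<integral>\<^sup>+\<omega>. ennreal (err n \<omega>) \<partial>M n)" by (intro nn_integral_cmult) measurable
      also have "\<dots> \<le> ennreal n * ennreal (exp (q n * (\<delta> - I)))" by (intro mult_left_mono elim(1)) auto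
      also have "\<dots> = ennreal (exp (- \<delta> * ln n))"
      proof -
        have "ln n + q n * (\<delta> - I) = - \<delta> * ln n"
          using q elim(2) by (simp add: \<delta>_def field_simps)
        moreover have "real n = exp (ln n)" using elim(2) by simp
        ultimately have "real n * exp (q n * (\<delta> - I)) = exp (- \<delta> * ln n)"
          by (metis exp_add)
        then show ?thesis by (simp flip: ennreal_mult)
      qed
      finally have "measure (M n) {\<omega> \<in> space (M n). err n \<omega> \<noteq> 0} \<le> exp (- \<delta> * ln n)"
        by (simp add: emeasure_eq_measure)
      moreover have "{\<omega> \<in> space (M n). err n \<omega> \<noteq> 0} = space (M n) - {\<omega> \<in> space (M n). err n \<omega> = 0}" by auto
      ultimately show ?case using prob_compl[OF A] by simp
    qed
    have hi: "\<forall>\<^sub>F n in sequentially. measure (M n) {\<omega> \<in> space (M n). err n \<omega> = 0} \<le> 1"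
      using eventually_ge_at_top[of 1]
    proof eventually_elim
      case (elim n)
      interpret prob_space "M n" by (rule prob[OF elim])
      show ?case by simp
    qed
    have "(\<lambda>n. 1 - exp (- \<delta> * ln (real n))) \<longlonglongrightarrow> 1 - 0"
    proof (intro tendsto_diff tendsto_const filterlim_compose[OF exp_at_bot])
      have "filterlim (\<lambda>n. \<delta> * ln (real n)) at_top sequentially"
        using \<delta> by (intro filterlim_tendsto_pos_mult_at_top[OF tendsto_const] filterlim_compose[OF ln_at_top filterlim_real_sequentially])
      then show "filterlim (\<lambda>n. - \<delta> * ln (real n)) at_bot sequentially"
        unfolding filterlim_uminus_at_bot by simp
    qed
    then have "(\<lambda>n. 1 - exp (- \<delta> * ln (real n))) \<longlonglongrightarrow> 1" by simp
    from tendsto_sandwich[OF lo hi this tendsto_const] show ?thesis .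
  qed
  ultimately show ?thesis unfolding err_def M_def I_def by blast
qed

end
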